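(* Let $U$ be a hyperbolic Riemann surface. Let $U'\subset U$ be open and let $f:U'\to U$ be a holomorphic covering map. Assume that there is an open connected set $W\subset U'$ such that $f^n(W)\subset U'$ for all $n\ge 0$. Then, for all $w\in W$, $$\liminf_{n\to\infty} d_U\bigl(f^n(w),\,U\setminus f^n(W)\bigr)>0.$$ Furthermore, let $w\in W$, let $D\subset U$ be open and set $V:=f^{-1}(D)$. Suppose $(n_k)$ is a sequence of positive integers with $n_k\to\infty$ such that $f^{n_k}(w)\in D$ for all $k$ and $d_U(f^{n_k}(w),U\setminus D)\to\infty$ as $k\to\infty$. Then $$d_U\bigl(f^{n_k-1}(w),\,U\setminus V\bigr)\to\infty\qquad (k\to\infty).$$
   Context: Riemann surfaces are not required to be connected: a Riemann surface is a nonempty union of connected Riemann surfaces. A Riemann surface is hyperbolic if each of its connected components is holomorphically universally covered by the unit disc; its hyperbolic metric is the complete conformal metric of constant curvature $-1$, defined componentwise. $d_U$ denotes the hyperbolic distance on $U$ (equal to $\infty$ for points in different components), and $d_U(z,E)=\inf_{\zeta\in E}d_U(z,\zeta)$, with $d_U(z,\emptyset)=\infty$. *)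

theory Defs
  imports "HOL-Complex_Analysis.Complex_Analysis"
begin

section \<open>Riemann surfaces\<close>

text \<open>
  A surface is a set \<open>U\<close> in a Hausdorff space, with the subspace topology, together with a
  holomorphic atlas \<open>A\<close> (not necessarily maximal). A chart is a pair of its domain and its
  coordinate map; the coordinate map is only meaningful on the domain. Surfaces need not be
  connected, and no countability condition is imposed, since a disjoint union of uncountably many
  connected surfaces is allowed.
\<close>

type_synonym 'a chart = "'a set \<times> ('a \<Rightarrow> complex)"

definition riemann_surface :: "'a::t2_space set \<Rightarrow> 'a chart set \<Rightarrow> bool" where
  "riemann_surface U A \<longleftrightarrow>
     U \<noteq> {} \<and>
     (\<Union>(V, \<phi>)\<in>A. V) = U \<and>
     (\<forall>(V, \<phi>)\<in>A. openin (top_of_set U) V \<and> open (\<phi> ` V) \<and>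
                 homeomorphism V (\<phi> ` V) \<phi> (inv_into V \<phi>)) \<and>
     (\<forall>(V, \<phi>)\<in>A. \<forall>(V', \<psi>)\<in>A. (\<psi> \<circ> inv_into V \<phi>) holomorphic_on \<phi> ` (V \<inter> V'))"

definition restrict_atlas :: "'a chart set \<Rightarrow> 'a set \<Rightarrow> 'a chart set" where
  "restrict_atlas A S = (\<lambda>(V, \<phi>). (V \<inter> S, \<phi>)) ` A"

definition holomorphic_map ::
    "'a::t2_space set \<Rightarrow> 'a chart set \<Rightarrow> 'b::t2_space set \<Rightarrow> 'b chart set \<Rightarrow> ('a \<Rightarrow> 'b) \<Rightarrow> bool" where
  "holomorphic_map X A Y B f \<longleftrightarrow>
     continuous_on X f \<and> f ` X \<subseteq> Y \<and>
     (\<forall>(V, \<phi>)\<in>A. \<forall>(V', \<psi>)\<in>B.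
        (\<psi> \<circ> f \<circ> inv_into V \<phi>) holomorphic_on \<phi> ` (V \<inter> f -` V'))"

definition holomorphic_covering ::
    "'a::t2_space set \<Rightarrow> 'a chart set \<Rightarrow> 'b::t2_space set \<Rightarrow> 'b chart set \<Rightarrow> ('a \<Rightarrow> 'b) \<Rightarrow> bool" where
  "holomorphic_covering X A Y B p \<longleftrightarrow> covering_space X p Y \<and> holomorphic_map X A Y B p"

text \<open>
  The disc is simply connected, so every covering by it is a universal covering.
\<close>

definition hyperbolic_surface :: "'a::t2_space set \<Rightarrow> 'a chart set \<Rightarrow> bool" where
  "hyperbolic_surface U A \<longleftrightarrow>
     riemann_surface U A \<and>
     (\<forall>C\<in>components U. \<exists>p :: complex \<Rightarrow> 'a.
        holomorphic_covering (ball 0 1) {(ball 0 1, \<lambda>z. z)} C (restrict_atlas A C) p)"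

section \<open>Conformal metrics\<close>

text \<open>
  \<open>Ck_on k S u\<close>: \<open>u\<close> is \<open>k\<close> times continuously differentiable on the open set \<open>S\<close>.
\<close>

primrec Ck_on :: "nat \<Rightarrow> 'a::euclidean_space set \<Rightarrow> ('a \<Rightarrow> real) \<Rightarrow> bool" where
  "Ck_on 0 S u \<longleftrightarrow> continuous_on S u"
| "Ck_on (Suc k) S u \<longleftrightarrow>
     (\<forall>z\<in>S. u differentiable (at z)) \<and>
     (\<forall>b\<in>Basis. Ck_on k S (\<lambda>z. frechet_derivative u (at z) b))"

definition laplacian :: "(complex \<Rightarrow> real) \<Rightarrow> complex \<Rightarrow> real" where
  "laplacian u z =
     (\<Sum>b\<in>Basis. frechet_derivative (\<lambda>w. frechet_derivative u (at w) b) (at z) b)"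

text \<open>The Gaussian curvature of the metric \<open>r(z) |dz|\<close> on a plane domain.\<close>

definition gauss_curvature :: "(complex \<Rightarrow> real) \<Rightarrow> complex \<Rightarrow> real" where
  "gauss_curvature r z = - laplacian (\<lambda>w. ln (r w)) z / (r z)\<^sup>2"

text \<open>
  A conformal metric assigns to every chart \<open>(V, \<phi>)\<close> a density \<open>\<rho> (V, \<phi>)\<close> on \<open>\<phi> ` V\<close>; in the
  coordinate \<open>z = \<phi>(p)\<close> the metric is \<open>\<rho> (V, \<phi>) z |dz|\<close>. Values of \<open>\<rho>\<close> at other arguments
  are irrelevant.
\<close>

type_synonym 'a density = "'a chart \<Rightarrow> complex \<Rightarrow> real"

definition conformal_metric :: "'a chart set \<Rightarrow> 'a density \<Rightarrow> bool" where
  "conformal_metric A \<rho> \<longleftrightarrow>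
     (\<forall>(V, \<phi>)\<in>A. (\<forall>z\<in>\<phi> ` V. \<rho> (V, \<phi>) z > 0) \<and> (\<forall>k. Ck_on k (\<phi> ` V) (\<rho> (V, \<phi>)))) \<and>
     (\<forall>(V, \<phi>)\<in>A. \<forall>(V', \<psi>)\<in>A. \<forall>p\<in>V \<inter> V'.
        \<rho> (V, \<phi>) (\<phi> p) = \<rho> (V', \<psi>) (\<psi> p) * cmod (deriv (\<psi> \<circ> inv_into V \<phi>) (\<phi> p)))"

definition piecewise_C1_path :: "'a::t2_space set \<Rightarrow> 'a chart set \<Rightarrow> (real \<Rightarrow> 'a) \<Rightarrow> bool" where
  "piecewise_C1_path U A \<gamma> \<longleftrightarrow>
     path \<gamma> \<and> path_image \<gamma> \<subseteq> U \<and>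
     (\<forall>(V, \<phi>)\<in>A. \<forall>a b. {a..b} \<subseteq> {0..1} \<and> \<gamma> ` {a..b} \<subseteq> V \<longrightarrow>
        (\<phi> \<circ> \<gamma>) piecewise_C1_differentiable_on {a..b})"

text \<open>
  The length of the velocity vector of \<open>\<gamma>\<close> at time \<open>t\<close>. For a conformal metric it does not depend
  on the chart around \<open>\<gamma> t\<close> that is chosen.
\<close>

definition metric_speed :: "'a chart set \<Rightarrow> 'a density \<Rightarrow> (real \<Rightarrow> 'a) \<Rightarrow> real \<Rightarrow> real" where
  "metric_speed A \<rho> \<gamma> t =
     (let (V, \<phi>) = (SOME c. c \<in> A \<and> \<gamma> t \<in> fst c)
      in \<rho> (V, \<phi>) (\<phi> (\<gamma> t)) * cmod (vector_derivative (\<phi> \<circ> \<gamma>) (at t)))"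

definition metric_length :: "'a chart set \<Rightarrow> 'a density \<Rightarrow> (real \<Rightarrow> 'a) \<Rightarrow> ennreal" where
  "metric_length A \<rho> \<gamma> = (\<integral>\<^sup>+ t\<in>{0..1}. ennreal (metric_speed A \<rho> \<gamma> t) \<partial>lborel)"

text \<open>
  The infimum over the empty set is \<open>\<infinity>\<close>, so points in different components have distance \<open>\<infinity>\<close>.
\<close>

definition metric_dist ::
    "'a::t2_space set \<Rightarrow> 'a chart set \<Rightarrow> 'a density \<Rightarrow> 'a \<Rightarrow> 'a \<Rightarrow> ennreal" where
  "metric_dist U A \<rho> x y =
     (INF \<gamma>\<in>{\<gamma>. piecewise_C1_path U A \<gamma> \<and> pathstart \<gamma> = x \<and> pathfinish \<gamma> = y}.
        metric_length A \<rho> \<gamma>)"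

text \<open>
  Completeness of the (extended) distance. The terms of a Cauchy sequence eventually lie in one
  component, so this is the same as completeness of each component.
\<close>

definition complete_metric :: "'a::t2_space set \<Rightarrow> 'a chart set \<Rightarrow> 'a density \<Rightarrow> bool" where
  "complete_metric U A \<rho> \<longleftrightarrow>
     (\<forall>x :: nat \<Rightarrow> 'a.
        range x \<subseteq> U \<and> (\<forall>e>0. \<exists>N. \<forall>m\<ge>N. \<forall>n\<ge>N. metric_dist U A \<rho> (x m) (x n) < e) \<longrightarrow>
        (\<exists>l\<in>U. (\<lambda>n. metric_dist U A \<rho> (x n) l) \<longlonglongrightarrow> 0))"

section \<open>The hyperbolic metric\<close>

definition is_hyperbolic_metric :: "'a::t2_space set \<Rightarrow> 'a chart set \<Rightarrow> 'a density \<Rightarrow> bool" where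
  "is_hyperbolic_metric U A \<rho> \<longleftrightarrow>
     conformal_metric A \<rho> \<and>
     (\<forall>(V, \<phi>)\<in>A. \<forall>z\<in>\<phi> ` V. gauss_curvature (\<rho> (V, \<phi>)) z = -1) \<and>
     complete_metric U A \<rho>"

text \<open>
  On a hyperbolic surface such a metric exists and its densities are uniquely determined on the
  chart images, so the choice concerns only irrelevant values of \<open>\<rho>\<close>.
\<close>

definition hyperbolic_metric :: "'a::t2_space set \<Rightarrow> 'a chart set \<Rightarrow> 'a density" where
  "hyperbolic_metric U A = (SOME \<rho>. is_hyperbolic_metric U A \<rho>)"

definition hyp_dist :: "'a::t2_space set \<Rightarrow> 'a chart set \<Rightarrow> 'a \<Rightarrow> 'a \<Rightarrow> ennreal" where
  "hyp_dist U A = metric_dist U A (hyperbolic_metric U A)"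

definition hyp_setdist :: "'a::t2_space set \<Rightarrow> 'a chart set \<Rightarrow> 'a \<Rightarrow> 'a set \<Rightarrow> ennreal" where
  "hyp_setdist U A z E = (INF \<zeta>\<in>E. hyp_dist U A z \<zeta>)"

end

theory Submission
  imports Defs
begin

text \<open>
  Let \<open>k\<close> be a covering of a component of \<open>U\<close> by the unit disc. The logarithm \<open>u\<close> of the density of a hyperbolic
  metric, pulled back by \<open>k\<close>, solves Liouville's equation, and therefore the pulled back density is
  \<open>2 \<bar>F'\<bar> / (1 - \<bar>F\<bar>\<^sup>2)\<close> for a holomorphic self-map \<open>F\<close> of the disc with \<open>F 0 = 0\<close>. Completeness allows the inverse
  branch of \<open>F\<close> at \<open>0\<close> to be continued along all rays, so the Schwarz lemma gives \<open>\<bar>F' 0\<bar> = 1\<close>: the pulled back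
  metric is the Poincare metric, and hyperbolic balls about \<open>k 0\<close> are images of discs about \<open>0\<close>.

  Now let \<open>k n\<close> be such coverings with \<open>k n 0 = (f ^^ n) w\<close>. As \<open>f\<close> is a covering, \<open>k (n + 1) = f \<circ> k n \<circ> h n\<close> with a
  holomorphic self-map \<open>h n\<close> of the disc that fixes \<open>0\<close>. If \<open>k 0\<close> maps the disc \<open>B\<close> of radius \<open>s\<close> about \<open>0\<close> into \<open>W\<close>, then
  \<open>k n\<close> maps \<open>B\<close> into \<open>(f ^^ n) ` W\<close> by the Schwarz lemma, which is the first claim. For the second, lift
  \<open>(f ^^ n) \<circ> k 0\<close> on \<open>B\<close> through \<open>k n\<close>; the lift is a local inverse of \<open>h 0 \<circ> \<dots> \<circ> h (n - 1)\<close>, and its derivative at \<open>0\<close> is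
  at most \<open>1 / s\<close>. Hence the product of the \<open>\<bar>(h j)' 0\<bar>\<close> is at least \<open>s\<close>, so that \<open>\<bar>(h n)' 0\<bar>\<close> tends to \<open>1\<close> and the
  image under \<open>h n\<close> of a disc of radius close to \<open>1\<close> contains a given disc: a large ball about \<open>(f ^^ (n + 1)) w\<close> in \<open>D\<close>
  gives a large ball about \<open>(f ^^ n) w\<close> in \<open>f -` D\<close>.
\<close>

text \<open>\<open>hyperbolic_metric\<close> is a Hilbert choice, so nothing can be said about
  \<open>hyp_dist\<close> before a complete metric of curvature -1 has been constructed and any two
  such metrics have been shown to agree. Both halves pass through \<open>poincare_metric\<close>.
  The obstacle is uniqueness: curvature is local information, whereas the developing map must exist
  on the whole disc. It is found as a quotient of two solutions of a linear equation y'' = - T y,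
  whose power series converge on the whole disc, so that no monodromy enters. Distances are never
  computed. A lower bound is the variation of the potential - ln (1 - |F|^2) along a lifted path, an
  upper bound is the length of the image of a segment. Both are crude, but they show that bounded
  distance from the centre means Euclidean radius bounded away from 1, with constants that are the
  same for all coverings, and this is what the two claims rest on.\<close>

section \<open>Sections of local homeomorphisms and lifting\<close>

text \<open>The set of agreement is closed because the target is Hausdorff, and open because
  \<open>p\<close> is injective near the common value. Only local injectivity of \<open>p\<close>
  enters, so the lemma serves for coverings, for the projection of a fibre product and for the
  developing map alike.\<close>

lemma lifts_agree:
  fixes h1 h2 :: "'a::topological_space \<Rightarrow> 'b::t2_space"
  assumes S: "connected S" and c1: "continuous_on S h1" and c2: "continuous_on S h2"
    and i1: "h1 ` S \<subseteq> X" and i2: "h2 ` S \<subseteq> X"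
    and eq: "\<And>x. x \<in> S \<Longrightarrow> p (h1 x) = p (h2 x)"
    and li: "\<And>x. x \<in> X \<Longrightarrow> \<exists>N. openin (top_of_set X) N \<and> x \<in> N \<and> inj_on p N"
    and a: "a \<in> S" "h1 a = h2 a" and x: "x \<in> S"
  shows "h1 x = h2 x"
proof -
  define E where "E = {x \<in> S. h1 x = h2 x}"
  have "Hausdorff_space (euclidean :: 'b topology)"
    unfolding Hausdorff_space_def disjnt_def
  proof (intro allI impI)
    fix x y :: 'b
    assume "x \<in> topspace euclidean \<and> y \<in> topspace euclidean \<and> x \<noteq> y"
    then obtain U V where "open U" "open V" "x \<in> U" "y \<in> V" "U \<inter> V = {}"
      using hausdorff[of x y] unfolding topspace_euclidean by blast
    then show "\<exists>U V. openin euclidean U \<and> openin euclidean V \<and> x \<in> U \<and> y \<in> V \<and> U \<inter> V = {}"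
      by (metis open_openin)
  qed
  from closedin_continuous_maps_eq[OF this, of "top_of_set S" h1 h2]
  have "closedin (top_of_set S) {x \<in> topspace (top_of_set S). h1 x = h2 x}"
    using c1 c2 by simp
  then have cl: "closedin (top_of_set S) E" by (simp add: E_def)
  have op: "openin (top_of_set S) E"
  proof (subst openin_subopen, intro ballI)
    fix z assume z: "z \<in> E"
    then have zS: "z \<in> S" and hz: "h1 z = h2 z" by (auto simp: E_def)
    obtain N where N: "openin (top_of_set X) N" "h1 z \<in> N" "inj_on p N"
      using li[of "h1 z"] i1 zS by blast
    have o1: "openin (top_of_set S) (S \<inter> h1 -` N)"
      using continuous_openin_preimage[OF c1 _ N(1)] i1 by (simp add: image_subset_iff_funcset)
    have o2: "openin (top_of_set S) (S \<inter> h2 -` N)"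
      using continuous_openin_preimage[OF c2 _ N(1)] i2 by (simp add: image_subset_iff_funcset)
    have "(S \<inter> h1 -` N) \<inter> (S \<inter> h2 -` N) \<subseteq> E"
      using eq N(3) unfolding inj_on_def E_def by blast
    moreover have "z \<in> (S \<inter> h1 -` N) \<inter> (S \<inter> h2 -` N)" using zS hz N(2) by simp
    ultimately show "\<exists>T. openin (top_of_set S) T \<and> z \<in> T \<and> T \<subseteq> E"
      using openin_Int[OF o1 o2] by blast
  qed
  have "E = {} \<or> E = S" using S cl op unfolding connected_clopen by metis
  then show ?thesis using a x by (auto simp: E_def)
qed

text \<open>If the supremum \<open>M\<close> of the radii that admit a section were below
  \<open>r\<close>, the limits along rays would give a point of \<open>E\<close> over every point of
  the sphere of radius \<open>M\<close>. The local sections through these points extend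
  \<open>G\<close>, agree with each other and, by compactness, reach a larger ball. Condition
  \<open>ray\<close> stands for whatever completeness is at hand: it is verified for a fibre product
  over a covering and for the developing map.\<close>

lemma section_over_ball:
  fixes p :: "'e::t2_space \<Rightarrow> 'v::euclidean_space" and r :: real
  assumes contp: "continuous_on E p"
    and loc: "\<And>e. e \<in> E \<Longrightarrow> \<exists>d>0. \<exists>s N. continuous_on (ball (p e) d) s \<and> s ` ball (p e) d \<subseteq> E \<and>
          (\<forall>z\<in>ball (p e) d. p (s z) = z) \<and> openin (top_of_set E) N \<and> e \<in> N \<and> (\<forall>e'\<in>N. s (p e') = e')"
    and ray: "\<And>R G \<zeta>. \<lbrakk>0 < R; R < r; continuous_on (ball 0 R) G; G ` ball 0 R \<subseteq> E;
          \<forall>z\<in>ball 0 R. p (G z) = z; G 0 = e0; norm \<zeta> = R\<rbrakk>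
          \<Longrightarrow> \<exists>e\<in>E. ((\<lambda>t. G (t *\<^sub>R \<zeta>)) \<longlongrightarrow> e) (at_left 1)"
    and e0: "e0 \<in> E" "p e0 = 0" and r: "0 < r"
  obtains G where "continuous_on (ball 0 r) G" "G ` ball 0 r \<subseteq> E" "\<forall>z\<in>ball 0 r. p (G z) = z" "G 0 = e0"
proof -
  define sec where "sec R G \<longleftrightarrow> continuous_on (ball 0 R) G \<and> G ` ball 0 R \<subseteq> E \<and>
     (\<forall>z\<in>ball 0 R. p (G z) = z) \<and> G 0 = e0" for R G
  have li: "\<exists>N. openin (top_of_set E) N \<and> x \<in> N \<and> inj_on p N" if "x \<in> E" for x
    using loc[OF that] by (metis inj_on_inverseI)
  have agree: "G1 x = G2 x" if S: "convex S" "a \<in> S" "G1 a = G2 a" "x \<in> S" and sub: "S \<subseteq> S1" "S \<subseteq> S2"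
      and G1: "continuous_on S1 G1" "G1 ` S1 \<subseteq> E" "\<forall>z\<in>S1. p (G1 z) = z"
      and G2: "continuous_on S2 G2" "G2 ` S2 \<subseteq> E" "\<forall>z\<in>S2. p (G2 z) = z" for S S1 S2 :: "'v set" and G1 G2 a x
  proof (rule lifts_agree[where p = p and X = E and S = S and ?h1.0 = G1 and ?h2.0 = G2 and a = a])
    show "connected S" using S(1) by (rule convex_connected)
    show "\<exists>N. openin (top_of_set E) N \<and> x \<in> N \<and> inj_on p N" if "x \<in> E" for x using that by (rule li)
    show "a \<in> S" "G1 a = G2 a" "x \<in> S" by fact+
    show "continuous_on S G1" "continuous_on S G2"
      using G1(1) G2(1) sub by (meson continuous_on_subset)+
    show "G1 ` S \<subseteq> E" "G2 ` S \<subseteq> E" using G1(2) G2(2) sub by blast+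
    show "p (G1 z) = p (G2 z)" if "z \<in> S" for z
      using G1(3) G2(3) sub that by (metis subsetD)
  qed
  define I where "I = {R. 0 < R \<and> R \<le> r \<and> (\<exists>G. sec R G)}"
  have Ine: "I \<noteq> {}"
  proof -
    obtain d s N where d: "0 < d" "continuous_on (ball 0 d) s" "s ` ball 0 d \<subseteq> E"
       "\<forall>z\<in>ball 0 d. p (s z) = z" "e0 \<in> N" "\<forall>e'\<in>N. s (p e') = e'"
      using loc[OF e0(1)] e0(2) by auto
    have "sec (min d r) s"
      using d e0 by (fastforce simp: sec_def intro: continuous_on_subset)
    then have "min d r \<in> I" using d r by (auto simp: I_def)
    then show ?thesis by auto
  qed
  have Ibdd: "bdd_above I" by (auto simp: I_def intro: bdd_aboveI[of _ r])
  \<comment> \<open>One section is fixed for each radius; \<open>agree\<close> makes these choices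
    compatible, so that \<open>G\<close> below is their union.\<close>
  define GR where "GR R = (SOME G. sec R G)" for R
  have GR: "sec R (GR R)" if "R \<in> I" for R
  proof -
    have "\<exists>G. sec R G" using that by (simp add: I_def)
    then show ?thesis unfolding GR_def by (rule someI_ex)
  qed
  define M where "M = Sup I"
  have Mpos: "0 < M" and Mr: "M \<le> r"
  proof -
    obtain R where "R \<in> I" using Ine by auto
    then show "0 < M" using cSup_upper[OF _ Ibdd, of R] by (auto simp: M_def I_def)
    show "M \<le> r" unfolding M_def by (rule cSup_least[OF Ine]) (auto simp: I_def)
  qed
  define G where "G z = GR (SOME R. R \<in> I \<and> norm z < R) z" for z
  have GG: "G z = GR R z" if "R \<in> I" "norm z < R" for R z
  proof -
    define R' where "R' = (SOME R. R \<in> I \<and> norm z < R)"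
    have R': "R' \<in> I" "norm z < R'" 
      using someI[of "\<lambda>R. R \<in> I \<and> norm z < R" R] that unfolding R'_def by auto
    have R0: "0 < R" "0 < R'" using R'(1) that(1) by (auto simp: I_def)
    have s1: "sec R (GR R)" "sec R' (GR R')" using GR R'(1) that(1) by blast+
    have "GR R' z = GR R z"
      by (rule agree[of "ball 0 (min R R')" 0 _ _ _ "ball 0 R'" "ball 0 R"])
         (use s1 R0 that R' in \<open>simp_all add: sec_def subset_ball\<close>)
    then show ?thesis by (simp add: G_def R'_def)
  qed
  have exR: "\<exists>R\<in>I. norm z < R" if "norm z < M" for z :: 'v
    using that less_cSup_iff[OF Ine Ibdd] by (auto simp: M_def)
  have secM: "sec M G"
    unfolding sec_def
  proof (intro conjI ballI)
    have "isCont G z" if z: "z \<in> ball 0 M" for z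
    proof -
      obtain R where R: "R \<in> I" "norm z < R" using exR z by auto
      have "continuous_on (ball 0 R) G"
        by (rule continuous_on_eq[of _ "GR R"]) (use GR[OF R(1)] GG[OF R(1)] in \<open>auto simp: sec_def\<close>)
      then show ?thesis using R by (simp add: continuous_on_eq_continuous_at)
    qed
    then show "continuous_on (ball 0 M) G" by (simp add: continuous_at_imp_continuous_on)
    show "G ` ball 0 M \<subseteq> E"
      using exR GG GR by (fastforce simp: sec_def)
    show "p (G z) = z" if "z \<in> ball 0 M" for z
      using exR[of z] GG GR that by (fastforce simp: sec_def)
    show "G 0 = e0" using exR[of 0] GG GR Mpos by (fastforce simp: sec_def)
  qed
  have "M = r"
  proof (rule ccontr)
    assume "M \<noteq> r"
    then have Mlt: "M < r" using Mr by simp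
    have "\<exists>d s. 0 < d \<and> continuous_on (ball \<zeta> d) s \<and> s ` ball \<zeta> d \<subseteq> E \<and> (\<forall>z\<in>ball \<zeta> d. p (s z) = z) \<and>
        (\<forall>z\<in>ball \<zeta> d \<inter> ball 0 M. s z = G z)" if \<zeta>: "norm \<zeta> = M" for \<zeta>
    proof -
      obtain e where e: "e \<in> E" and lim: "((\<lambda>t. G (t *\<^sub>R \<zeta>)) \<longlongrightarrow> e) (at_left 1)"
        using ray[OF Mpos Mlt _ _ _ _ \<zeta>, of G] secM unfolding sec_def by blast
      have ev1: "eventually (\<lambda>t::real. 0 < t \<and> t < 1) (at_left 1)"
        by (rule eventually_at_leftI[of 0]) auto
      have inb: "t *\<^sub>R \<zeta> \<in> ball 0 M" if "0 < t \<and> t < 1" for t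
        using that \<zeta> Mpos by simp
      have "((\<lambda>t. p (G (t *\<^sub>R \<zeta>))) \<longlongrightarrow> p e) (at_left 1)"
        by (rule continuous_on_tendsto_compose[OF contp lim e], rule eventually_mono[OF ev1])
           (use inb secM in \<open>auto simp: sec_def\<close>)
      then have "((\<lambda>t. t *\<^sub>R \<zeta>) \<longlongrightarrow> p e) (at_left 1)"
        by (rule Lim_transform_eventually)
           (rule eventually_mono[OF ev1], use inb secM in \<open>auto simp: sec_def\<close>)
      moreover have "((\<lambda>t. t *\<^sub>R \<zeta>) \<longlongrightarrow> 1 *\<^sub>R \<zeta>) (at_left 1)" by (intro tendsto_intros)
      ultimately have pe: "p e = \<zeta>" using tendsto_unique[of "at_left (1::real)"] by force
      obtain d s N where d: "0 < d" "continuous_on (ball \<zeta> d) s" "s ` ball \<zeta> d \<subseteq> E"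
          "\<forall>z\<in>ball \<zeta> d. p (s z) = z" "openin (top_of_set E) N" "e \<in> N" "\<forall>e'\<in>N. s (p e') = e'"
        using loc[OF e] pe by auto
      obtain Q where Q: "open Q" "N = E \<inter> Q" using d(5) by (auto simp: openin_open)
      have "eventually (\<lambda>t. G (t *\<^sub>R \<zeta>) \<in> Q) (at_left 1)"
        using topological_tendstoD[OF lim Q(1)] d(6) Q by auto
      moreover have "eventually (\<lambda>t. t *\<^sub>R \<zeta> \<in> ball \<zeta> d) (at_left 1)"
        using topological_tendstoD[OF \<open>((\<lambda>t. t *\<^sub>R \<zeta>) \<longlongrightarrow> 1 *\<^sub>R \<zeta>) (at_left 1)\<close>, of "ball \<zeta> d"] d(1) by auto
      ultimately have "eventually (\<lambda>t. G (t *\<^sub>R \<zeta>) \<in> Q \<and> t *\<^sub>R \<zeta> \<in> ball \<zeta> d \<and> (0 < t \<and> t < 1)) (at_left 1)"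
        using ev1 by eventually_elim auto
      \<comment> \<open>Near the end of the ray \<open>G\<close> runs inside \<open>N\<close>, where
        \<open>s\<close> undoes \<open>p\<close>. So \<open>s\<close> and \<open>G\<close> agree at
        one point, and then on the whole intersection of the two balls, which is convex.\<close>
      then obtain t where t: "G (t *\<^sub>R \<zeta>) \<in> Q" "t *\<^sub>R \<zeta> \<in> ball \<zeta> d" "0 < t \<and> t < 1"
        using eventually_happens[of _ "at_left (1::real)"] by force
      have "G (t *\<^sub>R \<zeta>) \<in> N" "p (G (t *\<^sub>R \<zeta>)) = t *\<^sub>R \<zeta>" using t inb[OF t(3)] secM Q by (auto simp: sec_def)
      then have eqt: "s (t *\<^sub>R \<zeta>) = G (t *\<^sub>R \<zeta>)" using d(7) by metis
      have "s z = G z" if "z \<in> ball \<zeta> d \<inter> ball 0 M" for z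
      proof (rule agree[of "ball \<zeta> d \<inter> ball 0 M" "t *\<^sub>R \<zeta>" _ _ _ "ball \<zeta> d" "ball 0 M"])
        show "t *\<^sub>R \<zeta> \<in> ball \<zeta> d \<inter> ball 0 M" using inb[OF t(3)] t(2) by blast
      qed (use d secM eqt that in \<open>simp_all add: sec_def convex_Int\<close>)
      then show ?thesis using d by blast
    qed
    then obtain d s where ds: "\<And>\<zeta>. norm \<zeta> = M \<Longrightarrow> 0 < d \<zeta> \<and> continuous_on (ball \<zeta> (d \<zeta>)) (s \<zeta>) \<and>
        s \<zeta> ` ball \<zeta> (d \<zeta>) \<subseteq> E \<and> (\<forall>z\<in>ball \<zeta> (d \<zeta>). p (s \<zeta> z) = z) \<and>
        (\<forall>z\<in>ball \<zeta> (d \<zeta>) \<inter> ball 0 M. s \<zeta> z = G z)" by metis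
    \<comment> \<open>Two balls centred on the sphere that meet, meet on the chord, hence inside the ball
      where both sections are \<open>G\<close>.\<close>
    have cons: "s \<zeta> z = s \<zeta>' z" if "norm \<zeta> = M" "norm \<zeta>' = M" "z \<in> ball \<zeta> (d \<zeta>)" "z \<in> ball \<zeta>' (d \<zeta>')" for \<zeta> \<zeta>' z
    proof (cases "\<zeta> = \<zeta>'")
      case False
      define D where "D = d \<zeta> + d \<zeta>'"
      have d0: "0 < d \<zeta>" "0 < d \<zeta>'" using ds that by auto
      then have Dpos: "0 < D" by (simp add: D_def)
      have dd: "dist \<zeta> \<zeta>' < D"
        using dist_triangle3[of \<zeta> \<zeta>' z] that by (simp add: dist_commute D_def)
      \<comment> \<open>The point \<open>y\<close> divides the chord in the ratio of the two radii;
        since the chord is shorter than their sum \<open>D\<close>, it lies in both balls.\<close>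
      define u where "u = d \<zeta> / D"
      have u: "0 < u" "u < 1" "1 - u = d \<zeta>' / D" using d0 Dpos by (auto simp: u_def D_def field_simps)
      define y where "y = (1 - u) *\<^sub>R \<zeta> + u *\<^sub>R \<zeta>'"
      have seg: "y \<in> open_segment \<zeta> \<zeta>'" using False u by (auto simp: in_segment y_def)
      have yM: "y \<in> ball 0 M" using dist_decreases_open_segment[OF seg, of 0] that by auto
      have "\<zeta> - y = u *\<^sub>R (\<zeta> - \<zeta>')" by (simp add: y_def algebra_simps)
      then have "dist \<zeta> y = u * dist \<zeta> \<zeta>'" using u by (simp add: dist_norm)
      also have "\<dots> < u * D" using dd u by simp
      finally have y1: "y \<in> ball \<zeta> (d \<zeta>)" using Dpos by (simp add: u_def)
      have "\<zeta>' - y = (1 - u) *\<^sub>R (\<zeta>' - \<zeta>)" by (simp add: y_def algebra_simps)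
      then have "dist \<zeta>' y = (1 - u) * dist \<zeta> \<zeta>'" using u(2) by (simp add: dist_norm norm_minus_commute)
      also have "\<dots> < (1 - u) * D" by (rule mult_strict_left_mono[OF dd]) (use u in simp)
      finally have y2: "y \<in> ball \<zeta>' (d \<zeta>')" using Dpos u(3) by simp
      show ?thesis
      proof (rule agree[of "ball \<zeta> (d \<zeta>) \<inter> ball \<zeta>' (d \<zeta>')" y _ _ _ "ball \<zeta> (d \<zeta>)" "ball \<zeta>' (d \<zeta>')"])
        show "s \<zeta> y = s \<zeta>' y" using ds[OF that(1)] ds[OF that(2)] y1 y2 yM by (metis IntI)
        show "y \<in> ball \<zeta> (d \<zeta>) \<inter> ball \<zeta>' (d \<zeta>')" "z \<in> ball \<zeta> (d \<zeta>) \<inter> ball \<zeta>' (d \<zeta>')"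
          using y1 y2 that(3,4) by blast+
        show "continuous_on (ball \<zeta> (d \<zeta>)) (s \<zeta>)" "s \<zeta> ` ball \<zeta> (d \<zeta>) \<subseteq> E" "\<forall>z\<in>ball \<zeta> (d \<zeta>). p (s \<zeta> z) = z"
          using ds[OF that(1)] by blast+
        show "continuous_on (ball \<zeta>' (d \<zeta>')) (s \<zeta>')" "s \<zeta>' ` ball \<zeta>' (d \<zeta>') \<subseteq> E" "\<forall>z\<in>ball \<zeta>' (d \<zeta>'). p (s \<zeta>' z) = z"
          using ds[OF that(2)] by blast+
      qed (simp_all add: convex_Int)
    qed auto
    define Q where "Q = ball 0 M \<union> (\<Union>\<zeta>\<in>sphere 0 M. ball \<zeta> (d \<zeta>))"
    have "cball 0 M \<subseteq> Q"
    proof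
      fix z :: 'v assume "z \<in> cball 0 M"
      then consider "norm z < M" | "norm z = M" by fastforce
      then show "z \<in> Q" using ds[of z] by cases (auto simp: Q_def intro!: bexI[of _ z])
    qed
    moreover have "open Q" by (auto simp: Q_def)
    ultimately obtain \<epsilon> where \<epsilon>: "\<epsilon> > 0" "(\<Union>x\<in>cball 0 M. ball x \<epsilon>) \<subseteq> Q"
      using compact_subset_open_imp_ball_epsilon_subset[of "cball 0 M" Q] compact_cball by metis
    \<comment> \<open>A point of this ball outside \<open>ball 0 M\<close> is closer than \<epsilon>
      to its radial projection on the sphere of radius \<open>M\<close>, hence lies in
      \<open>Q\<close>.\<close>
    define R where "R = min r (M + \<epsilon> / 2)"
    have RM: "M < R" "R \<le> r" using Mlt \<epsilon> by (auto simp: R_def)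
    have RQ: "ball 0 R \<subseteq> Q"
    proof
      fix z :: 'v assume z: "z \<in> ball 0 R"
      show "z \<in> Q"
      proof (cases "norm z < M")
        case False
        then have nz: "norm z > 0" using Mpos by linarith
        define x where "x = (M / norm z) *\<^sub>R z"
        have "norm x = M" using nz Mpos by (simp add: x_def)
        have "x - z = (M / norm z - 1) *\<^sub>R z" by (simp add: x_def algebra_simps)
        then have "dist x z = \<bar>M / norm z - 1\<bar> * norm z" by (simp add: dist_norm)
        also have "\<dots> = norm z - M" using nz False by (auto simp: field_simps abs_if)
        finally have "dist x z < \<epsilon>" using z \<epsilon>(1) by (auto simp: R_def)
        then have "z \<in> (\<Union>x\<in>cball 0 M. ball x \<epsilon>)" using \<open>norm x = M\<close> by (intro UN_I[of x]) auto
        then show ?thesis using \<epsilon>(2) by blast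
      qed (auto simp: Q_def)
    qed
    define G' where "G' z = (if norm z < M then G z else s (SOME \<zeta>. norm \<zeta> = M \<and> z \<in> ball \<zeta> (d \<zeta>)) z)" for z
    have G's: "G' z = s \<zeta> z" if "norm \<zeta> = M" "z \<in> ball \<zeta> (d \<zeta>)" for \<zeta> z
    proof (cases "norm z < M")
      case True
      then show ?thesis using ds[OF that(1)] that by (simp add: G'_def)
    next
      case False
      define \<eta> where "\<eta> = (SOME \<zeta>. norm \<zeta> = M \<and> z \<in> ball \<zeta> (d \<zeta>))"
      have "norm \<eta> = M \<and> z \<in> ball \<eta> (d \<eta>)" unfolding \<eta>_def by (rule someI) (use that in auto)
      then show ?thesis using cons[of \<eta> \<zeta> z] that False by (simp add: G'_def \<eta>_def)
    qed
    have cases: "norm z < M \<or> (\<exists>\<zeta>. norm \<zeta> = M \<and> z \<in> ball \<zeta> (d \<zeta>))" if "z \<in> ball 0 R" for z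
      using RQ that by (fastforce simp: Q_def)
    have "sec R G'"
      unfolding sec_def
    proof (intro conjI ballI)
      have "isCont G' z" if z: "z \<in> ball 0 R" for z
        using cases[OF z]
      proof
        assume n: "norm z < M"
        have "continuous_on (ball 0 M) G'"
          by (rule continuous_on_eq[of _ G]) (use secM in \<open>simp_all add: sec_def G'_def\<close>)
        then show ?thesis using n by (simp add: continuous_on_eq_continuous_at)
      next
        assume "\<exists>\<zeta>. norm \<zeta> = M \<and> z \<in> ball \<zeta> (d \<zeta>)"
        then obtain \<zeta> where \<zeta>: "norm \<zeta> = M" "z \<in> ball \<zeta> (d \<zeta>)" by blast
        have "continuous_on (ball \<zeta> (d \<zeta>)) G'"
          by (rule continuous_on_eq[of _ "s \<zeta>"]) (use ds[OF \<zeta>(1)] G's[OF \<zeta>(1)] in simp_all)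
        then show ?thesis using \<zeta> by (simp add: continuous_on_eq_continuous_at)
      qed
      then show "continuous_on (ball 0 R) G'" by (simp add: continuous_at_imp_continuous_on)
      have *: "G' z \<in> E \<and> p (G' z) = z" if z: "z \<in> ball 0 R" for z
        using cases[OF z]
      proof
        assume "norm z < M"
        then show ?thesis using secM by (auto simp: sec_def G'_def)
      next
        assume "\<exists>\<zeta>. norm \<zeta> = M \<and> z \<in> ball \<zeta> (d \<zeta>)"
        then obtain \<zeta> where \<zeta>: "norm \<zeta> = M" "z \<in> ball \<zeta> (d \<zeta>)" by blast
        then show ?thesis using ds[OF \<zeta>(1)] G's[OF \<zeta>] by auto
      qed
      then show "G' ` ball 0 R \<subseteq> E" "\<And>z. z \<in> ball 0 R \<Longrightarrow> p (G' z) = z" by auto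
      show "G' 0 = e0" using secM Mpos by (simp add: sec_def G'_def)
    qed
    then have "R \<in> I" using RM Mpos by (auto simp: I_def)
    then have "R \<le> M" unfolding M_def by (rule cSup_upper[OF _ Ibdd])
    then show False using RM by simp
  qed
  then show ?thesis using secM that by (auto simp: sec_def)
qed

text \<open>From some time on the projected path stays in an evenly covered neighbourhood of
  \<open>l\<close>. The tail of \<open>x\<close> is connected, hence contained in a single sheet,
  and the inverse of \<open>P\<close> on that sheet carries the limit upstairs.\<close>

lemma covering_space_limit_lift:
  fixes x :: "real \<Rightarrow> 'b::topological_space" and P :: "'b \<Rightarrow> 'a::topological_space"
  assumes cov: "covering_space X P Y" and t0: "t0 < 1"
    and cx: "continuous_on {t0..<1} x" and xX: "x ` {t0..<1} \<subseteq> X"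
    and lim: "((\<lambda>t. P (x t)) \<longlongrightarrow> l) (at_left 1)" and l: "l \<in> Y"
  obtains e where "e \<in> X" "P e = l" "(x \<longlongrightarrow> e) (at_left 1)"
proof -
  obtain T v where T: "l \<in> T" "openin (top_of_set Y) T" "\<Union>v = X \<inter> P -` T"
      "\<forall>u\<in>v. openin (top_of_set X) u" "pairwise disjnt v" "\<forall>u\<in>v. \<exists>q. homeomorphism u T P q"
    using cov l unfolding covering_space_def by metis
  obtain Q where Q: "open Q" "T = Y \<inter> Q" using T(2) by (auto simp: openin_open)
  have "eventually (\<lambda>t. P (x t) \<in> Q) (at_left 1)"
    using topological_tendstoD[OF lim Q(1)] T(1) Q by auto
  then obtain b where b: "b < 1" "\<And>t. b < t \<Longrightarrow> t < 1 \<Longrightarrow> P (x t) \<in> Q"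
    unfolding eventually_at_left_field by blast
  define t1 where "t1 = max t0 ((b + 1) / 2)"
  have t1: "t0 \<le> t1" "b < t1" "t1 < 1" using b(1) t0 by (simp_all add: t1_def max_def split: if_splits)
  have xX': "x t \<in> X" if "t \<in> {t1..<1}" for t
    using xX t1 that by (meson atLeastLessThan_iff image_subset_iff order_trans)
  have PX: "P (x t) \<in> Y" if "t \<in> {t1..<1}" for t
    using cov xX'[OF that] unfolding covering_space_def by blast
  have inv: "x t \<in> \<Union>v" if "t \<in> {t1..<1}" for t
    using that b(2)[of t] t1 PX[OF that] xX'[OF that] unfolding T(3) Q(2) by simp
  obtain u where u: "u \<in> v" "x t1 \<in> u" using inv[of t1] t1 by auto
  define C where "C = x ` {t1..<1}"
  have con: "connected C" unfolding C_def
    by (rule connected_continuous_image[OF continuous_on_subset[OF cx]]) (use t1 in auto)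
  have CX: "C \<subseteq> X" using xX' by (auto simp: C_def)
  \<comment> \<open>The remaining sheets form one open set disjoint from \<open>u\<close>; the
    connected tail \<open>C\<close> meets \<open>u\<close> and therefore avoids it.\<close>
  have "openin (top_of_set X) (\<Union>(v - {u}))" using T(4) by (intro openin_Union) auto
  then obtain O2 where O2: "open O2" "\<Union>(v - {u}) = X \<inter> O2" unfolding openin_open by blast
  obtain O1 where O1: "open O1" "u = X \<inter> O1" using T(4) u(1) unfolding openin_open by blast
  have disj: "u \<inter> \<Union>(v - {u}) = {}" using T(5) u(1) unfolding pairwise_def disjnt_def by blast
  have Cv: "C \<subseteq> \<Union>v" using inv by (auto simp: C_def)
  have "\<Union>v \<subseteq> O1 \<union> O2" using O1(2) O2(2) by blast
  then have "C \<subseteq> O1 \<union> O2" using Cv by blast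
  moreover have "O1 \<inter> O2 \<inter> C = {}" using disj CX O1(2) O2(2) by blast
  ultimately have "O1 \<inter> C = {} \<or> O2 \<inter> C = {}"
    using connectedD[OF con O1(1) O2(1)] by blast
  moreover have "O1 \<inter> C \<noteq> {}" using u O1(2) t1 unfolding C_def by force
  ultimately have O2C: "O2 \<inter> C = {}" by blast
  have "C \<subseteq> u" using Cv O2C O2(2) by blast
  then have Cu: "x t \<in> u" if "t \<in> {t1..<1}" for t using that by (auto simp: C_def)
  obtain q where q: "homeomorphism u T P q" using T(6) u by blast
  have ev: "eventually (\<lambda>t::real. t \<in> {t1..<1}) (at_left 1)"
    using t1 by (auto simp: eventually_at_left_field)
  have PT: "P (x t) \<in> T" "q (P (x t)) = x t" if "t \<in> {t1..<1}" for t
    using Cu[OF that] q unfolding homeomorphism_def by blast+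
  have "((\<lambda>t. q (P (x t))) \<longlongrightarrow> q l) (at_left 1)"
    by (rule continuous_on_tendsto_compose[OF homeomorphism_cont2[OF q] lim T(1)],
        rule eventually_mono[OF ev]) (rule PT)
  then have "(x \<longlongrightarrow> q l) (at_left 1)"
    by (rule Lim_transform_eventually, rule_tac eventually_mono[OF ev]) (rule PT)
  moreover have "q l \<in> u" "P (q l) = l" using q T(1) unfolding homeomorphism_def by blast+
  ultimately show ?thesis using that O1(2) by blast
qed

text \<open>The lifting theorems of \<open>HOL-Analysis\<close> are about coverings of subsets of normed spaces.\<close>

theorem covering_space_lift_ball:
  fixes P :: "'b::t2_space \<Rightarrow> 'a::t2_space" and g :: "'v::euclidean_space \<Rightarrow> 'a"
  assumes cov: "covering_space X P Y" and r: "0 < r"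
    and cg: "continuous_on (ball 0 r) g" and gY: "g ` ball 0 r \<subseteq> Y"
    and x0: "x0 \<in> X" "P x0 = g 0"
  obtains h where "continuous_on (ball 0 r) h" "h ` ball 0 r \<subseteq> X" "h 0 = x0" "\<forall>z\<in>ball 0 r. P (h z) = g z"
proof -
  \<comment> \<open>The fibre product of \<open>g\<close> and \<open>P\<close>: sections of
    \<open>fst\<close> over the ball are exactly the graphs of lifts of \<open>g\<close>.\<close>
  define E where "E = {e. fst e \<in> ball 0 r \<and> snd e \<in> X \<and> P (snd e) = g (fst e)}"
  have loc: "\<exists>d>0. \<exists>s N. continuous_on (ball (fst e) d) s \<and> s ` ball (fst e) d \<subseteq> E \<and>
          (\<forall>z\<in>ball (fst e) d. fst (s z) = z) \<and> openin (top_of_set E) N \<and> e \<in> N \<and> (\<forall>e'\<in>N. s (fst e') = e')"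
    if e: "e \<in> E" for e
  proof -
    obtain z x where ex: "e = (z, x)" by fastforce
    have zx: "z \<in> ball 0 r" "x \<in> X" "P x = g z" using e by (auto simp: E_def ex)
    obtain T u q where T: "x \<in> T" "openin (top_of_set X) T" "P x \<in> u" "openin (top_of_set Y) u"
        "homeomorphism T u P q"
      using covering_space_local_homeomorphism[OF cov zx(2)] by metis
    have "openin (top_of_set (ball 0 r)) (ball 0 r \<inter> g -` u)"
      using continuous_openin_preimage[OF cg _ T(4)] gY by (simp add: image_subset_iff_funcset)
    then have "open (ball 0 r \<inter> g -` u)" by (metis open_ball openin_open_eq)
    moreover have "z \<in> ball 0 r \<inter> g -` u" using zx T(3) by simp
    ultimately obtain d where d: "d > 0" "ball z d \<subseteq> ball 0 r \<inter> g -` u"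
      by (meson openE)
    \<comment> \<open>A local inverse \<open>q\<close> of \<open>P\<close> near \<open>x\<close>,
      composed with \<open>g\<close>, gives the local section of the fibre product.\<close>
    define s where "s = (\<lambda>z'. (z', q (g z')))"
    obtain Q where Q: "open Q" "T = X \<inter> Q" using T(2) unfolding openin_open by blast
    define N where "N = E \<inter> (ball z d \<times> Q)"
    have cs: "continuous_on (ball z d) s"
      unfolding s_def using d
      by (intro continuous_intros continuous_on_compose2[OF homeomorphism_cont2[OF T(5)]]
          continuous_on_subset[OF cg]) auto
    have qT: "q y \<in> X" "P (q y) = y" if "y \<in> u" for y
      using T(5) that Q unfolding homeomorphism_def by blast+
    have "\<forall>e'\<in>N. s (fst e') = e'"
    proof
      fix e' assume "e' \<in> N"
      then have "snd e' \<in> T" "P (snd e') = g (fst e')" using Q(2) by (auto simp: N_def E_def)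
      moreover have "q (P (snd e')) = snd e'"
        using T(5) calculation(1) unfolding homeomorphism_def by blast
      ultimately show "s (fst e') = e'" by (simp add: s_def prod_eq_iff)
    qed
    moreover have "openin (top_of_set E) N" unfolding N_def
      by (intro openin_open_Int open_Times) (use Q in auto)
    moreover have "e \<in> N" using e d(1) T(1) Q by (auto simp: N_def ex)
    moreover have "s ` ball z d \<subseteq> E" using d(2) qT by (auto simp: s_def E_def)
    moreover have "\<forall>z'\<in>ball z d. fst (s z') = z'" by (simp add: s_def)
    ultimately show ?thesis using d(1) cs unfolding ex fst_conv by blast
  qed
  have ray: "\<exists>e\<in>E. ((\<lambda>t. G (t *\<^sub>R \<zeta>)) \<longlongrightarrow> e) (at_left 1)"
    if R: "0 < R" "R < r" and cG: "continuous_on (ball 0 R) G" and GE: "G ` ball 0 R \<subseteq> E"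
      and Gz: "\<forall>z\<in>ball 0 R. fst (G z) = z" and \<zeta>: "norm \<zeta> = R" for R G \<zeta>
  proof -
    define x where "x t = snd (G (t *\<^sub>R \<zeta>))" for t :: real
    have inb: "t *\<^sub>R \<zeta> \<in> ball 0 R" if "t \<in> {0..<1}" for t using that \<zeta> R by auto
    have Gt: "fst (G (t *\<^sub>R \<zeta>)) = t *\<^sub>R \<zeta>" "x t \<in> X" "P (x t) = g (t *\<^sub>R \<zeta>)" if "t \<in> {0..<1}" for t
    proof -
      have "G (t *\<^sub>R \<zeta>) \<in> E" using GE inb[OF that] by blast
      moreover show 1: "fst (G (t *\<^sub>R \<zeta>)) = t *\<^sub>R \<zeta>" using Gz inb[OF that] by blast
      ultimately show "x t \<in> X" "P (x t) = g (t *\<^sub>R \<zeta>)" by (simp_all add: E_def x_def 1)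
    qed
    have cx: "continuous_on {0..<1} x" unfolding x_def
      by (intro continuous_intros continuous_on_compose2[OF cG]) (use inb in auto)
    have ev: "eventually (\<lambda>t::real. t \<in> {0..<1}) (at_left 1)"
      by (auto simp: eventually_at_left_field intro!: exI[of _ 0])
    have lt: "((\<lambda>t. t *\<^sub>R \<zeta>) \<longlongrightarrow> 1 *\<^sub>R \<zeta>) (at_left 1)" by (intro tendsto_intros)
    have \<zeta>b: "\<zeta> \<in> ball 0 r" using \<zeta> R by simp
    then have "isCont g \<zeta>" using cg by (simp add: continuous_on_eq_continuous_at)
    then have "((\<lambda>t. g (t *\<^sub>R \<zeta>)) \<longlongrightarrow> g \<zeta>) (at_left 1)"
      using isCont_tendsto_compose[of \<zeta> g] lt by simp
    then have "((\<lambda>t. P (x t)) \<longlongrightarrow> g \<zeta>) (at_left 1)"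
      by (rule Lim_transform_eventually) (rule eventually_mono[OF ev], use Gt in auto)
    moreover have "g \<zeta> \<in> Y" using gY \<zeta>b by blast
    moreover have "x ` {0..<1} \<subseteq> X" using Gt(2) by blast
    \<comment> \<open>The first component of the ray limit is \<zeta> itself; only the second
      component has to be lifted from the base.\<close>
    ultimately obtain e where e: "e \<in> X" "P e = g \<zeta>" "(x \<longlongrightarrow> e) (at_left 1)"
      using covering_space_limit_lift[OF cov _ cx] zero_less_one by metis
    have "((\<lambda>t. (t *\<^sub>R \<zeta>, x t)) \<longlongrightarrow> (\<zeta>, e)) (at_left 1)"
      using tendsto_Pair[OF lt e(3)] by simp
    then have "((\<lambda>t. G (t *\<^sub>R \<zeta>)) \<longlongrightarrow> (\<zeta>, e)) (at_left 1)"
      by (rule Lim_transform_eventually)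
         (rule eventually_mono[OF ev], use Gt in \<open>simp add: x_def prod_eq_iff\<close>)
    moreover have "(\<zeta>, e) \<in> E" using e \<zeta>b by (simp add: E_def)
    ultimately show ?thesis by blast
  qed
  have cf: "continuous_on E fst" by (intro continuous_intros)
  have e0: "(0, x0) \<in> E" using x0 r by (simp add: E_def)
  obtain G where G: "continuous_on (ball 0 r) G" "G ` ball 0 r \<subseteq> E" "\<forall>z\<in>ball 0 r. fst (G z) = z" "G 0 = (0, x0)"
    by (rule section_over_ball[of E fst r "(0, x0)", OF cf _ _ e0 fst_conv r])
       (erule loc, (rule ray; assumption), blast)
  have GE: "G z \<in> E" "fst (G z) = z" if "z \<in> ball 0 r" for z
    using G(2,3) that by blast+
  show ?thesis
  proof (rule that[of "\<lambda>z. snd (G z)"])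
    show "continuous_on (ball 0 r) (\<lambda>z. snd (G z))" using G(1) by (intro continuous_intros)
    show "(\<lambda>z. snd (G z)) ` ball 0 r \<subseteq> X" using GE(1) by (auto simp: E_def)
    show "snd (G 0) = x0" using G(4) by simp
    show "\<forall>z\<in>ball 0 r. P (snd (G z)) = g z"
    proof
      fix z :: 'v assume z: "z \<in> ball 0 r"
      then show "P (snd (G z)) = g z" using GE[OF z] unfolding E_def mem_Collect_eq by simp
    qed
  qed
qed

section \<open>Closure properties of k times continuous differentiability, and symmetry of second
  derivatives\<close>

section \<open>Differentiable functions\<close>

lemma frechet_derivativeI: "(u has_derivative D) (at z) \<Longrightarrow> frechet_derivative u (at z) = D"
  using frechet_derivative_at by metis

lemma Ck_on_cong:
  assumes S: "open S" and eq: "\<And>z. z \<in> S \<Longrightarrow> u z = v z" and u: "Ck_on k S u"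
  shows "Ck_on k S v"
  using eq u
proof (induction k arbitrary: u v)
  case 0
  then show ?case by (auto cong: continuous_on_cong)
next
  case (Suc k)
  have d: "(v has_derivative frechet_derivative u (at z)) (at z)" if "z \<in> S" for z
  proof (rule has_derivative_transform_within_open[OF _ S that])
    show "(u has_derivative frechet_derivative u (at z)) (at z)"
      using Suc.prems(2) that by (auto simp: frechet_derivative_works[symmetric])
  qed (fact Suc.prems(1))
  have "Ck_on k S (\<lambda>z. frechet_derivative v (at z) b)" if "b \<in> Basis" for b
    by (rule Suc.IH[of "\<lambda>z. frechet_derivative u (at z) b"])
       (use Suc.prems(2) that frechet_derivativeI[OF d] in auto)
  then show ?case using d by (auto simp: differentiable_def)
qed

lemma Ck_on_Suc_imp: "Ck_on (Suc k) S u \<Longrightarrow> Ck_on k S u"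
proof (induction k arbitrary: u)
  case 0
  then show ?case
    by (auto intro!: continuous_at_imp_continuous_on differentiable_imp_continuous_within)
next
  case (Suc k)
  then show ?case by (metis Ck_on.simps(2))
qed

lemma Ck_on_local:
  assumes "\<And>z. z \<in> S \<Longrightarrow> \<exists>N. open N \<and> z \<in> N \<and> Ck_on k N u"
  shows "Ck_on k S u"
  using assms
proof (induction k arbitrary: u)
  case 0
  show ?case unfolding Ck_on.simps
  proof (rule continuous_at_imp_continuous_on, rule ballI)
    fix z assume "z \<in> S"
    then obtain N where "open N" "z \<in> N" "continuous_on N u" using 0[of z] by auto
    then show "isCont u z" by (simp add: continuous_on_eq_continuous_at)
  qed
next
  case (Suc k)
  have "u differentiable (at z)" if "z \<in> S" for z
    using Suc.prems[OF that] by auto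
  moreover have "Ck_on k S (\<lambda>z. frechet_derivative u (at z) b)" if "b \<in> Basis" for b
  proof (rule Suc.IH)
    fix z assume "z \<in> S"
    then show "\<exists>N. open N \<and> z \<in> N \<and> Ck_on k N (\<lambda>z. frechet_derivative u (at z) b)"
      using Suc.prems[of z] that by auto
  qed
  ultimately show ?case by simp
qed

lemma Ck_on_const: "Ck_on k S (\<lambda>z. c)"
  by (induction k arbitrary: c) (auto simp: frechet_derivative_const)

text \<open>This lets the closure lemmas exhibit some derivative \<open>D\<close> by the usual rules
  in place of computing \<open>frechet_derivative\<close>.\<close>

lemma Ck_on_SucI:
  assumes "open S" "\<And>z. z \<in> S \<Longrightarrow> (u has_derivative D z) (at z)" "\<And>b. b \<in> Basis \<Longrightarrow> Ck_on k S (\<lambda>z. D z b)"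
  shows "Ck_on (Suc k) S u"
proof -
  have "Ck_on k S (\<lambda>z. frechet_derivative u (at z) b)" if "b \<in> Basis" for b
    by (rule Ck_on_cong[OF assms(1) _ assms(3)[OF that]]) (use frechet_derivativeI[OF assms(2)] in auto)
  then show ?thesis using assms(2) by (auto simp: differentiable_def)
qed

lemma Ck_on_SucD:
  assumes "Ck_on (Suc k) S u" "z \<in> S"
  shows "(u has_derivative frechet_derivative u (at z)) (at z)"
  using assms by (auto simp: frechet_derivative_works[symmetric])

lemma Ck_on_add:
  assumes S: "open S" and "Ck_on k S u" "Ck_on k S v"
  shows "Ck_on k S (\<lambda>z. u z + v z)"
  using assms(2,3)
proof (induction k arbitrary: u v)
  case 0
  then show ?case by (auto intro: continuous_intros)
next
  case (Suc k)
  show ?case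
  proof (rule Ck_on_SucI[OF S])
    show "((\<lambda>z. u z + v z) has_derivative (\<lambda>h. frechet_derivative u (at z) h + frechet_derivative v (at z) h)) (at z)"
      if "z \<in> S" for z
      by (intro has_derivative_add Ck_on_SucD[OF Suc.prems(1) that] Ck_on_SucD[OF Suc.prems(2) that])
    show "Ck_on k S (\<lambda>z. frechet_derivative u (at z) b + frechet_derivative v (at z) b)" if "b \<in> Basis" for b
      using Suc.prems that by (intro Suc.IH) auto
  qed
qed

lemma Ck_on_mult:
  assumes S: "open S" and "Ck_on k S u" "Ck_on k S v"
  shows "Ck_on k S (\<lambda>z. u z * v z)"
  using assms(2,3)
proof (induction k arbitrary: u v)
  case 0
  then show ?case by (auto intro: continuous_intros)
next
  case (Suc k)
  show ?case
  proof (rule Ck_on_SucI[OF S])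
    show "((\<lambda>z. u z * v z) has_derivative (\<lambda>h. u z * frechet_derivative v (at z) h + frechet_derivative u (at z) h * v z)) (at z)"
      if "z \<in> S" for z
      by (intro has_derivative_mult Ck_on_SucD[OF Suc.prems(1) that] Ck_on_SucD[OF Suc.prems(2) that])
    show "Ck_on k S (\<lambda>z. u z * frechet_derivative v (at z) b + frechet_derivative u (at z) b * v z)" if "b \<in> Basis" for b
      using Suc.prems Suc.prems[THEN Ck_on_Suc_imp] that by (intro Ck_on_add[OF S] Suc.IH) auto
  qed
qed

lemma Ck_on_inverse:
  assumes S: "open S" and "Ck_on k S u" and nz: "\<And>z. z \<in> S \<Longrightarrow> u z \<noteq> 0"
  shows "Ck_on k S (\<lambda>z. inverse (u z))"
  using assms(2)
proof (induction k)
  case 0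
  then show ?case using nz by (auto intro!: continuous_intros)
next
  case (Suc k)
  have IH: "Ck_on k S (\<lambda>z. inverse (u z))" using Suc Ck_on_Suc_imp by blast
  show ?case
  proof (rule Ck_on_SucI[OF S])
    show "((\<lambda>z. inverse (u z)) has_derivative (\<lambda>h. (- 1) * (inverse (u z) * (inverse (u z) * frechet_derivative u (at z) h)))) (at z)"
      if "z \<in> S" for z
      by (rule has_derivative_eq_rhs, rule Deriv.has_derivative_inverse, rule nz[OF that], rule Ck_on_SucD[OF Suc.prems that])
         (auto simp: fun_eq_iff)
    show "Ck_on k S (\<lambda>z. (- 1) * (inverse (u z) * (inverse (u z) * frechet_derivative u (at z) b)))" if "b \<in> Basis" for b
      using Suc.prems that by (intro Ck_on_mult[OF S] IH Ck_on_const) auto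
  qed
qed

text \<open>The derivative of ln u is u' / u and no longer contains a logarithm, so a case
  distinction on \<open>k\<close> replaces induction.\<close>

lemma Ck_on_ln:
  assumes S: "open S" and u: "Ck_on k S u" and pos: "\<And>z. z \<in> S \<Longrightarrow> 0 < u z"
  shows "Ck_on k S (\<lambda>z. ln (u z))"
proof (cases k)
  case 0
  then show ?thesis using u pos by (auto intro!: continuous_intros simp: less_imp_neq[symmetric])
next
  case (Suc k')
  note u' = u[unfolded Suc]
  have nz: "u z \<noteq> 0" if "z \<in> S" for z using pos[OF that] by simp
  show ?thesis unfolding Suc
  proof (rule Ck_on_SucI[OF S])
    show "((\<lambda>z. ln (u z)) has_derivative (\<lambda>h. inverse (u z) * frechet_derivative u (at z) h)) (at z)"
      if "z \<in> S" for z
      by (rule has_derivative_eq_rhs[OF has_derivative_ln[OF pos[OF that] Ck_on_SucD[OF u' that]]])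
         (auto simp: fun_eq_iff field_simps)
    show "Ck_on k' S (\<lambda>z. inverse (u z) * frechet_derivative u (at z) b)" if "b \<in> Basis" for b
      using u' that nz by (intro Ck_on_mult[OF S] Ck_on_inverse[OF S] Ck_on_Suc_imp[OF u']) auto
  qed
qed

text \<open>Here the square root reappears in its own derivative, hence the induction.\<close>

lemma Ck_on_sqrt:
  assumes S: "open S" and "Ck_on k S u" and pos: "\<And>z. z \<in> S \<Longrightarrow> 0 < u z"
  shows "Ck_on k S (\<lambda>z. sqrt (u z))"
  using assms(2)
proof (induction k)
  case 0
  then show ?case by (auto intro!: continuous_intros)
next
  case (Suc k)
  have IH: "Ck_on k S (\<lambda>z. sqrt (u z))" using Suc Ck_on_Suc_imp by blast
  show ?case
  proof (rule Ck_on_SucI[OF S])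
    show "((\<lambda>z. sqrt (u z)) has_derivative (\<lambda>h. (1/2) * (inverse (sqrt (u z)) * frechet_derivative u (at z) h))) (at z)"
      if "z \<in> S" for z
      by (rule has_derivative_eq_rhs[OF has_derivative_real_sqrt[OF pos[OF that] Ck_on_SucD[OF Suc.prems that]]])
         (auto simp: fun_eq_iff field_simps)
    have nz: "sqrt (u z) \<noteq> 0" if "z \<in> S" for z using pos[OF that] by simp
    show "Ck_on k S (\<lambda>z. (1/2) * (inverse (sqrt (u z)) * frechet_derivative u (at z) b))" if "b \<in> Basis" for b
      using Suc.prems that by (intro Ck_on_mult[OF S] Ck_on_inverse[OF S IH nz] Ck_on_const) auto
  qed
qed

text \<open>The factor \<open>c\<close> makes the induction close: the derivative in direction b is
  the real part of (c b) f', which has the same shape. Taking c = - \<i> also covers imaginary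
  parts.\<close>

lemma Ck_on_Re_holomorphic:
  assumes S: "open S" and "f holomorphic_on S"
  shows "Ck_on k S (\<lambda>z. Re (c * f z))"
  using assms(2)
proof (induction k arbitrary: f c)
  case 0
  then show ?case by (auto intro!: continuous_intros holomorphic_on_imp_continuous_on)
next
  case (Suc k)
  show ?case
  proof (rule Ck_on_SucI[OF S])
    show "((\<lambda>z. Re (c * f z)) has_derivative (\<lambda>h. Re (c * (deriv f z * h)))) (at z)" if "z \<in> S" for z
    proof -
      have "(f has_derivative (\<lambda>h. deriv f z * h)) (at z)"
        using holomorphic_derivI[OF Suc.prems S that] by (simp add: has_field_derivative_def)
      then show ?thesis by (auto intro!: derivative_eq_intros)
    qed
    show "Ck_on k S (\<lambda>z. Re (c * (deriv f z * b)))" for b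
      using Suc.IH[OF holomorphic_deriv[OF Suc.prems S], of "c * b"] by (simp add: mult_ac)
  qed
qed

lemma Ck_on_norm2_holomorphic:
  assumes S: "open S" and f: "f holomorphic_on S"
  shows "Ck_on k S (\<lambda>z. (cmod (f z))\<^sup>2)"
proof -
  have "Ck_on k S (\<lambda>z. Re (1 * f z) * Re (1 * f z) + Re (- \<i> * f z) * Re (- \<i> * f z))"
    by (intro Ck_on_add[OF S] Ck_on_mult[OF S] Ck_on_Re_holomorphic[OF S f])
  moreover have "Re (1 * w) * Re (1 * w) + Re (- \<i> * w) * Re (- \<i> * w) = (cmod w)\<^sup>2" for w
    unfolding cmod_power2 by (simp add: power2_eq_square)
  ultimately show ?thesis by simp
qed

lemma has_derivative_components:
  fixes u :: "complex \<Rightarrow> real"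
  assumes "u differentiable (at z)"
  shows "(u has_derivative (\<lambda>h. Re h * frechet_derivative u (at z) 1 + Im h * frechet_derivative u (at z) \<i>)) (at z)"
proof -
  have D: "(u has_derivative frechet_derivative u (at z)) (at z)"
    using assms by (simp add: frechet_derivative_works)
  interpret L: linear "frechet_derivative u (at z)" using D by (rule has_derivative_linear)
  have "frechet_derivative u (at z) h = Re h * frechet_derivative u (at z) 1 + Im h * frechet_derivative u (at z) \<i>" for h
  proof -
    have "h = Re h *\<^sub>R 1 + Im h *\<^sub>R \<i>" by (simp add: complex_eq_iff)
    then have "frechet_derivative u (at z) h = frechet_derivative u (at z) (Re h *\<^sub>R 1 + Im h *\<^sub>R \<i>)" by simp
    then show ?thesis by (simp only: L.add L.scaleR real_scaleR_def)
  qed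
  then have eq: "frechet_derivative u (at z) =
      (\<lambda>h. Re h * frechet_derivative u (at z) 1 + Im h * frechet_derivative u (at z) \<i>)" by (rule ext)
  show ?thesis using D by (subst (asm) eq)
qed

lemma has_real_derivative_along:
  fixes u :: "complex \<Rightarrow> real"
  assumes "u differentiable (at (c + t *\<^sub>R d))"
  shows "((\<lambda>t. u (c + t *\<^sub>R d)) has_real_derivative frechet_derivative u (at (c + t *\<^sub>R d)) d) (at t)"
proof -
  have D: "(u has_derivative frechet_derivative u (at (c + t *\<^sub>R d))) (at (c + t *\<^sub>R d))"
    using assms by (simp add: frechet_derivative_works)
  have "((\<lambda>t. c + t *\<^sub>R d) has_derivative (\<lambda>h. h *\<^sub>R d)) (at t)" by (auto intro!: derivative_eq_intros)
  from has_derivative_compose[OF this D]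
  show ?thesis
    by (simp add: has_field_derivative_def linear_cmul[OF has_derivative_linear[OF D]] mult_commute_abs)
qed

text \<open>The mean value theorem is applied twice, first in direction \<open>d\<close> to the
  difference of two parallel sides and then in direction \<open>e\<close>. Exchanging
  \<open>d\<close> and \<open>e\<close> leaves the left-hand side alone and exchanges the order of
  differentiation on the right.\<close>

lemma second_difference:
  fixes u :: "complex \<Rightarrow> real"
  assumes h: "0 < h" and sub: "\<And>s t. 0 \<le> s \<Longrightarrow> s \<le> h \<Longrightarrow> 0 \<le> t \<Longrightarrow> t \<le> h \<Longrightarrow> z + s *\<^sub>R d + t *\<^sub>R e \<in> S"
    and u: "\<And>w. w \<in> S \<Longrightarrow> u differentiable (at w)"
    and p: "\<And>w. w \<in> S \<Longrightarrow> (\<lambda>w. frechet_derivative u (at w) d) differentiable (at w)"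
  obtains s t where "0 < s" "s < h" "0 < t" "t < h"
    "u (z + h *\<^sub>R d + h *\<^sub>R e) - u (z + h *\<^sub>R d) - u (z + h *\<^sub>R e) + u z =
      h\<^sup>2 * frechet_derivative (\<lambda>w. frechet_derivative u (at w) d) (at (z + s *\<^sub>R d + t *\<^sub>R e)) e"
proof -
  define \<phi> where "\<phi> s = u (z + h *\<^sub>R e + s *\<^sub>R d) - u (z + s *\<^sub>R d)" for s
  let ?p = "\<lambda>w. frechet_derivative u (at w) d"
  have "\<exists>s. 0 < s \<and> s < h \<and> \<phi> h - \<phi> 0 = (h - 0) * (?p (z + h *\<^sub>R e + s *\<^sub>R d) - ?p (z + s *\<^sub>R d))"
  proof (rule MVT2[OF h])
    fix s assume s: "0 \<le> s" "s \<le> h"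
    show "DERIV \<phi> s :> ?p (z + h *\<^sub>R e + s *\<^sub>R d) - ?p (z + s *\<^sub>R d)"
      unfolding \<phi>_def
      by (intro DERIV_diff has_real_derivative_along u)
         (use sub[OF s, of h] sub[OF s, of 0] h in \<open>auto simp: algebra_simps\<close>)
  qed
  then obtain s where s: "0 < s" "s < h" "\<phi> h - \<phi> 0 = h * (?p (z + h *\<^sub>R e + s *\<^sub>R d) - ?p (z + s *\<^sub>R d))" by auto
  have "\<exists>t. 0 < t \<and> t < h \<and> ?p (z + s *\<^sub>R d + h *\<^sub>R e) - ?p (z + s *\<^sub>R d + 0 *\<^sub>R e) =
      (h - 0) * frechet_derivative ?p (at (z + s *\<^sub>R d + t *\<^sub>R e)) e"
    by (rule MVT2[OF h]) (intro has_real_derivative_along p sub, use s in auto)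
  then obtain t where t: "0 < t" "t < h" "?p (z + s *\<^sub>R d + h *\<^sub>R e) - ?p (z + s *\<^sub>R d) =
      h * frechet_derivative ?p (at (z + s *\<^sub>R d + t *\<^sub>R e)) e" by auto
  have eq: "z + h *\<^sub>R e + x = z + x + h *\<^sub>R e" for x by (simp add: algebra_simps)
  show ?thesis
    by (rule that[OF s(1,2) t(1,2)])
       (use s(3) t(3) in \<open>simp add: \<phi>_def eq power2_eq_square algebra_simps\<close>)
qed

text \<open>A second difference over a square is symmetric in the two directions, and by
  \<open>second_difference\<close> it is the squared side times either mixed derivative at some
  point of the square. Continuity does the rest as the square shrinks.\<close>

lemma mixed_partials:
  fixes u :: "complex \<Rightarrow> real"
  assumes S: "open S" and u: "Ck_on 2 S u" and z: "z \<in> S"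
  shows "frechet_derivative (\<lambda>w. frechet_derivative u (at w) 1) (at z) \<i> =
    frechet_derivative (\<lambda>w. frechet_derivative u (at w) \<i>) (at z) 1"
proof (rule ccontr)
  let ?p = "\<lambda>w. frechet_derivative (\<lambda>w. frechet_derivative u (at w) 1) (at w) \<i>"
  let ?q = "\<lambda>w. frechet_derivative (\<lambda>w. frechet_derivative u (at w) \<i>) (at w) 1"
  assume neq: "?p z \<noteq> ?q z"
  define \<epsilon> where "\<epsilon> = \<bar>?p z - ?q z\<bar> / 2"
  have \<epsilon>: "\<epsilon> > 0" using neq by (simp add: \<epsilon>_def)
  have u2: "Ck_on (Suc (Suc 0)) S u" using u by (simp add: numeral_2_eq_2)
  have diffs: "u differentiable (at w)" "(\<lambda>w. frechet_derivative u (at w) 1) differentiable (at w)"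
      "(\<lambda>w. frechet_derivative u (at w) \<i>) differentiable (at w)" if "w \<in> S" for w
    using u2 that by (auto simp: Basis_complex_def)
  have cont: "continuous_on S ?p" "continuous_on S ?q"
    using u2 by (auto simp: Basis_complex_def)
  have "isCont ?p z" "isCont ?q z" using cont S z by (auto simp: continuous_on_eq_continuous_at)
  then obtain d1 d2 where d: "d1 > 0" "\<And>w. dist w z < d1 \<Longrightarrow> dist (?p w) (?p z) < \<epsilon>"
      "d2 > 0" "\<And>w. dist w z < d2 \<Longrightarrow> dist (?q w) (?q z) < \<epsilon>"
    unfolding continuous_at_eps_delta using \<epsilon> by metis
  obtain d3 where d3: "d3 > 0" "ball z d3 \<subseteq> S" using S z by (meson openE)
  \<comment> \<open>A point of the square with side \<open>h\<close> is at distance at most 2 h from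
    \<open>z\<close>; the divisor 3 keeps this below all three radii.\<close>
  define h where "h = min d1 (min d2 d3) / 3"
  have h: "0 < h" "2 * h < d1" "2 * h < d2" "2 * h < d3" using d d3 by (auto simp: h_def)
  have near: "dist (z + s *\<^sub>R 1 + t *\<^sub>R \<i>) z \<le> 2 * h" "dist (z + s *\<^sub>R \<i> + t *\<^sub>R 1) z \<le> 2 * h"
    if "0 \<le> s" "s \<le> h" "0 \<le> t" "t \<le> h" for s t
    using norm_triangle_ineq[of "s *\<^sub>R (1::complex)" "t *\<^sub>R \<i>"] norm_triangle_ineq[of "s *\<^sub>R \<i>" "t *\<^sub>R (1::complex)"] that
    by (auto simp: dist_norm add.assoc)
  have inS: "z + s *\<^sub>R 1 + t *\<^sub>R \<i> \<in> S" "z + s *\<^sub>R \<i> + t *\<^sub>R 1 \<in> S"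
    if "0 \<le> s" "s \<le> h" "0 \<le> t" "t \<le> h" for s t
    using near[OF that] h(4) d3(2) by (auto simp: subset_iff dist_commute)
  obtain s t where st: "0 < s" "s < h" "0 < t" "t < h"
    "u (z + h *\<^sub>R 1 + h *\<^sub>R \<i>) - u (z + h *\<^sub>R 1) - u (z + h *\<^sub>R \<i>) + u z = h\<^sup>2 * ?p (z + s *\<^sub>R 1 + t *\<^sub>R \<i>)"
    using second_difference[OF h(1) inS(1) diffs(1,2)] by blast
  obtain s' t' where st': "0 < s'" "s' < h" "0 < t'" "t' < h"
    "u (z + h *\<^sub>R \<i> + h *\<^sub>R 1) - u (z + h *\<^sub>R \<i>) - u (z + h *\<^sub>R 1) + u z = h\<^sup>2 * ?q (z + s' *\<^sub>R \<i> + t' *\<^sub>R 1)"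
    using second_difference[OF h(1) inS(2) diffs(1,3)] by blast
  have "z + h *\<^sub>R \<i> + h *\<^sub>R 1 = z + h *\<^sub>R 1 + h *\<^sub>R \<i>" by simp
  have "h\<^sup>2 * ?p (z + s *\<^sub>R 1 + t *\<^sub>R \<i>) = h\<^sup>2 * ?q (z + s' *\<^sub>R \<i> + t' *\<^sub>R 1)"
    using st(5) st'(5)[unfolded \<open>z + h *\<^sub>R \<i> + h *\<^sub>R 1 = z + h *\<^sub>R 1 + h *\<^sub>R \<i>\<close>] by linarith
  then have eq: "?p (z + s *\<^sub>R 1 + t *\<^sub>R \<i>) = ?q (z + s' *\<^sub>R \<i> + t' *\<^sub>R 1)" using h(1) by simp
  have "dist (?p (z + s *\<^sub>R 1 + t *\<^sub>R \<i>)) (?p z) < \<epsilon>"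
    by (rule d(2)) (use near(1)[of s t] st h in linarith)
  moreover have "dist (?q (z + s' *\<^sub>R \<i> + t' *\<^sub>R 1)) (?q z) < \<epsilon>"
    by (rule d(4)) (use near(2)[of s' t'] st' h in linarith)
  moreover have "False" if "\<bar>x - a\<bar> < \<bar>a - b\<bar> / 2" "\<bar>x - b\<bar> < \<bar>a - b\<bar> / 2" for x a b :: real
    using that by (simp add: abs_if split: if_splits)
  ultimately show False unfolding eq dist_real_def \<epsilon>_def by blast
qed

section \<open>Liouville's equation in terms of Wirtinger derivatives\<close>

section \<open>The equation of constant curvature\<close>

text \<open>\<open>a\<close> and \<open>b\<close> are \<open>\<partial>u/\<partial>z\<close> and \<open>\<partial>\<^sup>2u/\<partial>z\<^sup>2\<close> (Wirtinger derivatives), and the \<open>\<partial>/\<partial>z\<bar>\<close>-derivatives of both are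
  determined by the equation \<open>\<Delta>u = exp (2u)\<close>.\<close>

definition liouville :: "complex set \<Rightarrow> (complex \<Rightarrow> real) \<Rightarrow> (complex \<Rightarrow> complex) \<Rightarrow> (complex \<Rightarrow> complex) \<Rightarrow> bool" where
  "liouville S u a b \<longleftrightarrow> (\<forall>z\<in>S.
     (u has_derivative (\<lambda>h. 2 * Re (a z * h))) (at z) \<and>
     (a has_derivative (\<lambda>h. b z * h + of_real (exp (2 * u z)) / 4 * cnj h)) (at z) \<and>
     (\<exists>c. (b has_derivative (\<lambda>h. c * h + of_real (exp (2 * u z)) * a z / 2 * cnj h)) (at z)))"

text \<open>The second derivative of \<open>u\<close> in direction d is 2 Re ((b d + exp (2 u) cnj d
  / 4) d). Over the directions 1 and \<i> the terms with \<open>b\<close> cancel, and each direction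
  contributes exp (2 u) / 2.\<close>

lemma liouville_laplacian:
  assumes S: "open S" and L: "liouville S u a b" and z: "z \<in> S"
  shows "laplacian u z = exp (2 * u z)"
proof -
  have u: "frechet_derivative u (at w) d = 2 * Re (a w * d)" if "w \<in> S" for w d
    using L that frechet_derivativeI unfolding liouville_def by metis
  have a: "(a has_derivative (\<lambda>h. b z * h + of_real (exp (2 * u z)) / 4 * cnj h)) (at z)"
    using L z unfolding liouville_def by blast
  have "((\<lambda>w. 2 * Re (a w * d)) has_derivative (\<lambda>h. 2 * Re ((b z * h + of_real (exp (2 * u z)) / 4 * cnj h) * d))) (at z)" for d
    by (intro has_derivative_mult_right bounded_linear.has_derivative[OF bounded_linear_Re] has_derivative_mult_left a)
  then have D: "((\<lambda>w. frechet_derivative u (at w) d) has_derivative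
      (\<lambda>h. 2 * Re ((b z * h + of_real (exp (2 * u z)) / 4 * cnj h) * d))) (at z)" for d
    by (rule has_derivative_transform_within_open[OF _ S z]) (simp add: u)
  then have "frechet_derivative (\<lambda>w. frechet_derivative u (at w) d) (at z) d =
      2 * Re ((b z * d + of_real (exp (2 * u z)) / 4 * cnj d) * d)" for d
    by (simp only: frechet_derivativeI[OF D])
  then show ?thesis by (simp add: laplacian_def Basis_complex_def)
qed

text \<open>The zbar-derivative of \<open>a\<close> is a quarter of the Laplacian of
  \<open>u\<close>. That of \<open>b\<close> is a quarter of the z-derivative of the Laplacian,
  which the equation turns into exp (2 u) a / 2. As \<open>b\<close> is of second order in
  \<open>u\<close>, differentiating it takes a third order.\<close>

lemma liouville_if_laplacian:
  assumes S: "open S" and u: "Ck_on 3 S u" and lap: "\<And>z. z \<in> S \<Longrightarrow> laplacian u z = exp (2 * u z)"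
  obtains a b where "liouville S u a b"
proof -
  define p where "p = (\<lambda>w. frechet_derivative u (at w) 1)"
  define q where "q = (\<lambda>w. frechet_derivative u (at w) \<i>)"
  define p1 where "p1 = (\<lambda>w. frechet_derivative p (at w) 1)"
  define p2 where "p2 = (\<lambda>w. frechet_derivative p (at w) \<i>)"
  define q1 where "q1 = (\<lambda>w. frechet_derivative q (at w) 1)"
  define q2 where "q2 = (\<lambda>w. frechet_derivative q (at w) \<i>)"
  have C3: "Ck_on (Suc (Suc (Suc 0))) S u" using u by (simp add: numeral_3_eq_3)
  have du: "u differentiable (at w)" "p differentiable (at w)" "q differentiable (at w)"
    "p1 differentiable (at w)" "p2 differentiable (at w)" "q1 differentiable (at w)" "q2 differentiable (at w)"
    if "w \<in> S" for w
    using C3 that unfolding p1_def p2_def q1_def q2_def p_def q_def by (auto simp: Basis_complex_def)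
  have C2u: "Ck_on 2 S u" using Ck_on_Suc_imp[OF C3] by (simp add: numeral_2_eq_2)
  have C2: "Ck_on 2 S p" "Ck_on 2 S q"
    using C3 unfolding p_def q_def numeral_2_eq_2 Ck_on.simps(2)[of "Suc (Suc 0)"] by (auto simp: Basis_complex_def)
  have qp: "q1 w = p2 w" if "w \<in> S" for w
    using mixed_partials[OF S C2u that] by (simp add: p_def q_def q1_def p2_def)
  note der = has_derivative_components
  have Du: "(u has_derivative (\<lambda>h. Re h * p w + Im h * q w)) (at w)" if "w \<in> S" for w
    using der[OF du(1)[OF that]] by (simp add: p_def q_def)
  have Dp: "(p has_derivative (\<lambda>h. Re h * p1 w + Im h * p2 w)) (at w)" if "w \<in> S" for w
    using der[OF du(2)[OF that]] by (simp add: p1_def p2_def)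
  have Dq: "(q has_derivative (\<lambda>h. Re h * p2 w + Im h * q2 w)) (at w)" if "w \<in> S" for w
    using der[OF du(3)[OF that]] qp[OF that] by (simp add: q1_def q2_def)
  have lap': "p1 w + q2 w = exp (2 * u w)" if "w \<in> S" for w
    using lap[OF that] by (simp add: laplacian_def Basis_complex_def p_def q_def p1_def q2_def)
  define a where "a = (\<lambda>w. (of_real (p w) - \<i> * of_real (q w)) / 2 :: complex)"
  define b where "b = (\<lambda>w. (of_real (p1 w) - of_real (q2 w) - 2 * \<i> * of_real (p2 w)) / 4 :: complex)"
  have "liouville S u a b"
    unfolding liouville_def
  proof (intro ballI conjI)
    fix z assume z: "z \<in> S"
    show "(u has_derivative (\<lambda>h. 2 * Re (a z * h))) (at z)"
      by (rule has_derivative_eq_rhs[OF Du[OF z]]) (simp add: a_def fun_eq_iff)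
    have "(a has_derivative (\<lambda>h. (of_real (Re h * p1 z + Im h * p2 z) - \<i> * of_real (Re h * p2 z + Im h * q2 z)) / 2)) (at z)"
      unfolding a_def using Dp[OF z] Dq[OF z] by (auto intro!: derivative_eq_intros)
    moreover have "(of_real (Re h * p1 z + Im h * p2 z) - \<i> * of_real (Re h * p2 z + Im h * q2 z)) / 2 =
        b z * h + of_real (exp (2 * u z)) / 4 * cnj h" for h
      unfolding lap'[OF z, symmetric] by (simp add: b_def complex_eq_iff field_simps)
    ultimately show "(a has_derivative (\<lambda>h. b z * h + of_real (exp (2 * u z)) / 4 * cnj h)) (at z)" by (simp only:)
    define p11 where "p11 = frechet_derivative p1 (at z) 1"
    define p12 where "p12 = frechet_derivative p1 (at z) \<i>"
    define r1 where "r1 = frechet_derivative q2 (at z) 1"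
    define r2 where "r2 = frechet_derivative q2 (at z) \<i>"
    have Dp1: "(p1 has_derivative (\<lambda>h. Re h * p11 + Im h * p12)) (at z)"
      using der[OF du(4)[OF z]] by (simp add: p11_def p12_def)
    have Dq2: "(q2 has_derivative (\<lambda>h. Re h * r1 + Im h * r2)) (at z)"
      using der[OF du(7)[OF z]] by (simp add: r1_def r2_def)
    have m1: "frechet_derivative p2 (at z) 1 = p12"
      using mixed_partials[OF S C2(1) z] by (simp add: p1_def p2_def p12_def)
    have "frechet_derivative p2 (at z) = frechet_derivative q1 (at z)"
      using frechet_derivative_transform_within_open[OF du(6)[OF z] S z, of p2] qp by simp
    then have m2: "frechet_derivative p2 (at z) \<i> = r1"
      using mixed_partials[OF S C2(2) z] by (simp add: q1_def q2_def r1_def)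
    have Dp2: "(p2 has_derivative (\<lambda>h. Re h * p12 + Im h * r1)) (at z)"
      using der[OF du(5)[OF z]] by (simp add: m1 m2)
    \<comment> \<open>Differentiating \<open>p1 + q2 = exp (2 * u)\<close> in two ways expresses
      \<open>p11\<close> and \<open>r2\<close> by the other third derivatives and first-order terms;
      this is what determines the zbar-derivative of \<open>b\<close>.\<close>
    have "((\<lambda>w. exp (2 * u w)) has_derivative (\<lambda>h. exp (2 * u z) * (2 * (Re h * p z + Im h * q z)))) (at z)"
      using Du[OF z] by (auto intro!: derivative_eq_intros)
    moreover have "((\<lambda>w. exp (2 * u w)) has_derivative (\<lambda>h. (Re h * p11 + Im h * p12) + (Re h * r1 + Im h * r2))) (at z)"
      by (rule has_derivative_transform_within_open[OF has_derivative_add[OF Dp1 Dq2] S z]) (simp add: lap')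
    ultimately have eq: "(\<lambda>h. exp (2 * u z) * (2 * (Re h * p z + Im h * q z))) =
        (\<lambda>h. (Re h * p11 + Im h * p12) + (Re h * r1 + Im h * r2))" by (rule has_derivative_unique)
    have e1: "p11 = 2 * exp (2 * u z) * p z - r1" using fun_cong[OF eq, of 1] by simp
    have e2: "r2 = 2 * exp (2 * u z) * q z - p12" using fun_cong[OF eq, of \<i>] by simp
    have "(b has_derivative (\<lambda>h. (of_real (Re h * p11 + Im h * p12) - of_real (Re h * r1 + Im h * r2)
        - 2 * \<i> * of_real (Re h * p12 + Im h * r1)) / 4)) (at z)"
      unfolding b_def using Dp1 Dq2 Dp2 by (auto intro!: derivative_eq_intros)
    \<comment> \<open>\<open>c\<close> is the z-derivative of \<open>b\<close>, half of its
      x-derivative minus \<i> times its y-derivative.\<close>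
    moreover define c :: complex where
      "c = ((of_real p11 - of_real r1 - 2 * \<i> * of_real p12) - \<i> * (of_real p12 - of_real r2 - 2 * \<i> * of_real r1)) / 8"
    have "(of_real (Re h * p11 + Im h * p12) - of_real (Re h * r1 + Im h * r2)
        - 2 * \<i> * of_real (Re h * p12 + Im h * r1)) / 4 = c * h + of_real (exp (2 * u z)) * a z / 2 * cnj h" for h
      by (simp add: c_def a_def complex_eq_iff e1 e2 field_simps)
    ultimately have "(b has_derivative (\<lambda>h. c * h + of_real (exp (2 * u z)) * a z / 2 * cnj h)) (at z)" by (simp only:)
    then show "\<exists>c. (b has_derivative (\<lambda>h. c * h + of_real (exp (2 * u z)) * a z / 2 * cnj h)) (at z)" by blast
  qed
  then show ?thesis by (rule that)
qed

text \<open>Locally ln |f| is the real part of a logarithm of f; differentiating the modulus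
  directly avoids the choice of a branch.\<close>

lemma has_derivative_ln_cmod:
  assumes "f holomorphic_on S" "open S" "z \<in> S" "f z \<noteq> 0"
  shows "((\<lambda>w. ln (cmod (f w))) has_derivative (\<lambda>h. Re (deriv f z / f z * h))) (at z)"
proof -
  have "(f has_derivative (\<lambda>h. deriv f z * h)) (at z)"
    using holomorphic_derivI[OF assms(1-3)] by (simp add: has_field_derivative_def)
  then have "((\<lambda>w. cmod (f w)) has_derivative (\<lambda>h. inner (deriv f z * h) (sgn (f z)))) (at z)"
    using has_derivative_compose[of f "\<lambda>h. deriv f z * h" z UNIV cmod "\<lambda>h. inner h (sgn (f z))"]
      has_derivative_norm[OF assms(4)] by simp
  then have "((\<lambda>w. ln (cmod (f w))) has_derivative (\<lambda>h. inner (deriv f z * h) (sgn (f z)) * inverse (cmod (f z)))) (at z)"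
    using assms(4) by (auto intro!: derivative_eq_intros simp: field_simps)
  moreover have "inner w (sgn v) * inverse (cmod v) = Re (w / v)" for v w
  proof -
    have "Re (w / v) = inner w v / (cmod v)\<^sup>2"
      by (simp add: Re_divide inner_complex_def cmod_power2)
    then show ?thesis by (simp add: sgn_div_norm power2_eq_square field_simps)
  qed
  ultimately show ?thesis by simp
qed

text \<open>The new function is the logarithm of the density pulled back by \<open>g\<close>, and
  exp (2 u) is multiplied by |g'|^2, as Liouville's equation demands because ln |g'| is harmonic.
  The witnesses are its first and second z-derivatives by the chain rule.\<close>

lemma liouville_pullback:
  assumes S: "open S" and T: "open T" and L: "liouville S u a b" and g: "g holomorphic_on T" "g ` T \<subseteq> S"
    and g': "\<And>z. z \<in> T \<Longrightarrow> deriv g z \<noteq> 0"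
  obtains a' b' where "liouville T (\<lambda>z. u (g z) + ln (cmod (deriv g z))) a' b'"
proof -
  define g1 where "g1 = deriv g"
  define g2 where "g2 = deriv g1"
  \<comment> \<open>The z-derivative of ln |g'|.\<close>
  define k where "k = (\<lambda>z. g2 z / (2 * g1 z))"
  have hol: "g1 holomorphic_on T" "g2 holomorphic_on T" unfolding g1_def g2_def
    by (intro holomorphic_deriv g T)+
  have nz: "g1 z \<noteq> 0" if "z \<in> T" for z using g' that by (simp add: g1_def)
  have hk: "k holomorphic_on T" unfolding k_def using nz by (intro holomorphic_intros hol) auto
  define a' where "a' = (\<lambda>z. a (g z) * g1 z + k z)"
  define b' where "b' = (\<lambda>z. b (g z) * (g1 z)\<^sup>2 + a (g z) * g2 z + deriv k z)"
  have "liouville T (\<lambda>z. u (g z) + ln (cmod (deriv g z))) a' b'"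
    unfolding liouville_def
  proof (intro ballI conjI)
    fix z assume z: "z \<in> T"
    have gz: "g z \<in> S" using g z by blast
    have dh: "(f has_derivative (\<lambda>h. deriv f z * h)) (at z)" if "f holomorphic_on T" for f
      using holomorphic_derivI[OF that T z] by (simp add: has_field_derivative_def)
    have Dg: "(g has_derivative (\<lambda>h. g1 z * h)) (at z)" "(g1 has_derivative (\<lambda>h. g2 z * h)) (at z)"
       "(g2 has_derivative (\<lambda>h. deriv g2 z * h)) (at z)" "(k has_derivative (\<lambda>h. deriv k z * h)) (at z)"
       "(deriv k has_derivative (\<lambda>h. deriv (deriv k) z * h)) (at z)"
      using dh[OF g(1)] dh[OF hol(1)] dh[OF hol(2)] dh[OF hk] dh[OF holomorphic_deriv[OF hk T]]
      by (simp_all add: g1_def g2_def)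
    obtain c where L': "(u has_derivative (\<lambda>h. 2 * Re (a (g z) * h))) (at (g z))"
      "(a has_derivative (\<lambda>h. b (g z) * h + of_real (exp (2 * u (g z))) / 4 * cnj h)) (at (g z))"
      "(b has_derivative (\<lambda>h. c * h + of_real (exp (2 * u (g z))) * a (g z) / 2 * cnj h)) (at (g z))"
      using L gz unfolding liouville_def by blast
    note comp = has_derivative_compose[OF Dg(1)]
    note Dc = comp[OF L'(1)] comp[OF L'(2)] comp[OF L'(3)]
    have ex: "exp (2 * (u (g z) + ln (cmod (deriv g z)))) = of_real (exp (2 * u (g z))) * (g1 z * cnj (g1 z))"
    proof -
      have "exp (2 * (u (g z) + ln (cmod (g1 z)))) = exp (2 * u (g z)) * (cmod (g1 z))\<^sup>2"
        using nz[OF z] by (simp add: distrib_left exp_add exp_double)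
      then show ?thesis by (simp add: g1_def complex_norm_square[symmetric])
    qed
    have kk: "2 * k z = g2 z / g1 z" by (simp add: k_def)
    have "((\<lambda>w. ln (cmod (g1 w))) has_derivative (\<lambda>h. Re (g2 z / g1 z * h))) (at z)"
      using has_derivative_ln_cmod[OF hol(1) T z nz[OF z]] by (simp add: g2_def)
    from has_derivative_add[OF Dc(1) this]
    show "((\<lambda>z. u (g z) + ln (cmod (deriv g z))) has_derivative (\<lambda>h. 2 * Re (a' z * h))) (at z)"
      unfolding kk[symmetric] by (simp add: a'_def g1_def ring_distribs mult.assoc)
    have "(a' has_derivative (\<lambda>h. (a (g z) * (g2 z * h) + (b (g z) * (g1 z * h) + of_real (exp (2 * u (g z))) / 4 * cnj (g1 z * h)) * g1 z)
        + deriv k z * h)) (at z)"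
      unfolding a'_def by (intro has_derivative_add has_derivative_mult Dc Dg)
    then show "(a' has_derivative (\<lambda>h. b' z * h + of_real (exp (2 * (u (g z) + ln (cmod (deriv g z))))) / 4 * cnj h)) (at z)"
      unfolding ex by (simp add: b'_def power2_eq_square algebra_simps)
    have "(b' has_derivative (\<lambda>h. (b (g z) * (g1 z * (g2 z * h) + g2 z * h * g1 z) +
        (c * (g1 z * h) + of_real (exp (2 * u (g z))) * a (g z) / 2 * cnj (g1 z * h)) * (g1 z * g1 z)) +
        (a (g z) * (deriv g2 z * h) + (b (g z) * (g1 z * h) + of_real (exp (2 * u (g z))) / 4 * cnj (g1 z * h)) * g2 z) +
        deriv (deriv k) z * h)) (at z)"
      unfolding b'_def power2_eq_square by (intro has_derivative_add has_derivative_mult Dc Dg)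
    moreover define C where "C = 2 * b (g z) * g1 z * g2 z + c * g1 z * g1 z * g1 z + a (g z) * deriv g2 z + b (g z) * g1 z * g2 z + deriv (deriv k) z"
    have "(b (g z) * (g1 z * (g2 z * h) + g2 z * h * g1 z) +
        (c * (g1 z * h) + of_real (exp (2 * u (g z))) * a (g z) / 2 * cnj (g1 z * h)) * (g1 z * g1 z)) +
        (a (g z) * (deriv g2 z * h) + (b (g z) * (g1 z * h) + of_real (exp (2 * u (g z))) / 4 * cnj (g1 z * h)) * g2 z) +
        deriv (deriv k) z * h = C * h + of_real (exp (2 * u (g z))) * (g1 z * cnj (g1 z)) * a' z / 2 * cnj h" for h
      using nz[OF z] by (simp add: C_def a'_def k_def field_simps)
    ultimately show "\<exists>c. (b' has_derivative (\<lambda>h. c * h + of_real (exp (2 * (u (g z) + ln (cmod (deriv g z))))) * a' z / 2 * cnj h)) (at z)"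
      unfolding ex by (simp only:) blast
  qed
  then show ?thesis by (rule that)
qed

text \<open>Since \<open>a\<close> and \<open>b\<close> are determined by \<open>u\<close>, they can
  be defined on all of \<open>S\<close> by the operator \<open>w\<close>, the Wirtinger derivative
  in z, and then be compared with the local ones.\<close>

lemma liouville_local:
  assumes loc: "\<And>z. z \<in> S \<Longrightarrow> \<exists>N a b. open N \<and> z \<in> N \<and> liouville N u a b"
  obtains a b where "liouville S u a b"
proof -
  define w where "w f z = (frechet_derivative f (at z) 1 - \<i> * frechet_derivative f (at z) \<i>) / 2"
    for f :: "complex \<Rightarrow> complex" and z
  define a where "a = w (\<lambda>z. of_real (u z))"
  define b where "b = w a"
  have "liouville S u a b"
    unfolding liouville_def
  proof
    fix z assume "z \<in> S"
    then obtain N a' b' where N: "open N" "z \<in> N" "liouville N u a' b'" using loc by blast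
    have a: "a v = a' v" if "v \<in> N" for v
    proof -
      have "(u has_derivative (\<lambda>h. 2 * Re (a' v * h))) (at v)" using N that unfolding liouville_def by blast
      then have "((\<lambda>z. complex_of_real (u z)) has_derivative (\<lambda>h. of_real (2 * Re (a' v * h)))) (at v)"
        by (rule has_derivative_of_real)
      then show ?thesis by (simp add: a_def w_def frechet_derivativeI complex_eq_iff)
    qed
    have Da: "(a has_derivative (\<lambda>h. b' v * h + of_real (exp (2 * u v)) / 4 * cnj h)) (at v)" if "v \<in> N" for v
    proof (rule has_derivative_transform_within_open[OF _ N(1) that])
      show "(a' has_derivative (\<lambda>h. b' v * h + of_real (exp (2 * u v)) / 4 * cnj h)) (at v)"
        using N that unfolding liouville_def by blast
    qed (simp add: a)
    have b: "b v = b' v" if "v \<in> N" for v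
      by (simp add: b_def w_def frechet_derivativeI[OF Da[OF that]] field_simps)
    obtain c where c: "(b' has_derivative (\<lambda>h. c * h + of_real (exp (2 * u z)) * a' z / 2 * cnj h)) (at z)"
      using N unfolding liouville_def by blast
    have "(b has_derivative (\<lambda>h. c * h + of_real (exp (2 * u z)) * a z / 2 * cnj h)) (at z)"
      unfolding a[OF N(2)] by (rule has_derivative_transform_within_open[OF c N(1,2)]) (simp add: b)
    moreover have "(u has_derivative (\<lambda>h. 2 * Re (a z * h))) (at z)"
      using N unfolding a[OF N(2)] liouville_def by blast
    ultimately show "(u has_derivative (\<lambda>h. 2 * Re (a z * h))) (at z) \<and>
       (a has_derivative (\<lambda>h. b z * h + of_real (exp (2 * u z)) / 4 * cnj h)) (at z) \<and>
       (\<exists>c. (b has_derivative (\<lambda>h. c * h + of_real (exp (2 * u z)) * a z / 2 * cnj h)) (at z))"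
      using Da[OF N(2)] b[OF N(2)] by auto
  qed
  then show ?thesis by (rule that)
qed

text \<open>For the Poincare density \<open>b\<close> is the square of \<open>a\<close>. Thus the
  function called \<open>T\<close> in the proof of \<open>liouville_developing_map\<close> vanishes,
  in accordance with the identity being the developing map.\<close>

lemma liouville_disc:
  "liouville (ball 0 1) (\<lambda>z. ln (2 / (1 - (cmod z)\<^sup>2))) (\<lambda>z. cnj z / of_real (1 - (cmod z)\<^sup>2))
     (\<lambda>z. (cnj z / of_real (1 - (cmod z)\<^sup>2))\<^sup>2)"
  unfolding liouville_def
proof (intro ballI conjI)
  fix z :: complex assume "z \<in> ball 0 1"
  define d where "d = 1 - (cmod z)\<^sup>2"
  have "(cmod z)\<^sup>2 < 1" using \<open>z \<in> ball 0 1\<close> by (simp add: abs_square_less_1)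
  then have d: "d > 0" by (simp add: d_def)
  have dc: "of_real d = 1 - z * cnj z" unfolding d_def of_real_diff complex_norm_square by simp
  let ?a = "\<lambda>z. cnj z / complex_of_real (1 - (cmod z)\<^sup>2)"
  have n2: "((\<lambda>z. 1 - (cmod z)\<^sup>2) has_derivative (\<lambda>h. - (2 * Re (cnj z * h)))) (at z)"
    unfolding cmod_power2 by (auto intro!: derivative_eq_intros)
  have ex: "exp (2 * ln (2 / d)) = 4 / d\<^sup>2"
    using d by (simp add: exp_double power_divide)
  have "((\<lambda>z. ln (2 / (1 - (cmod z)\<^sup>2))) has_derivative (\<lambda>h. 2 * Re (cnj z * h) / d)) (at z)"
  proof (rule has_derivative_transform_within_open[of "\<lambda>z. ln 2 - ln (1 - (cmod z)\<^sup>2)" _ _ _ "ball 0 1"])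
    have "((\<lambda>z. ln (1 - (cmod z)\<^sup>2)) has_derivative (\<lambda>h. - (2 * Re (cnj z * h)) * inverse d)) (at z)"
      using has_derivative_ln[OF _ n2] d by (simp add: d_def)
    then show "((\<lambda>z. ln 2 - ln (1 - (cmod z)\<^sup>2)) has_derivative (\<lambda>h. 2 * Re (cnj z * h) / d)) (at z)"
      by (rule has_derivative_eq_rhs[OF has_derivative_diff[OF has_derivative_const]]) (simp add: fun_eq_iff divide_inverse algebra_simps)
    show "ln 2 - ln (1 - (cmod w)\<^sup>2) = ln (2 / (1 - (cmod w)\<^sup>2))" if "w \<in> ball 0 1" for w
    proof -
      have "(cmod w)\<^sup>2 < 1" using that by (simp add: abs_square_less_1)
      then show ?thesis by (simp add: ln_div)
    qed
  qed (use \<open>z \<in> ball 0 1\<close> in auto)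
  moreover have "2 * Re (cnj z * h) / d = 2 * Re (cnj z / of_real d * h)" for h by (simp add: Re_divide_of_real)
  ultimately show "((\<lambda>z. ln (2 / (1 - (cmod z)\<^sup>2))) has_derivative (\<lambda>h. 2 * Re (?a z * h))) (at z)"
    by (simp add: d_def)
  have n2c: "((\<lambda>z. complex_of_real (1 - (cmod z)\<^sup>2)) has_derivative (\<lambda>h. - (cnj z * h + z * cnj h))) (at z)"
    by (rule has_derivative_eq_rhs[OF has_derivative_of_real[OF n2]]) (simp add: fun_eq_iff complex_eq_iff)
  have Da: "(?a has_derivative (\<lambda>h. (?a z)\<^sup>2 * h + of_real (4 / d\<^sup>2) / 4 * cnj h)) (at z)"
  proof -
    have "(?a has_derivative (\<lambda>h. (cnj h * of_real d - cnj z * (- (cnj z * h + z * cnj h))) / (of_real d * of_real d))) (at z)"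
      unfolding d_def by (intro has_derivative_divide' n2c has_derivative_cnj has_derivative_ident) (use d in \<open>unfold d_def of_real_eq_0_iff, simp\<close>)
    moreover have "(cnj h * of_real d - cnj z * (- (cnj z * h + z * cnj h))) / (of_real d * of_real d)
        = (cnj z / of_real d)\<^sup>2 * h + of_real (4 / d\<^sup>2) / 4 * cnj h" for h
    proof -
      have "cnj h * of_real d - cnj z * (- (cnj z * h + z * cnj h)) = (cnj z)\<^sup>2 * h + cnj h"
        unfolding dc by (simp add: power2_eq_square algebra_simps)
      then show ?thesis using d by (simp add: power2_eq_square field_simps)
    qed
    ultimately show ?thesis by (simp add: d_def)
  qed
  then show "(?a has_derivative (\<lambda>h. (?a z)\<^sup>2 * h + of_real (exp (2 * ln (2 / (1 - (cmod z)\<^sup>2)))) / 4 * cnj h)) (at z)"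
    using ex by (simp add: d_def)
  have "((\<lambda>z. ?a z * ?a z) has_derivative (\<lambda>h. ?a z * ((?a z)\<^sup>2 * h + of_real (4 / d\<^sup>2) / 4 * cnj h) +
      ((?a z)\<^sup>2 * h + of_real (4 / d\<^sup>2) / 4 * cnj h) * ?a z)) (at z)"
    by (intro has_derivative_mult Da)
  moreover have "A * (A\<^sup>2 * h + E / 4 * cnj h) + (A\<^sup>2 * h + E / 4 * cnj h) * A = 2 * A^3 * h + E * A / 2 * cnj h" for A h E
    by (simp add: power2_eq_square power3_eq_cube algebra_simps)
  ultimately have "((\<lambda>z. ?a z * ?a z) has_derivative (\<lambda>h. 2 * (?a z)^3 * h + of_real (4 / d\<^sup>2) * ?a z / 2 * cnj h)) (at z)"
    by (simp only:)
  moreover have "(\<lambda>z. (?a z)\<^sup>2) = (\<lambda>z. ?a z * ?a z)" by (rule ext) (rule power2_eq_square)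
  ultimately have "((\<lambda>z. (?a z)\<^sup>2) has_derivative (\<lambda>h. 2 * (?a z)^3 * h + of_real (4 / d\<^sup>2) * ?a z / 2 * cnj h)) (at z)"
    by (simp only:)
  then show "\<exists>c. ((\<lambda>z. (?a z)\<^sup>2) has_derivative (\<lambda>h. c * h + of_real (exp (2 * ln (2 / (1 - (cmod z)\<^sup>2)))) * ?a z / 2 * cnj h)) (at z)"
    unfolding ex[unfolded d_def] d_def by blast
qed

section \<open>Power series solutions of y'' = - T y\<close>

section \<open>Linear second-order equations on the disc\<close>

text \<open>The Taylor coefficients at 0 of the solution of y'' = - T y with y 0 = c0 and y' 0 = c1,
  where \<open>t\<close> lists those of \<open>T\<close>.\<close>

fun ode_coeff :: "(nat \<Rightarrow> complex) \<Rightarrow> complex \<Rightarrow> complex \<Rightarrow> nat \<Rightarrow> complex" where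
  "ode_coeff t c0 c1 0 = c0"
| "ode_coeff t c0 c1 (Suc 0) = c1"
| "ode_coeff t c0 c1 (Suc (Suc n)) =
     - (\<Sum>i=0..n. t i * ode_coeff t c0 c1 (n - i)) / (of_nat (n + 2) * of_nat (n + 1))"

text \<open>With d n the weighted coefficient, the recursion gives d (m + 2) \<le> M / (m + 2) times
  the maximum of the earlier ones. Once m exceeds M the maximum no longer grows, so it is attained
  among the first indices.\<close>

lemma ode_coeff_bounded:
  assumes R: "0 < R" "R < 1" and t: "\<And>n. norm (t n) * R ^ n \<le> M"
  shows "\<exists>B. \<forall>n. norm (ode_coeff t c0 c1 n) * R ^ n \<le> B"
proof -
  define d where "d n = norm (ode_coeff t c0 c1 n) * R ^ n" for n
  have d0: "d n \<ge> 0" for n using R by (simp add: d_def)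
  have M: "0 \<le> M" using order_trans[OF norm_ge_zero, of "t 0" M] t[of 0] by simp
  define n0 where "n0 = nat \<lceil>M\<rceil>"
  have n0: "M \<le> real n0" by (simp add: n0_def) linarith
  define B where "B = Max (d ` {..Suc n0})"
  have "d n \<le> B" for n
  proof (induction n rule: less_induct)
    case (less n)
    show ?case
    proof (cases "n \<le> Suc n0")
      case True
      then show ?thesis unfolding B_def by (intro Max_ge) auto
    next
      case False
      then obtain m where m: "n = Suc (Suc m)" "n0 \<le> m" by (metis Suc_le_D not_less_eq_eq Suc_le_mono)
      have B0: "0 \<le> B" using less[of 0] d0[of 0] m by simp
      define s where "s = (\<Sum>i=0..m. t i * ode_coeff t c0 c1 (m - i))"
      have "norm s * R ^ m \<le> (\<Sum>i=0..m. norm (t i * ode_coeff t c0 c1 (m - i))) * R ^ m"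
        unfolding s_def using R by (intro mult_right_mono norm_sum) auto
      also have "\<dots> = (\<Sum>i=0..m. (norm (t i) * R ^ i) * d (m - i))"
        unfolding sum_distrib_right d_def
        by (rule sum.cong) (auto simp: norm_mult mult_ac power_add[symmetric])
      also have "\<dots> \<le> (\<Sum>i=0..m. M * B)"
        by (rule sum_mono, rule mult_mono) (use t less m M d0 R in auto)
      also have "\<dots> = real (m + 1) * (M * B)" by simp
      finally have sm: "norm s * R ^ m \<le> real (m + 1) * (M * B)" .
      have "norm (of_nat (m + 2) * of_nat (m + 1) :: complex) = real (m + 2) * real (m + 1)"
        by (simp only: norm_mult norm_of_nat)
      then have "d n = (norm s * R ^ m) * (R * R) / (real (m + 2) * real (m + 1))"
        unfolding d_def m(1) ode_coeff.simps(3) s_def[symmetric] norm_divide norm_minus_cancel by simp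
      also have "\<dots> \<le> (real (m + 1) * (M * B)) * 1 / (real (m + 2) * real (m + 1))"
        by (intro divide_right_mono mult_mono sm) (use R M B0 mult_le_one[of R R] in auto)
      also have "\<dots> = M / real (m + 2) * B"
      proof -
        have "x * (M * B) * 1 / (y * x) = M / y * B" if "x \<noteq> 0" for x y using that by simp
        then show ?thesis by (metis add_is_0 of_nat_eq_0_iff one_neq_zero)
      qed
      also have "\<dots> \<le> 1 * B" using n0 m B0 by (intro mult_right_mono) (auto simp: field_simps)
      finally show ?thesis by simp
    qed
  qed
  then show ?thesis unfolding d_def by blast
qed

text \<open>The estimate \<open>ode_coeff_bounded\<close> is available for every radius below 1, so
  the formal solution converges on the whole disc, where it may be differentiated termwise.\<close>

lemma ode_solution_disc:
  assumes T: "T holomorphic_on ball 0 1"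
  obtains y where "y holomorphic_on ball 0 1" "y 0 = c0" "deriv y 0 = c1"
    "\<And>z. z \<in> ball 0 1 \<Longrightarrow> deriv (deriv y) z = - T z * y z"
proof -
  define E where "E = fps_expansion T 0"
  define C where "C = Abs_fps (ode_coeff (fps_nth E) c0 c1)"
  have Er: "fps_conv_radius E \<ge> 1"
    using conv_radius_fps_expansion[of T 0 1] T by (simp add: E_def eball_def ball_def one_ereal_def)
  have Cr: "fps_conv_radius C \<ge> 1"
    unfolding fps_conv_radius_def
  proof (rule conv_radius_geI_ex)
    fix r :: real assume r: "0 < r" "ereal r < 1"
    then have r1: "r < 1" by (simp add: one_ereal_def)
    \<comment> \<open>Coefficients bounded with weight \<open>R\<close> are compared at radius
      \<open>r\<close> with a geometric series of ratio r / R.\<close>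
    define R where "R = (r + 1) / 2"
    have R: "0 < R" "R < 1" "r < R" using r r1 by (auto simp: R_def)
    have "ereal R < fps_conv_radius E" using R Er by (metis ereal_less(3) less_le_trans)
    then have "summable (\<lambda>n. norm (fps_nth E n * of_real R ^ n))"
      unfolding fps_conv_radius_def by (intro abs_summable_in_conv_radius) (use R in auto)
    then have "bounded (range (\<lambda>n. norm (fps_nth E n * of_real R ^ n)))"
      by (intro summable_imp_bounded)
    then obtain M where M: "\<And>n. norm (fps_nth E n) * R ^ n \<le> M"
      using R unfolding bounded_iff by (auto simp: norm_mult norm_power)
    obtain B where B: "\<And>n. norm (fps_nth C n) * R ^ n \<le> B"
      using ode_coeff_bounded[OF R(1,2) M, of c0 c1] unfolding C_def by auto
    have "summable (\<lambda>n. fps_nth C n * of_real r ^ n)"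
    proof (rule summable_comparison_test')
      show "summable (\<lambda>n. B * (r / R) ^ n)" using r R by (intro summable_mult summable_geometric) auto
      fix n :: nat
      have "norm (fps_nth C n * of_real r ^ n) = (norm (fps_nth C n) * R ^ n) * (r / R) ^ n"
        using r R by (simp add: norm_mult norm_power power_divide)
      also have "\<dots> \<le> B * (r / R) ^ n" using B r R by (intro mult_right_mono) auto
      finally show "norm (fps_nth C n * of_real r ^ n) \<le> B * (r / R) ^ n" .
    qed
    then show "\<exists>z. norm z = r \<and> summable (\<lambda>n. fps_nth C n * z ^ n)"
      using r by (intro exI[of _ "of_real r"]) auto
  qed
  have eq: "fps_deriv (fps_deriv C) = - (E * C)"
  proof (rule fps_ext)
    fix n
    have "fps_nth (fps_deriv (fps_deriv C)) n = of_nat (n + 1) * (of_nat (n + 2) * ode_coeff (fps_nth E) c0 c1 (Suc (Suc n)))"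
      by (simp add: C_def)
    also have "\<dots> = - (\<Sum>i=0..n. fps_nth E i * ode_coeff (fps_nth E) c0 c1 (n - i))"
      unfolding ode_coeff.simps(3) by (simp add: field_simps del: of_nat_add of_nat_Suc)
    finally show "fps_nth (fps_deriv (fps_deriv C)) n = fps_nth (- (E * C)) n"
      by (simp add: fps_mult_nth C_def)
  qed
  define y where "y = eval_fps C"
  have rad: "ereal (norm z) < fps_conv_radius C" "ereal (norm z) < fps_conv_radius E" "ereal (norm z) < fps_conv_radius (fps_deriv C)"
    if "z \<in> ball 0 1" for z
  proof -
    have z1: "ereal (norm z) < 1" using that by (simp add: one_ereal_def)
    show "ereal (norm z) < fps_conv_radius C" "ereal (norm z) < fps_conv_radius E"
      using z1 Cr Er less_le_trans by blast+
    then show "ereal (norm z) < fps_conv_radius (fps_deriv C)"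
      using fps_conv_radius_deriv[of C] less_le_trans by blast
  qed
  have d1: "(y has_field_derivative eval_fps (fps_deriv C) z) (at z)" if "z \<in> ball 0 1" for z
    unfolding y_def by (rule has_field_derivative_eval_fps) (rule rad[OF that])
  have dy: "deriv y z = eval_fps (fps_deriv C) z" if "z \<in> ball 0 1" for z
    using d1[OF that] by (rule DERIV_imp_deriv)
  have "(eval_fps (fps_deriv C) has_field_derivative eval_fps (fps_deriv (fps_deriv C)) z) (at z)" if "z \<in> ball 0 1" for z
    by (rule has_field_derivative_eval_fps) (rule rad[OF that])
  then have d2: "(deriv y has_field_derivative eval_fps (fps_deriv (fps_deriv C)) z) (at z)" if "z \<in> ball 0 1" for z
    by (rule has_field_derivative_transform_within_open[OF _ open_ball that]) (use that dy in metis)+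
  have ET: "eval_fps E z = T z" if "z \<in> ball 0 1" for z
  proof -
    have "T holomorphic_on eball 0 1" using T by (simp add: eball_def ball_def one_ereal_def)
    moreover have "ereal (norm z) < 1" using that by (simp add: one_ereal_def)
    ultimately have "eval_fps E z = T (0 + z)" unfolding E_def by (rule eval_fps_expansion')
    then show ?thesis by simp
  qed
  show ?thesis
  proof (rule that[of y])
    show "y holomorphic_on ball 0 1"
      unfolding holomorphic_on_open[OF open_ball] using d1 by blast
    show "y 0 = c0" by (simp add: y_def eval_fps_at_0 C_def)
    show "deriv y 0 = c1" using dy[of 0] by (simp add: eval_fps_at_0 C_def)
    fix z :: complex assume z: "z \<in> ball 0 1"
    have "deriv (deriv y) z = eval_fps (- (E * C)) z" using DERIV_imp_deriv[OF d2[OF z]] eq by simp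
    also have "\<dots> = - (eval_fps E z * eval_fps C z)"
    proof -
      have "ereal (norm z) < fps_conv_radius (E * C)"
        using rad(1,2)[OF z] fps_conv_radius_mult[of E C] by (meson less_le_trans min_less_iff_conj)
      then show ?thesis using rad(1,2)[OF z] by (simp add: eval_fps_minus eval_fps_mult)
    qed
    finally show "deriv (deriv y) z = - T z * y z" using ET[OF z] by (simp add: y_def)
  qed
qed

section \<open>From a solution of Liouville's equation to a holomorphic self-map of the disc\<close>

section \<open>The developing map\<close>

text \<open>Liouville's equation makes \<open>T = b - a\<^sup>2\<close> holomorphic. It is half the
  Schwarzian derivative of the map sought, which is therefore a quotient of solutions of y'' = - T
  y. These exist on the whole disc; that the denominator has no zero and that |F| < 1 both come from
  exp (- u) being positive.\<close>

lemma liouville_developing_map: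
  assumes L: "liouville (ball 0 1) u a b"
  obtains F where "F holomorphic_on ball 0 1" "F ` ball 0 1 \<subseteq> ball 0 1" "F 0 = 0"
    "\<And>z. z \<in> ball 0 1 \<Longrightarrow> deriv F z \<noteq> 0"
    "\<And>z. z \<in> ball 0 1 \<Longrightarrow> exp (u z) * (1 - (cmod (F z))\<^sup>2) = 2 * cmod (deriv F z)"
proof -
  let ?D = "ball (0::complex) 1"
  define T where "T z = b z - (a z)\<^sup>2" for z
  define e where "e z = complex_of_real (exp (u z))" for z
  define v where "v z = complex_of_real (exp (- u z))" for z
  have ev: "e z * v z = 1" for z by (simp add: e_def v_def of_real_mult[symmetric] exp_minus)
  have e2: "complex_of_real (exp (2 * u z)) = e z * e z" for z by (simp add: e_def exp_double power2_eq_square)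
  have du: "(u has_derivative (\<lambda>h. 2 * Re (a z * h))) (at z)" if "z \<in> ?D" for z
    using L that unfolding liouville_def by blast
  have da: "(a has_derivative (\<lambda>h. b z * h + e z * e z / 4 * cnj h)) (at z)" if "z \<in> ?D" for z
    using L that unfolding liouville_def e2 by blast
  have sr: "complex_of_real (2 * Re (a z * h)) = a z * h + cnj (a z) * cnj h" for z h
    by (simp add: complex_eq_iff)
  have duc: "((\<lambda>z. complex_of_real (u z)) has_derivative (\<lambda>h. a z * h + cnj (a z) * cnj h)) (at z)" if "z \<in> ?D" for z
    by (rule has_derivative_eq_rhs[OF has_derivative_of_real[OF du[OF that]]]) (simp only: sr)
  have de: "(e has_derivative (\<lambda>h. e z * (a z * h + cnj (a z) * cnj h))) (at z)" if "z \<in> ?D" for z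
  proof -
    have "((\<lambda>z. exp (u z)) has_derivative (\<lambda>h. exp (u z) * (2 * Re (a z * h)))) (at z)"
      using du[OF that] by (auto intro!: derivative_eq_intros)
    from has_derivative_of_real[OF this] show ?thesis
      unfolding e_def by (rule has_derivative_eq_rhs) (rule ext, simp only: sr[symmetric] of_real_mult)
  qed
  have dv: "(v has_derivative (\<lambda>h. - (v z * (a z * h + cnj (a z) * cnj h)))) (at z)" if "z \<in> ?D" for z
  proof -
    have "((\<lambda>z. exp (- u z)) has_derivative (\<lambda>h. - (exp (- u z) * (2 * Re (a z * h))))) (at z)"
      using du[OF that] by (auto intro!: derivative_eq_intros simp: algebra_simps)
    from has_derivative_of_real[OF this] show ?thesis
      unfolding v_def by (rule has_derivative_eq_rhs) (rule ext, simp only: sr[symmetric] of_real_mult of_real_minus)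
  qed
  have "T field_differentiable (at z)" if z: "z \<in> ?D" for z
  proof -
    obtain c where c: "(b has_derivative (\<lambda>h. c * h + e z * e z * a z / 2 * cnj h)) (at z)"
      using L z unfolding liouville_def e2 by blast
    have "(T has_derivative (\<lambda>h. (c * h + e z * e z * a z / 2 * cnj h) - (a z * (b z * h + e z * e z / 4 * cnj h) + (b z * h + e z * e z / 4 * cnj h) * a z))) (at z)"
      unfolding T_def power2_eq_square by (intro has_derivative_diff has_derivative_mult c da z)
    moreover have "(c * h + e z * e z * a z / 2 * cnj h) - (a z * (b z * h + e z * e z / 4 * cnj h) + (b z * h + e z * e z / 4 * cnj h) * a z)
       = (c - 2 * a z * b z) * h" for h by (simp add: field_simps)
    ultimately have "(T has_derivative (*) (c - 2 * a z * b z)) (at z)" by (simp only:)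
    then show ?thesis unfolding field_differentiable_def has_field_derivative_def by blast
  qed
  then have Th: "T holomorphic_on ?D" by (simp add: holomorphic_on_def field_differentiable_at_within)
  have b_eq: "b z = T z + (a z)\<^sup>2" for z by (simp add: T_def)
  \<comment> \<open>The function \<open>v = exp (-u)\<close> solves \<open>\<partial>\<^sup>2v/\<partial>z\<^sup>2 = - T v\<close>, hence is a hermitian form in the solutions of
    \<open>y'' = - T y\<close>; its coefficients are the double Wronskians \<open>K\<close>.\<close>
  define v1 where "v1 z = - a z * v z" for z
  define v2 where "v2 z = - cnj (a z) * v z" for z
  define m where "m z = a z * cnj (a z) * v z - e z / 4" for z
  have eev: "e z * e z * v z = e z" for z using ev[of z] by (metis mult.assoc mult.right_neutral)
  have dv1: "(v1 has_derivative (\<lambda>h. - T z * v z * h + m z * cnj h)) (at z)" if z: "z \<in> ?D" for z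
  proof -
    have "(v1 has_derivative (\<lambda>h. (- a z) * (- (v z * (a z * h + cnj (a z) * cnj h))) + (- (b z * h + e z * e z / 4 * cnj h)) * v z)) (at z)"
      unfolding v1_def by (intro has_derivative_mult has_derivative_minus dv da z)
    moreover have "(- a z) * (- (v z * (a z * h + cnj (a z) * cnj h))) + (- (b z * h + e z * e z / 4 * cnj h)) * v z
        = - T z * v z * h + (a z * cnj (a z) * v z - e z * e z * v z / 4) * cnj h" for h
      by (simp add: b_eq power2_eq_square field_simps)
    ultimately show ?thesis unfolding m_def eev by (simp only:)
  qed
  have cnjs: "cnj (v z) = v z" "cnj (e z) = e z" for z by (simp_all add: v_def e_def)
  have dv2: "(v2 has_derivative (\<lambda>h. m z * h - cnj (T z) * v z * cnj h)) (at z)" if z: "z \<in> ?D" for z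
  proof -
    have "((\<lambda>z. cnj (v1 z)) has_derivative (\<lambda>h. cnj (- T z * v z * h + m z * cnj h))) (at z)"
      by (rule has_derivative_cnj[OF dv1[OF z]])
    moreover have "(\<lambda>z. cnj (v1 z)) = v2" by (simp add: fun_eq_iff v1_def v2_def cnjs)
    moreover have "cnj (- T z * v z * h + m z * cnj h) = m z * h - cnj (T z) * v z * cnj h" for h
      by (simp add: m_def cnjs mult_ac)
    ultimately show ?thesis by (simp only:)
  qed
  have dm: "(m has_derivative (\<lambda>h. - T z * v2 z * h - cnj (T z) * v1 z * cnj h)) (at z)" if z: "z \<in> ?D" for z
  proof -
    let ?da = "\<lambda>h. b z * h + e z * e z / 4 * cnj h"
    have "(m has_derivative (\<lambda>h. (a z * cnj (a z)) * (- (v z * (a z * h + cnj (a z) * cnj h)))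
        + (a z * cnj (?da h) + ?da h * cnj (a z)) * v z - e z * (a z * h + cnj (a z) * cnj h) / 4)) (at z)"
      unfolding m_def by (intro has_derivative_diff has_derivative_mult has_derivative_cnj bounded_linear.has_derivative[OF bounded_linear_divide] dv da de z)
    moreover have "(a z * cnj (a z)) * (- (v z * (a z * h + cnj (a z) * cnj h)))
        + (a z * cnj (?da h) + ?da h * cnj (a z)) * v z - e z * (a z * h + cnj (a z) * cnj h) / 4
        = - T z * v2 z * h - cnj (T z) * v1 z * cnj h + (e z * e z * v z - e z) / 4 * (a z * h + cnj (a z) * cnj h)" for h
      by (simp add: b_eq v1_def v2_def cnjs power2_eq_square field_simps)
    ultimately show ?thesis unfolding eev by (simp only: diff_self div_0 mult_zero_left add_0_right)
  qed
  \<comment> \<open>At 0 the solution \<open>p\<close> has the value and the z-derivative of v / v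
    0, while \<open>q\<close> vanishes. This makes \<open>K p q\<close> and \<open>K q p\<close>
    zero, so the hermitian form is diagonal.\<close>
  obtain p where p: "p holomorphic_on ?D" "p 0 = 1" "deriv p 0 = - a 0"
      "\<And>z. z \<in> ?D \<Longrightarrow> deriv (deriv p) z = - T z * p z"
    using ode_solution_disc[OF Th] by metis
  obtain q where q: "q holomorphic_on ?D" "q 0 = 0" "deriv q 0 = 1"
      "\<And>z. z \<in> ?D \<Longrightarrow> deriv (deriv q) z = - T z * q z"
    using ode_solution_disc[OF Th] by metis
  have d1: "(y has_derivative (\<lambda>h. deriv y z * h)) (at z)" if "y holomorphic_on ?D" "z \<in> ?D" for y z
    using holomorphic_derivI[OF that(1) open_ball that(2)] by (simp add: has_field_derivative_def)
  have d2: "(deriv y has_derivative (\<lambda>h. - T z * y z * h)) (at z)"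
    if "y holomorphic_on ?D" "z \<in> ?D" "deriv (deriv y) z = - T z * y z" for y z
    using d1[OF holomorphic_deriv[OF that(1)] that(2)] that(3) by simp
  define W where "W z = p z * deriv q z - deriv p z * q z" for z
  have "(W has_derivative (\<lambda>h. 0)) (at z)" if z: "z \<in> ?D" for z
  proof -
    have "(W has_derivative (\<lambda>h. (p z * (- T z * q z * h) + deriv p z * h * deriv q z) - (deriv p z * (deriv q z * h) + (- T z * p z * h) * q z))) (at z)"
      unfolding W_def by (intro has_derivative_diff has_derivative_mult d1 d2 p q z)
    moreover have "(p z * (- T z * q z * h) + deriv p z * h * deriv q z) - (deriv p z * (deriv q z * h) + (- T z * p z * h) * q z) = 0" for h
      by (simp add: algebra_simps)
    ultimately show ?thesis by (simp only:)
  qed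
  then have "W z = W 0" if "z \<in> ?D" for z
    using has_derivative_zero_unique_connected[of ?D W z 0] that by auto
  then have W: "p z * deriv q z - deriv p z * q z = 1" if "z \<in> ?D" for z
    using that p(2) q(2,3) by (simp add: W_def)
  define K where "K f g z = v z * deriv f z * cnj (deriv g z) - v1 z * f z * cnj (deriv g z)
      - v2 z * deriv f z * cnj (g z) + m z * f z * cnj (g z)" for f g z
  have K: "K f g z = K f g 0" if hf: "f holomorphic_on ?D" "\<And>z. z \<in> ?D \<Longrightarrow> deriv (deriv f) z = - T z * f z"
      and hg: "g holomorphic_on ?D" "\<And>z. z \<in> ?D \<Longrightarrow> deriv (deriv g) z = - T z * g z" and z: "z \<in> ?D" for f g z
  proof -
    have "(K f g has_derivative (\<lambda>h. 0)) (at z)" if z: "z \<in> ?D" for z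
    proof -
      have dv': "(v has_derivative (\<lambda>h. v1 z * h + v2 z * cnj h)) (at z)"
        by (rule has_derivative_eq_rhs[OF dv[OF z]]) (simp add: fun_eq_iff v1_def v2_def algebra_simps)
      let ?f = "f z" and ?f1 = "deriv f z" and ?g = "cnj (g z)" and ?g1 = "cnj (deriv g z)"
      have "(K f g has_derivative (\<lambda>h.
          ((v z * ?f1) * cnj (- T z * g z * h) + (v z * (- T z * ?f * h) + (v1 z * h + v2 z * cnj h) * ?f1) * ?g1)
        - ((v1 z * ?f) * cnj (- T z * g z * h) + (v1 z * (?f1 * h) + (- T z * v z * h + m z * cnj h) * ?f) * ?g1)
        - ((v2 z * ?f1) * cnj (deriv g z * h) + (v2 z * (- T z * ?f * h) + (m z * h - cnj (T z) * v z * cnj h) * ?f1) * ?g)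
        + ((m z * ?f) * cnj (deriv g z * h) + (m z * (?f1 * h) + (- T z * v2 z * h - cnj (T z) * v1 z * cnj h) * ?f) * ?g))) (at z)"
        unfolding K_def
        by (intro has_derivative_diff has_derivative_add has_derivative_mult has_derivative_cnj
            dv' dv1 dv2 dm d1 d2 hf hg z)
      moreover have "((v z * ?f1) * cnj (- T z * g z * h) + (v z * (- T z * ?f * h) + (v1 z * h + v2 z * cnj h) * ?f1) * ?g1)
        - ((v1 z * ?f) * cnj (- T z * g z * h) + (v1 z * (?f1 * h) + (- T z * v z * h + m z * cnj h) * ?f) * ?g1)
        - ((v2 z * ?f1) * cnj (deriv g z * h) + (v2 z * (- T z * ?f * h) + (m z * h - cnj (T z) * v z * cnj h) * ?f1) * ?g)
        + ((m z * ?f) * cnj (deriv g z * h) + (m z * (?f1 * h) + (- T z * v2 z * h - cnj (T z) * v1 z * cnj h) * ?f) * ?g) = 0" for h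
        by (simp add: algebra_simps)
      ultimately show ?thesis by (simp only:)
    qed
    then show ?thesis using has_derivative_zero_unique_connected[of ?D "K f g" z 0] z by auto
  qed
  define v0 where "v0 = v 0"
  have vnz: "v z \<noteq> 0" for z by (simp add: v_def)
  have Kqq: "K q q z = v0" if "z \<in> ?D" for z
    using K[OF q(1,4) q(1,4) that] q(2,3) by (simp add: K_def v0_def)
  have Kpq: "K p q z = 0" if "z \<in> ?D" for z
    using K[OF p(1,4) q(1,4) that] p(2,3) q(2,3) by (simp add: K_def v1_def)
  have Kqp: "K q p z = 0" if "z \<in> ?D" for z
    using K[OF q(1,4) p(1,4) that] p(2,3) q(2,3) by (simp add: K_def v2_def)
  have Kpp: "K p p z = - e 0 / 4" if "z \<in> ?D" for z
    using K[OF p(1,4) p(1,4) that] p(2,3) by (simp add: K_def v1_def v2_def m_def algebra_simps)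
  have form: "v z = v0 * (p z * cnj (p z)) - e 0 / 4 * (q z * cnj (q z))" if z: "z \<in> ?D" for z
  proof -
    \<comment> \<open>Eliminating the derivatives of \<open>v\<close> from the four double
      Wronskians leaves \<open>v\<close> times the squared modulus of the Wronskian of
      \<open>p\<close> and \<open>q\<close>, which is 1.\<close>
    have "K q q z * (p z * cnj (p z)) - K p q z * (q z * cnj (p z)) - K q p z * (p z * cnj (q z)) + K p p z * (q z * cnj (q z))
       = v z * (p z * deriv q z - deriv p z * q z) * cnj (p z * deriv q z - deriv p z * q z)"
      by (simp add: K_def algebra_simps)
    then show ?thesis unfolding W[OF z] Kqq[OF z] Kpp[OF z] Kpq[OF z] Kqp[OF z] by simp
  qed
  define r where "r = exp (- u 0)"
  have r: "r > 0" by (simp add: r_def)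
  have v0r: "v0 = of_real r" by (simp add: v0_def v_def r_def)
  have e0r: "e 0 = of_real (inverse r)" by (simp add: e_def r_def exp_minus)
  have formr: "exp (- u z) = r * (cmod (p z))\<^sup>2 - (cmod (q z))\<^sup>2 / (4 * r)" if z: "z \<in> ?D" for z
  proof -
    have "complex_of_real (exp (- u z)) = of_real (r * (cmod (p z))\<^sup>2 - (cmod (q z))\<^sup>2 / (4 * r))"
      using form[OF z] r unfolding v_def v0r e0r complex_norm_square[symmetric] by (simp add: field_simps)
    then show ?thesis by (simp only: of_real_eq_iff)
  qed
  have pnz: "p z \<noteq> 0" if z: "z \<in> ?D" for z
  proof
    assume "p z = 0"
    then have "exp (- u z) \<le> 0" using formr[OF z] r by simp
    then show False by (simp add: not_le[symmetric])
  qed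
  \<comment> \<open>The factor 2 r turns the diagonal form r |p|^2 - |q|^2 / (4 r) into r |p|^2 (1 -
    |F|^2).\<close>
  define F where "F z = q z / (2 * of_real r * p z)" for z
  have nF: "(cmod (F z))\<^sup>2 = (cmod (q z))\<^sup>2 / (4 * r\<^sup>2 * (cmod (p z))\<^sup>2)" for z
    using r by (simp add: F_def norm_divide norm_mult power_divide power_mult_distrib)
  have key: "exp (- u z) = r * (cmod (p z))\<^sup>2 * (1 - (cmod (F z))\<^sup>2)" if z: "z \<in> ?D" for z
    unfolding nF formr[OF z] using pnz[OF z] r by (simp add: field_simps power2_eq_square)
  have DF: "(F has_field_derivative 1 / (2 * of_real r * (p z)\<^sup>2)) (at z)" if z: "z \<in> ?D" for z
  proof -
    have "((\<lambda>z. q z / (2 * of_real r * p z)) has_field_derivative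
       (deriv q z * (2 * of_real r * p z) - q z * (2 * of_real r * deriv p z)) / ((2 * of_real r * p z) * (2 * of_real r * p z))) (at z)"
      by (intro DERIV_divide DERIV_cmult holomorphic_derivI[OF p(1) open_ball z] holomorphic_derivI[OF q(1) open_ball z])
         (use pnz[OF z] r in auto)
    moreover have "(deriv q z * (2 * of_real r * p z) - q z * (2 * of_real r * deriv p z)) = 2 * of_real r * (p z * deriv q z - deriv p z * q z)"
      by (simp add: algebra_simps)
    ultimately show ?thesis unfolding F_def W[OF z] using pnz[OF z] r by (simp add: field_simps power2_eq_square)
  qed
  have dF: "deriv F z = 1 / (2 * of_real r * (p z)\<^sup>2)" if "z \<in> ?D" for z
    using DF[OF that] by (rule DERIV_imp_deriv)
  show ?thesis
  proof (rule that[of F])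
    show "F holomorphic_on ?D" unfolding holomorphic_on_open[OF open_ball] using DF by blast
    show "F 0 = 0" by (simp add: F_def q(2))
    show "F ` ?D \<subseteq> ?D"
    proof
      fix w assume "w \<in> F ` ?D"
      then obtain z where z: "z \<in> ?D" "w = F z" by blast
      have "0 < r * (cmod (p z))\<^sup>2 * (1 - (cmod (F z))\<^sup>2)" unfolding key[OF z(1), symmetric] by simp
      then have "0 < 1 - (cmod (F z))\<^sup>2" by (rule zero_less_mult_pos) (use r pnz[OF z(1)] in simp)
      then show "w \<in> ?D" using z(2) by (simp add: abs_square_less_1)
    qed
    fix z assume z: "z \<in> ?D"
    show "deriv F z \<noteq> 0" using dF[OF z] pnz[OF z] r by simp
    have "exp (u z) * (r * (cmod (p z))\<^sup>2 * (1 - (cmod (F z))\<^sup>2)) = 1"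
      unfolding key[OF z, symmetric] by (simp add: exp_minus)
    then show "exp (u z) * (1 - (cmod (F z))\<^sup>2) = 2 * cmod (deriv F z)"
      using pnz[OF z] r unfolding dF[OF z] by (simp add: norm_divide norm_mult norm_power field_simps)
  qed
qed

section \<open>Charts, pulled back densities and local inverses\<close>

section \<open>Holomorphic maps from plane domains into surfaces\<close>

text \<open>Openness of \<open>S\<close> is part of the notion: the preimages of chart domains are
  then open, and \<open>deriv\<close> of a coordinate expression is its actual derivative
  there.\<close>

definition holo_into :: "'a::t2_space set \<Rightarrow> 'a chart set \<Rightarrow> complex set \<Rightarrow> (complex \<Rightarrow> 'a) \<Rightarrow> bool" where
  "holo_into U A S g \<longleftrightarrow> open S \<and> continuous_on S g \<and> g ` S \<subseteq> U \<and>
     (\<forall>(V, \<phi>)\<in>A. (\<phi> \<circ> g) holomorphic_on (S \<inter> g -` V))"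

definition locally_inj :: "complex set \<Rightarrow> (complex \<Rightarrow> 'a) \<Rightarrow> bool" where
  "locally_inj S g \<longleftrightarrow> (\<forall>z\<in>S. \<exists>N. open N \<and> z \<in> N \<and> N \<subseteq> S \<and> inj_on g N)"

text \<open>The density of the pulled back metric in the plane coordinate. The chart is chosen as in
  \<open>metric_speed\<close>; for a conformal metric \<open>pull_eq\<close> makes the choice
  immaterial.\<close>

definition pull :: "'a chart set \<Rightarrow> 'a density \<Rightarrow> (complex \<Rightarrow> 'a) \<Rightarrow> complex \<Rightarrow> real" where
  "pull A \<rho> g z = (let (V, \<phi>) = (SOME c. c \<in> A \<and> g z \<in> fst c)
     in \<rho> (V, \<phi>) (\<phi> (g z)) * cmod (deriv (\<phi> \<circ> g) z))"

lemma holo_into_compose: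
  assumes g: "holo_into U A S g" and h: "h holomorphic_on T" "h ` T \<subseteq> S" and T: "open T"
  shows "holo_into U A T (g \<circ> h)"
  unfolding holo_into_def
proof (intro conjI)
  have ch: "continuous_on T h" using h(1) by (rule holomorphic_on_imp_continuous_on)
  show "continuous_on T (g \<circ> h)"
    by (rule continuous_on_compose[OF ch]) (use g h(2) in \<open>auto simp: holo_into_def intro: continuous_on_subset\<close>)
  show "(g \<circ> h) ` T \<subseteq> U" using g h(2) unfolding holo_into_def by fastforce
  show "\<forall>(V, \<phi>)\<in>A. (\<phi> \<circ> (g \<circ> h)) holomorphic_on (T \<inter> (g \<circ> h) -` V)"
  proof safe
    fix V \<phi> assume "(V, \<phi>) \<in> A"
    then have "(\<phi> \<circ> g) holomorphic_on (S \<inter> g -` V)" using g unfolding holo_into_def by blast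
    then have "((\<phi> \<circ> g) \<circ> h) holomorphic_on (T \<inter> (g \<circ> h) -` V)"
      by (intro holomorphic_on_compose_gen[OF holomorphic_on_subset[OF h(1)]]) (use h(2) in auto)
    then show "(\<phi> \<circ> (g \<circ> h)) holomorphic_on (T \<inter> (g \<circ> h) -` V)" by (simp add: o_assoc)
  qed
qed fact

lemma holo_into_subset: "holo_into U A S g \<Longrightarrow> open T \<Longrightarrow> T \<subseteq> S \<Longrightarrow> holo_into U A T g"
  using holo_into_compose[of U A S g "\<lambda>z. z" T] by (simp add: o_def)

lemma conformal_metric_change:
  assumes "conformal_metric A \<rho>" "(V, \<phi>) \<in> A" "(V', \<psi>) \<in> A" "p \<in> V" "p \<in> V'"
  shows "\<rho> (V, \<phi>) (\<phi> p) = \<rho> (V', \<psi>) (\<psi> p) * cmod (deriv (\<psi> \<circ> inv_into V \<phi>) (\<phi> p))"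
proof -
  have "\<forall>(V, \<phi>)\<in>A. \<forall>(V', \<psi>)\<in>A. \<forall>p\<in>V \<inter> V'.
      \<rho> (V, \<phi>) (\<phi> p) = \<rho> (V', \<psi>) (\<psi> p) * cmod (deriv (\<psi> \<circ> inv_into V \<phi>) (\<phi> p))"
    using assms(1) unfolding conformal_metric_def by (elim conjE)
  from bspec[OF this assms(2)] have "\<forall>(V', \<psi>)\<in>A. \<forall>p\<in>V \<inter> V'.
      \<rho> (V, \<phi>) (\<phi> p) = \<rho> (V', \<psi>) (\<psi> p) * cmod (deriv (\<psi> \<circ> inv_into V \<phi>) (\<phi> p))" by simp
  from bspec[OF this assms(3)] show ?thesis using assms(4,5) by simp
qed

lemma conformal_metricD:
  assumes "conformal_metric A \<rho>" "(V, \<phi>) \<in> A"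
  shows "z \<in> \<phi> ` V \<Longrightarrow> 0 < \<rho> (V, \<phi>) z" "Ck_on k (\<phi> ` V) (\<rho> (V, \<phi>))"
proof -
  have "\<forall>(V, \<phi>)\<in>A. (\<forall>z\<in>\<phi> ` V. \<rho> (V, \<phi>) z > 0) \<and> (\<forall>k. Ck_on k (\<phi> ` V) (\<rho> (V, \<phi>)))"
    using assms(1) unfolding conformal_metric_def by (elim conjE)
  from bspec[OF this assms(2)] show "z \<in> \<phi> ` V \<Longrightarrow> 0 < \<rho> (V, \<phi>) z" "Ck_on k (\<phi> ` V) (\<rho> (V, \<phi>))"
    by auto
qed

locale surface =
  fixes U :: "'a::t2_space set" and A :: "'a chart set"
  assumes rs: "riemann_surface U A"
begin

lemma chart_openin: "(V, \<phi>) \<in> A \<Longrightarrow> openin (top_of_set U) V"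
  and chart_open_image: "(V, \<phi>) \<in> A \<Longrightarrow> open (\<phi> ` V)"
  and chart_homeo: "(V, \<phi>) \<in> A \<Longrightarrow> homeomorphism V (\<phi> ` V) \<phi> (inv_into V \<phi>)"
proof -
  have *: "\<forall>(V, \<phi>)\<in>A. openin (top_of_set U) V \<and> open (\<phi> ` V) \<and> homeomorphism V (\<phi> ` V) \<phi> (inv_into V \<phi>)"
    using rs unfolding riemann_surface_def by (elim conjE)
  assume "(V, \<phi>) \<in> A"
  from bspec[OF * this] show "openin (top_of_set U) V" "open (\<phi> ` V)"
    "homeomorphism V (\<phi> ` V) \<phi> (inv_into V \<phi>)" by simp_all
qed

lemma chart_transition: "(V, \<phi>) \<in> A \<Longrightarrow> (V', \<psi>) \<in> A \<Longrightarrow> (\<psi> \<circ> inv_into V \<phi>) holomorphic_on \<phi> ` (V \<inter> V')"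
proof -
  have *: "\<forall>(V, \<phi>)\<in>A. \<forall>(V', \<psi>)\<in>A. (\<psi> \<circ> inv_into V \<phi>) holomorphic_on \<phi> ` (V \<inter> V')"
    using rs unfolding riemann_surface_def by (elim conjE)
  assume V: "(V, \<phi>) \<in> A" "(V', \<psi>) \<in> A"
  from bspec[OF * V(1)] have "\<forall>(V', \<psi>)\<in>A. (\<psi> \<circ> inv_into V \<phi>) holomorphic_on \<phi> ` (V \<inter> V')" by simp
  from bspec[OF this V(2)] show "(\<psi> \<circ> inv_into V \<phi>) holomorphic_on \<phi> ` (V \<inter> V')" by simp
qed

lemma chart_subset: "(V, \<phi>) \<in> A \<Longrightarrow> V \<subseteq> U"
  using chart_openin openin_subset by fastforce

lemma chart_inv: "(V, \<phi>) \<in> A \<Longrightarrow> x \<in> V \<Longrightarrow> inv_into V \<phi> (\<phi> x) = x"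
  using chart_homeo unfolding homeomorphism_def by blast

lemma chart_inj: "(V, \<phi>) \<in> A \<Longrightarrow> inj_on \<phi> V"
  using chart_inv by (metis inj_on_inverseI)

lemma ex_chart:
  assumes "x \<in> U" obtains V \<phi> where "(V, \<phi>) \<in> A" "x \<in> V"
proof -
  have "x \<in> (\<Union>(V, \<phi>)\<in>A. V)" using assms rs unfolding riemann_surface_def by (elim conjE) simp
  then show ?thesis using that by auto
qed

lemma some_chart:
  assumes "x \<in> U" obtains V \<phi> where "(V, \<phi>) \<in> A" "x \<in> V" "(SOME c. c \<in> A \<and> x \<in> fst c) = (V, \<phi>)"
proof -
  obtain V \<phi> where "(V, \<phi>) \<in> A" "x \<in> V" using ex_chart[OF assms] by blast
  then have "\<exists>c. c \<in> A \<and> x \<in> fst c" by (intro exI[of _ "(V, \<phi>)"]) simp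
  from someI_ex[OF this]
  have ch: "(SOME c. c \<in> A \<and> x \<in> fst c) \<in> A \<and> x \<in> fst (SOME c. c \<in> A \<and> x \<in> fst c)" .
  obtain V' \<psi> where eq: "(SOME c. c \<in> A \<and> x \<in> fst c) = (V', \<psi>)" by fastforce
  show ?thesis by (rule that[OF _ _ eq]) (use ch[unfolded eq] in auto)
qed

lemma open_preimage:
  assumes "open S" "continuous_on S g" "g ` S \<subseteq> U" "openin (top_of_set U) V"
  shows "open (S \<inter> g -` V)"
proof -
  have "openin (top_of_set S) (S \<inter> g -` V)"
    using continuous_openin_preimage[OF assms(2) _ assms(4)] assms(3) by (simp add: image_subset_iff_funcset)
  then show ?thesis using assms(1) openin_open_eq by blast
qed

lemma holo_open_preimage:
  assumes "holo_into U A S g" "openin (top_of_set U) V"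
  shows "open (S \<inter> g -` V)"
  using assms open_preimage unfolding holo_into_def by blast

lemma holo_chart:
  assumes "holo_into U A S g" "(V, \<phi>) \<in> A"
  shows "(\<phi> \<circ> g) holomorphic_on (S \<inter> g -` V)" "open (S \<inter> g -` V)"
  using assms holo_open_preimage[OF assms(1) chart_openin[OF assms(2)]] unfolding holo_into_def by blast+

lemma chart_open_subimage:
  assumes V: "(V, \<phi>) \<in> A" and W: "openin (top_of_set U) W"
  shows "open (\<phi> ` (V \<inter> W))"
proof -
  obtain Q where Q: "open Q" "W = U \<inter> Q" using W unfolding openin_open by blast
  have "V \<inter> W = V \<inter> Q" using chart_subset[OF V] Q by blast
  then have "openin (top_of_set V) (V \<inter> W)" using Q openin_open by blast
  then have "openin (top_of_set (\<phi> ` V)) (\<phi> ` (V \<inter> W))"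
    by (rule homeomorphism_imp_open_map[OF chart_homeo[OF V]])
  then show ?thesis using chart_open_image[OF V] openin_open_eq by blast
qed

lemma chart_change:
  assumes g: "holo_into U A S g" and V: "(V, \<phi>) \<in> A" "(V', \<psi>) \<in> A" and z: "z \<in> S" "g z \<in> V" "g z \<in> V'"
  shows "deriv (\<psi> \<circ> g) z = deriv (\<psi> \<circ> inv_into V \<phi>) (\<phi> (g z)) * deriv (\<phi> \<circ> g) z"
proof -
  let ?M = "(S \<inter> g -` V) \<inter> (S \<inter> g -` V')"
  have op: "open ?M" using holo_chart(2)[OF g V(1)] holo_chart(2)[OF g V(2)] by (rule open_Int)
  have d1: "((\<phi> \<circ> g) has_field_derivative deriv (\<phi> \<circ> g) z) (at z)"
    by (rule holomorphic_derivI[OF holo_chart[OF g V(1)]]) (use z in simp)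
  have d2: "((\<psi> \<circ> inv_into V \<phi>) has_field_derivative deriv (\<psi> \<circ> inv_into V \<phi>) ((\<phi> \<circ> g) z)) (at ((\<phi> \<circ> g) z))"
    by (rule holomorphic_derivI[OF chart_transition[OF V] chart_open_subimage[OF V(1) chart_openin[OF V(2)]]])
       (use z in simp)
  have "((\<psi> \<circ> g) has_field_derivative deriv (\<psi> \<circ> inv_into V \<phi>) ((\<phi> \<circ> g) z) * deriv (\<phi> \<circ> g) z) (at z)"
  proof (rule has_field_derivative_transform_within_open[OF DERIV_chain[OF d2 d1] op])
    show "((\<psi> \<circ> inv_into V \<phi>) \<circ> (\<phi> \<circ> g)) w = (\<psi> \<circ> g) w" if "w \<in> ?M" for w
      using that chart_inv[OF V(1)] by simp
  qed (use z in simp)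
  then show ?thesis by (simp add: DERIV_imp_deriv)
qed

lemma pull_eq:
  assumes \<rho>: "conformal_metric A \<rho>" and g: "holo_into U A S g" and V: "(V, \<phi>) \<in> A" and z: "z \<in> S" "g z \<in> V"
  shows "pull A \<rho> g z = \<rho> (V, \<phi>) (\<phi> (g z)) * cmod (deriv (\<phi> \<circ> g) z)"
proof -
  have "g z \<in> U" using g z unfolding holo_into_def by blast
  then obtain V' \<psi> where V': "(V', \<psi>) \<in> A" "g z \<in> V'" "(SOME c. c \<in> A \<and> g z \<in> fst c) = (V', \<psi>)"
    by (rule some_chart)
  have "\<rho> (V', \<psi>) (\<psi> (g z)) = \<rho> (V, \<phi>) (\<phi> (g z)) * cmod (deriv (\<phi> \<circ> inv_into V' \<psi>) (\<psi> (g z)))"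
    by (rule conformal_metric_change[OF \<rho> V'(1) V V'(2) z(2)])
  then show ?thesis
    unfolding pull_def V'(3) chart_change[OF g V'(1) V z(1) V'(2) z(2)] by (simp add: norm_mult)
qed

lemma pull_compose:
  assumes \<rho>: "conformal_metric A \<rho>" and g: "holo_into U A S g" and h: "h holomorphic_on T" "h ` T \<subseteq> S"
    and T: "open T" "z \<in> T"
  shows "pull A \<rho> (g \<circ> h) z = pull A \<rho> g (h z) * cmod (deriv h z)"
proof -
  have hz: "h z \<in> S" using h T by blast
  then have "g (h z) \<in> U" using g unfolding holo_into_def by blast
  then obtain V \<phi> where V: "(V, \<phi>) \<in> A" "g (h z) \<in> V" by (rule ex_chart)
  have gh: "holo_into U A T (g \<circ> h)" by (rule holo_into_compose[OF g h T(1)])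
  have "((\<phi> \<circ> g) has_field_derivative deriv (\<phi> \<circ> g) (h z)) (at (h z))"
    by (rule holomorphic_derivI[OF holo_chart[OF g V(1)]]) (use hz V in simp)
  moreover have "(h has_field_derivative deriv h z) (at z)" by (rule holomorphic_derivI[OF h(1) T])
  ultimately have "((\<phi> \<circ> g) \<circ> h has_field_derivative deriv (\<phi> \<circ> g) (h z) * deriv h z) (at z)"
    by (rule DERIV_chain)
  then have "deriv (\<phi> \<circ> (g \<circ> h)) z = deriv (\<phi> \<circ> g) (h z) * deriv h z"
    by (simp add: DERIV_imp_deriv o_assoc)
  then show ?thesis
    using pull_eq[OF \<rho> gh V(1) T(2)] pull_eq[OF \<rho> g V(1) hz V(2)] V(2) by (simp add: norm_mult)
qed

text \<open>Read in the chart, \<open>g\<close> is an injective holomorphic function near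
  \<open>z\<close>, hence biholomorphic onto an open set. In this way \<open>locally_inj\<close>
  takes the place of a condition on derivatives.\<close>

lemma local_inverse:
  assumes g: "holo_into U A S g" "locally_inj S g" and V: "(V, \<phi>) \<in> A" and z: "z \<in> S" "g z \<in> V"
  obtains M s where "open M" "z \<in> M" "M \<subseteq> S \<inter> g -` V" "inj_on g M" "open ((\<phi> \<circ> g) ` M)" "s holomorphic_on (\<phi> \<circ> g) ` M"
    "\<And>w. w \<in> M \<Longrightarrow> s (\<phi> (g w)) = w" "\<And>w. w \<in> M \<Longrightarrow> deriv (\<phi> \<circ> g) w \<noteq> 0"
    "\<And>w. w \<in> M \<Longrightarrow> deriv (\<phi> \<circ> g) w * deriv s (\<phi> (g w)) = 1"
proof -
  obtain N where N: "open N" "z \<in> N" "N \<subseteq> S" "inj_on g N" using g(2) z(1) unfolding locally_inj_def by blast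
  define M where "M = N \<inter> (S \<inter> g -` V)"
  have M: "open M" "z \<in> M" "M \<subseteq> S \<inter> g -` V" using N holo_chart(2)[OF g(1) V] z by (auto simp: M_def)
  have injg: "inj_on g M" using N(4) by (auto simp: M_def intro: inj_on_subset)
  have inj: "inj_on (\<phi> \<circ> g) M"
    by (rule comp_inj_on[OF injg]) (use chart_inj[OF V] in \<open>auto simp: M_def intro: inj_on_subset\<close>)
  have hol: "(\<phi> \<circ> g) holomorphic_on M" using holo_chart(1)[OF g(1) V] M(3) by (rule holomorphic_on_subset)
  obtain s where s: "s holomorphic_on (\<phi> \<circ> g) ` M" "\<And>w. w \<in> M \<Longrightarrow> deriv (\<phi> \<circ> g) w * deriv s ((\<phi> \<circ> g) w) = 1"
      "\<And>w. w \<in> M \<Longrightarrow> s ((\<phi> \<circ> g) w) = w"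
    using holomorphic_has_inverse[OF hol M(1) inj] by blast
  have "open ((\<phi> \<circ> g) ` M)" by (rule open_mapping_thm3[OF hol M(1) inj])
  then show ?thesis using that[OF M injg _ s(1)] s(2,3) by (metis comp_apply mult_zero_left zero_neq_one)
qed

text \<open>Near each point \<open>h\<close> is \<open>g\<close> followed by a chart and the
  holomorphic local inverse of \<open>P\<close> in that chart; continuity keeps \<open>h\<close>
  where this inverse applies.\<close>

lemma lift_holomorphic:
  assumes P: "holo_into U A \<Omega> P" "locally_inj \<Omega> P" and g: "holo_into U A S g"
    and h: "continuous_on S h" "h ` S \<subseteq> \<Omega>" "\<And>z. z \<in> S \<Longrightarrow> P (h z) = g z"
  shows "h holomorphic_on S"
proof -
  have S: "open S" using g unfolding holo_into_def by blast
  have "h field_differentiable (at z)" if z: "z \<in> S" for z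
  proof -
    have hz: "h z \<in> \<Omega>" using h(2) z by blast
    then have "P (h z) \<in> U" using P(1) unfolding holo_into_def by blast
    then obtain V \<phi> where V: "(V, \<phi>) \<in> A" "P (h z) \<in> V" by (rule ex_chart)
    obtain M s where M: "open M" "h z \<in> M" "M \<subseteq> \<Omega> \<inter> P -` V" "s holomorphic_on (\<phi> \<circ> P) ` M"
       "\<And>w. w \<in> M \<Longrightarrow> s (\<phi> (P w)) = w"
      using local_inverse[OF P V(1) hz V(2)] by metis
    define S1 where "S1 = S \<inter> h -` M"
    have S1: "open S1" unfolding S1_def using continuous_open_preimage[OF h(1) S M(1)] .
    have sub: "S1 \<subseteq> S \<inter> g -` V" using M(3) h(3) by (auto simp: S1_def)
    have im: "(\<phi> \<circ> g) ` S1 \<subseteq> (\<phi> \<circ> P) ` M" using h(3) by (force simp: S1_def)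
    have "(s \<circ> (\<phi> \<circ> g)) holomorphic_on S1"
      by (rule holomorphic_on_compose_gen[OF holomorphic_on_subset[OF holo_chart(1)[OF g V(1)] sub] M(4) im])
    moreover have "(s \<circ> (\<phi> \<circ> g)) w = h w" if "w \<in> S1" for w
      using that M(5)[of "h w"] h(3)[of w] by (simp add: S1_def)
    ultimately have "h holomorphic_on S1" by (rule holomorphic_transform)
    then show ?thesis using S1 z M(2) by (intro holomorphic_on_imp_differentiable_at[of h S1]) (auto simp: S1_def)
  qed
  then show ?thesis by (simp add: holomorphic_on_def field_differentiable_at_within)
qed

end

section \<open>The lifting property of disc coverings, and recentring by disc automorphisms\<close>

section \<open>Coverings by the disc\<close>

text \<open>Of a universal covering only the lifting property is recorded. In this form the notion does not refer to
  the component that is covered and is visibly invariant under automorphisms of the disc.\<close>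

definition disc_cover :: "'a::t2_space set \<Rightarrow> 'a chart set \<Rightarrow> (complex \<Rightarrow> 'a) \<Rightarrow> bool" where
  "disc_cover U A k \<longleftrightarrow> holo_into U A (ball 0 1) k \<and> locally_inj (ball 0 1) k \<and>
     (\<forall>r g p. 0 < r \<and> continuous_on (ball 0 r) g \<and> g ` ball (0::complex) r \<subseteq> U \<and> p \<in> ball 0 1 \<and> k p = g 0 \<longrightarrow>
       (\<exists>h. continuous_on (ball 0 r) h \<and> h ` ball 0 r \<subseteq> ball 0 1 \<and> h 0 = p \<and> (\<forall>z\<in>ball 0 r. k (h z) = g z)))"

lemma covering_space_locally_inj:
  assumes cov: "covering_space S p Y" and S: "open S"
  shows "locally_inj S p"
  unfolding locally_inj_def
proof
  fix z assume "z \<in> S"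
  then obtain T u q where T: "z \<in> T" "openin (top_of_set S) T" "homeomorphism T u p q"
    using covering_space_local_homeomorphism[OF cov] by metis
  then show "\<exists>N. open N \<and> z \<in> N \<and> N \<subseteq> S \<and> inj_on p N"
    using S openin_open_eq unfolding homeomorphism_def by (metis inj_on_inverseI)
qed

lemma locally_inj_nhds:
  assumes "locally_inj S k" "x \<in> S"
  shows "\<exists>N. openin (top_of_set S) N \<and> x \<in> N \<and> inj_on k N"
  using assms unfolding locally_inj_def by (metis openin_open_Int Int_absorb1)

context surface
begin

lemma disc_coverD:
  assumes "disc_cover U A k"
  shows "holo_into U A (ball 0 1) k" "locally_inj (ball 0 1) k" "z \<in> ball 0 1 \<Longrightarrow> k z \<in> U" "continuous_on (ball 0 1) k"
proof -
  show h: "holo_into U A (ball 0 1) k" and "locally_inj (ball 0 1) k"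
    using assms unfolding disc_cover_def by simp_all
  then show "z \<in> ball 0 1 \<Longrightarrow> k z \<in> U" "continuous_on (ball 0 1) k" unfolding holo_into_def by blast+
qed

lemma disc_cover_lift:
  assumes k: "disc_cover U A k" and r: "0 < r" and g: "continuous_on (ball 0 r) g" "g ` ball (0::complex) r \<subseteq> U"
    and p: "p \<in> ball 0 1" "k p = g 0"
  obtains h where "continuous_on (ball 0 r) h" "h ` ball 0 r \<subseteq> ball 0 1" "h 0 = p" "\<And>z. z \<in> ball 0 r \<Longrightarrow> k (h z) = g z"
  using k r g p unfolding disc_cover_def by metis

lemma disc_cover_lift_holo:
  assumes k: "disc_cover U A k" and r: "0 < r" and g: "holo_into U A (ball 0 r) g"
    and p: "p \<in> ball 0 1" "k p = g 0"
  obtains h where "h holomorphic_on (ball 0 r)" "h ` ball 0 r \<subseteq> ball 0 1" "h 0 = p" "\<And>z. z \<in> ball 0 r \<Longrightarrow> k (h z) = g z"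
proof -
  have "continuous_on (ball 0 r) g" "g ` ball 0 r \<subseteq> U" using g unfolding holo_into_def by blast+
  from disc_cover_lift[OF k r this p] obtain h where h: "continuous_on (ball 0 r) h" "h ` ball 0 r \<subseteq> ball 0 1" "h 0 = p"
    "\<And>z. z \<in> ball 0 r \<Longrightarrow> k (h z) = g z" by metis
  have "h holomorphic_on (ball 0 r)"
    by (rule lift_holomorphic[OF disc_coverD(1,2)[OF k] g h(1,2,4)])
  then show ?thesis using that h by blast
qed

lemma disc_cover_unique_lift:
  assumes k: "disc_cover U A k" and S: "connected S"
    and c: "continuous_on S h1" "h1 ` S \<subseteq> ball 0 1" "continuous_on S h2" "h2 ` S \<subseteq> ball 0 1"
    and eq: "\<And>z. z \<in> S \<Longrightarrow> k (h1 z) = k (h2 z)" and a: "a \<in> S" "h1 a = h2 a" and z: "z \<in> S"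
  shows "h1 z = h2 z"
  by (rule lifts_agree[OF S c(1,3,2,4) eq locally_inj_nhds[OF disc_coverD(2)[OF k]] a z])

text \<open>\<open>disc_cover\<close> lifts maps of discs only. The path is therefore extended to a
  disc of radius 2, which contains the unit interval, by clamping the real part, and the lift is
  restricted again.\<close>

lemma disc_cover_lift_path:
  assumes k: "disc_cover U A k" and \<gamma>: "continuous_on {0..1} \<gamma>" "\<gamma> ` {0..1} \<subseteq> U" and p: "p \<in> ball 0 1" "k p = \<gamma> (0::real)"
  obtains c where "continuous_on {0..1} c" "c ` {0..1} \<subseteq> ball 0 1" "c 0 = p" "\<And>t. t \<in> {0..1} \<Longrightarrow> k (c t) = \<gamma> t"
proof -
  define cl where "cl z = max 0 (min 1 (Re z))" for z
  have cl: "cl z \<in> {0..1}" for z by (auto simp: cl_def)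
  have ccl: "continuous_on S cl" for S unfolding cl_def by (intro continuous_intros)
  obtain h where h: "continuous_on (ball 0 2) h" "h ` ball 0 2 \<subseteq> ball 0 1" "h 0 = p" "\<And>z. z \<in> ball 0 2 \<Longrightarrow> k (h z) = \<gamma> (cl z)"
  proof (rule disc_cover_lift[OF k _ _ _ p(1), of 2 "\<lambda>z. \<gamma> (cl z)"])
    show "continuous_on (ball 0 2) (\<lambda>z. \<gamma> (cl z))"
      by (rule continuous_on_compose2[OF \<gamma>(1) ccl]) (use cl in blast)
    show "(\<lambda>z. \<gamma> (cl z)) ` ball 0 2 \<subseteq> U" using \<gamma>(2) cl by blast
    show "k p = \<gamma> (cl 0)" using p(2) by (simp add: cl_def)
  qed auto
  have b: "complex_of_real t \<in> ball 0 2" if "t \<in> {0..1}" for t using that by auto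
  show ?thesis
  proof (rule that[of "\<lambda>t. h (of_real t)"])
    show "continuous_on {0..1} (\<lambda>t. h (complex_of_real t))"
      by (rule continuous_on_compose2[OF h(1)]) (use b in \<open>auto intro!: continuous_intros\<close>)
    show "(\<lambda>t. h (complex_of_real t)) ` {0..1} \<subseteq> ball 0 1" using h(2) b by blast
    show "h (complex_of_real 0) = p" using h(3) by simp
    show "k (h (complex_of_real t)) = \<gamma> t" if "t \<in> {0..1}" for t
      using h(4)[OF b[OF that]] that by (simp add: cl_def)
  qed
qed

end

text \<open>\<open>Moebius_function 0 w\<close> sends w to 0; the parameter - w gives its inverse,
  which moves the centre to w.\<close>

lemma Moebius_props:
  assumes w: "cmod w < 1"
  shows "Moebius_function 0 (- w) holomorphic_on ball 0 1" "Moebius_function 0 (- w) ` ball 0 1 \<subseteq> ball 0 1"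
    "Moebius_function 0 (- w) 0 = w" "deriv (Moebius_function 0 (- w)) 0 = of_real (1 - (cmod w)\<^sup>2)"
    "\<And>z. z \<in> ball 0 1 \<Longrightarrow> Moebius_function 0 (- w) (Moebius_function 0 w z) = z"
    "\<And>z. z \<in> ball 0 1 \<Longrightarrow> Moebius_function 0 w (Moebius_function 0 (- w) z) = z"
proof -
  show "Moebius_function 0 (- w) holomorphic_on ball 0 1" using w by (intro Moebius_function_holomorphic) simp
  show "Moebius_function 0 (- w) ` ball 0 1 \<subseteq> ball 0 1" using Moebius_function_norm_lt_1[of "- w"] w by auto
  show "Moebius_function 0 (- w) 0 = w" by (simp add: Moebius_function_of_zero)
  show "Moebius_function 0 (- w) (Moebius_function 0 w z) = z" if "z \<in> ball 0 1" for z
    by (rule Moebius_function_compose) (use w that in auto)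
  show "Moebius_function 0 w (Moebius_function 0 (- w) z) = z" if "z \<in> ball 0 1" for z
    by (rule Moebius_function_compose) (use w that in auto)
  have "((\<lambda>z. (z + w) / (1 + cnj w * z)) has_field_derivative (1 - w * cnj w)) (at 0)"
    by (auto intro!: derivative_eq_intros)
  moreover have "Moebius_function 0 (- w) = (\<lambda>z. (z + w) / (1 + cnj w * z))"
    by (simp add: fun_eq_iff Moebius_function_simple)
  ultimately have "deriv (Moebius_function 0 (- w)) 0 = 1 - w * cnj w" by (simp add: DERIV_imp_deriv)
  then show "deriv (Moebius_function 0 (- w)) 0 = of_real (1 - (cmod w)\<^sup>2)"
    unfolding of_real_diff complex_norm_square by simp
qed

context surface
begin

text \<open>Recentring moves any point of the disc to 0, where the Schwarz lemma applies. Lifts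
  through the new map are lifts through \<open>k\<close> followed by the inverse
  automorphism.\<close>

lemma disc_cover_Moebius:
  assumes k: "disc_cover U A k" and w: "cmod w < 1"
  shows "disc_cover U A (k \<circ> Moebius_function 0 (- w))"
proof -
  let ?M = "Moebius_function 0 (- w)" and ?M' = "Moebius_function 0 w"
  have w': "cmod (- w) < 1" using w by simp
  note M = Moebius_props[OF w]
  note M' = Moebius_props[OF w', unfolded minus_minus]
  have cM: "continuous_on (ball 0 1) ?M" "continuous_on (ball 0 1) ?M'"
    using M(1) M'(1) holomorphic_on_imp_continuous_on by blast+
  show ?thesis unfolding disc_cover_def
  proof (intro conjI allI impI)
    show "holo_into U A (ball 0 1) (k \<circ> ?M)"
      by (rule holo_into_compose[OF disc_coverD(1)[OF k] M(1,2) open_ball])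
    show "locally_inj (ball 0 1) (k \<circ> ?M)" unfolding locally_inj_def
    proof
      fix z :: complex assume z: "z \<in> ball 0 1"
      then have "?M z \<in> ball 0 1" using M(2) by blast
      then obtain N where N: "open N" "?M z \<in> N" "N \<subseteq> ball 0 1" "inj_on k N"
        using disc_coverD(2)[OF k] unfolding locally_inj_def by blast
      have "inj_on ?M (ball 0 1)" using M(6) by (rule inj_on_inverseI)
      then have "inj_on (k \<circ> ?M) (ball 0 1 \<inter> ?M -` N)"
        using N(4) by (intro comp_inj_on) (auto intro: inj_on_subset)
      moreover have "open (ball 0 1 \<inter> ?M -` N)" using continuous_open_preimage[OF cM(1) open_ball N(1)] .
      ultimately show "\<exists>N. open N \<and> z \<in> N \<and> N \<subseteq> ball 0 1 \<and> inj_on (k \<circ> ?M) N"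
        using z N(2) by blast
    qed
    fix r g p
    assume as: "0 < r \<and> continuous_on (ball 0 r) g \<and> g ` ball (0::complex) r \<subseteq> U \<and> p \<in> ball 0 1 \<and> (k \<circ> ?M) p = g 0"
    have Mp: "?M p \<in> ball 0 1" using M(2) as by blast
    obtain h where h: "continuous_on (ball 0 r) h" "h ` ball 0 r \<subseteq> ball 0 1" "h 0 = ?M p" "\<And>z. z \<in> ball 0 r \<Longrightarrow> k (h z) = g z"
      using disc_cover_lift[OF k _ _ _ Mp, of r g] as by auto
    show "\<exists>h. continuous_on (ball 0 r) h \<and> h ` ball 0 r \<subseteq> ball 0 1 \<and> h 0 = p \<and> (\<forall>z\<in>ball 0 r. (k \<circ> ?M) (h z) = g z)"
    proof (intro exI[of _ "?M' \<circ> h"] conjI)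
      show "continuous_on (ball 0 r) (?M' \<circ> h)"
        using continuous_on_compose[OF h(1) continuous_on_subset[OF cM(2) h(2)]] .
      show "(?M' \<circ> h) ` ball 0 r \<subseteq> ball 0 1" using h(2) M'(2) by (simp add: image_comp[symmetric]) blast
      show "(?M' \<circ> h) 0 = p" using h(3) M(6) as by simp
      have "h z \<in> ball 0 1" if "z \<in> ball 0 r" for z using h(2) that by blast
      then show "\<forall>z\<in>ball 0 r. (k \<circ> ?M) ((?M' \<circ> h) z) = g z" using M(5) h(4) by simp
    qed
  qed
qed

end

text \<open>A disc in \<open>U\<close> whose centre maps into the component \<open>C\<close> stays
  in \<open>C\<close> by connectedness, so the covering of \<open>C\<close> has the lifting property
  for all of \<open>U\<close>.\<close>

lemma hyperbolic_surface_disc_cover: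
  assumes H: "hyperbolic_surface U A" and x: "x \<in> U"
  obtains k where "disc_cover U A k" "k 0 = x"
proof -
  interpret surface U A using H by unfold_locales (simp add: hyperbolic_surface_def)
  define C where "C = connected_component_set U x"
  have C: "C \<in> components U" "x \<in> C" using x by (auto simp: C_def components_def)
  obtain p where p: "covering_space (ball 0 1) p C"
     "holomorphic_map (ball 0 1) {(ball 0 1, \<lambda>z. z)} C (restrict_atlas A C) p"
    using H C(1) unfolding hyperbolic_surface_def holomorphic_covering_def by blast
  have CU: "C \<subseteq> U" using C(1) by (rule in_components_subset)
  have im: "p ` ball 0 1 = C" using covering_space_imp_surjective[OF p(1)] .
  have hol: "holo_into U A (ball 0 1) p" unfolding holo_into_def
  proof (intro conjI)
    show "continuous_on (ball 0 1) p" using covering_space_imp_continuous[OF p(1)] .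
    show "p ` ball 0 1 \<subseteq> U" using im CU by simp
    show "\<forall>(V, \<phi>)\<in>A. (\<phi> \<circ> p) holomorphic_on (ball 0 1 \<inter> p -` V)"
    proof safe
      fix V \<phi> assume "(V, \<phi>) \<in> A"
      then have "(V \<inter> C, \<phi>) \<in> restrict_atlas A C" unfolding restrict_atlas_def by force
      then have "(\<phi> \<circ> p \<circ> inv_into (ball 0 1) (\<lambda>z. z)) holomorphic_on (\<lambda>z. z) ` (ball 0 1 \<inter> p -` (V \<inter> C))"
        using p(2) unfolding holomorphic_map_def by blast
      moreover have "(\<lambda>z. z) ` (ball 0 1 \<inter> p -` (V \<inter> C)) = ball 0 1 \<inter> p -` V" using im by auto
      ultimately have "(\<phi> \<circ> p \<circ> inv_into (ball 0 1) (\<lambda>z. z)) holomorphic_on (ball 0 1 \<inter> p -` V)" by simp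
      moreover have "(\<phi> \<circ> p \<circ> inv_into (ball 0 1) (\<lambda>z. z)) w = (\<phi> \<circ> p) w" if "w \<in> ball 0 1 \<inter> p -` V" for w :: complex
        using that inv_into_f_f[of "\<lambda>z. z" "ball 0 1" w] by (simp add: inj_on_def)
      ultimately show "(\<phi> \<circ> p) holomorphic_on (ball 0 1 \<inter> p -` V)"
        by (rule holomorphic_transform)
    qed
  qed simp
  have cov: "disc_cover U A p" unfolding disc_cover_def
  proof (intro conjI allI impI)
    fix r g q
    assume as: "0 < r \<and> continuous_on (ball 0 r) g \<and> g ` ball (0::complex) r \<subseteq> U \<and> q \<in> ball 0 1 \<and> p q = g 0"
    have "connected (g ` ball 0 r)" using as by (intro connected_continuous_image) auto
    moreover have "p q \<in> C" using as im by blast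
    then have "g 0 \<in> C" using as by simp
    moreover have "g 0 \<in> g ` ball 0 r" using as by simp
    ultimately have "g ` ball 0 r \<subseteq> C" using components_maximal[OF C(1)] as by blast
    then show "\<exists>h. continuous_on (ball 0 r) h \<and> h ` ball 0 r \<subseteq> ball 0 1 \<and> h 0 = q \<and> (\<forall>z\<in>ball 0 r. p (h z) = g z)"
      using covering_space_lift_ball[OF p(1), of r g q] as by metis
  qed (use hol covering_space_locally_inj[OF p(1)] in auto)
  obtain w where w: "cmod w < 1" "p w = x" using im C(2) by fastforce
  show ?thesis
    by (rule that[OF disc_cover_Moebius[OF cov w(1)]]) (use Moebius_props(3)[OF w(1)] w(2) in simp)
qed

section \<open>Estimates of lengths from below by potentials and from above by segments\<close>

section \<open>Lengths of paths\<close>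

text \<open>Lengths are Lebesgue integrals, whereas the fundamental theorem of calculus yields a
  gauge integral of a function that may fail to be absolutely integrable. In that case the
  right-hand side is infinite.\<close>

lemma abs_has_integral_le_nn_integral:
  fixes g :: "real \<Rightarrow> real"
  assumes g: "(g has_integral I) {a..b}"
  shows "ennreal \<bar>I\<bar> \<le> (\<integral>\<^sup>+x. ennreal \<bar>g x\<bar> * indicator {a..b} x \<partial>lborel)"
proof -
  define h where "h x = g x * indicator {a..b} x" for x
  have hm: "h \<in> borel_measurable lebesgue"
    unfolding h_def by (rule has_integral_implies_lebesgue_measurable_real[OF g])
  have h_eq: "h = (\<lambda>x. if x \<in> {a..b} then g x else 0)" by (auto simp: h_def fun_eq_iff indicator_def)
  have hI: "(h has_integral I) UNIV"
    unfolding h_eq using g has_integral_restrict_UNIV by blast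
  have eq: "(\<integral>\<^sup>+x. ennreal \<bar>g x\<bar> * indicator {a..b} x \<partial>lborel) = (\<integral>\<^sup>+x. ennreal (norm (h x)) \<partial>lebesgue)"
    unfolding nn_integral_completion by (rule nn_integral_cong) (auto simp: h_def indicator_def)
  show ?thesis
  proof (cases "(\<integral>\<^sup>+x. ennreal (norm (h x)) \<partial>lebesgue) < \<infinity>")
    case True
    have ih: "integrable lebesgue h" by (rule integrableI_bounded[OF hm True])
    have "I = integral\<^sup>L lebesgue h"
      using has_integral_unique[OF hI has_integral_integral_lebesgue[OF ih]] .
    then show ?thesis using integral_norm_bound_ennreal[OF ih] eq by simp
  next
    case False
    then show ?thesis unfolding eq by (simp add: not_less top_unique)
  qed
qed

context surface
begin

lemma metric_speed_eq:
  assumes \<rho>: "conformal_metric A \<rho>" and k: "holo_into U A S k" and c: "(c has_vector_derivative c') (at t)" "c t \<in> S"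
    and T: "open T" "t \<in> T" "\<And>s. s \<in> T \<Longrightarrow> \<gamma> s = k (c s)"
  shows "metric_speed A \<rho> \<gamma> t = pull A \<rho> k (c t) * cmod c'"
proof -
  have gt: "\<gamma> t = k (c t)" using T by blast
  have "k (c t) \<in> U" using k c(2) unfolding holo_into_def by blast
  then obtain V \<phi> where V: "(V, \<phi>) \<in> A" "k (c t) \<in> V" "(SOME ch. ch \<in> A \<and> k (c t) \<in> fst ch) = (V, \<phi>)"
    by (rule some_chart)
  have "((\<phi> \<circ> k) has_field_derivative deriv (\<phi> \<circ> k) (c t)) (at (c t))"
    by (rule holomorphic_derivI[OF holo_chart[OF k V(1)]]) (use c(2) V(2) in simp)
  then have "((\<phi> \<circ> k) \<circ> c has_vector_derivative c' * deriv (\<phi> \<circ> k) (c t)) (at t)"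
    by (rule field_vector_diff_chain_at[OF c(1)])
  then have "(\<phi> \<circ> \<gamma> has_vector_derivative c' * deriv (\<phi> \<circ> k) (c t)) (at t)"
    by (rule has_vector_derivative_transform_within_open[OF _ T(1,2)]) (simp add: T(3))
  then have "vector_derivative (\<phi> \<circ> \<gamma>) (at t) = c' * deriv (\<phi> \<circ> k) (c t)"
    by (rule vector_derivative_at)
  then show ?thesis
    unfolding metric_speed_def gt V(3) using pull_eq[OF \<rho> k V(1) c(2) V(2)] gt by (simp add: norm_mult)
qed

text \<open>The lift is a priori only continuous. Locally it is a chart expression of \<gamma>
  followed by a holomorphic inverse branch, so it inherits differentiability off finitely many
  points; compactness of the interval keeps the exceptional set finite.\<close>

lemma piecewise_C1_path_lift_differentiable:
  assumes \<gamma>: "piecewise_C1_path U A \<gamma>" and k: "holo_into U A S k" "locally_inj S k"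
    and c: "continuous_on {0..1} c" "c ` {0..1} \<subseteq> S" "\<And>t. t \<in> {0..1} \<Longrightarrow> k (c t) = \<gamma> t"
  obtains K where "finite K" "\<And>t. t \<in> {0<..<1} - K \<Longrightarrow> \<exists>c'. (c has_vector_derivative c') (at t)"
proof -
  have "\<exists>d K. 0 < d \<and> finite K \<and> (\<forall>s\<in>ball t d \<inter> {0<..<1} - K. \<exists>c'. (c has_vector_derivative c') (at s))"
    if t: "t \<in> {0..1}" for t
  proof -
    have ct: "c t \<in> S" using c(2) t by blast
    then have "k (c t) \<in> U" using k(1) unfolding holo_into_def by blast
    then obtain V \<phi> where V: "(V, \<phi>) \<in> A" "k (c t) \<in> V" by (rule ex_chart)
    obtain M s where M: "open M" "c t \<in> M" "M \<subseteq> S \<inter> k -` V" "open ((\<phi> \<circ> k) ` M)" "s holomorphic_on (\<phi> \<circ> k) ` M"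
       "\<And>w. w \<in> M \<Longrightarrow> s (\<phi> (k w)) = w"
      using local_inverse[OF k V(1) ct V(2)] by metis
    obtain e where e: "e > 0" "\<And>w. dist w (c t) < e \<Longrightarrow> w \<in> M" using M(1,2) unfolding open_dist by blast
    obtain d where d: "d > 0" "\<And>x. x \<in> {0..1} \<Longrightarrow> dist x t < d \<Longrightarrow> dist (c x) (c t) < e"
      using c(1) t e(1) unfolding continuous_on_iff by metis
    have inM: "c x \<in> M" if "x \<in> {0..1}" "dist x t < d" for x using d(2)[OF that] e(2) by blast
    \<comment> \<open>\<open>piecewise_C1_path\<close> speaks of closed intervals; half of
      \<open>d\<close> keeps \<open>{a..b}\<close> where \<open>c\<close> stays in
      \<open>M\<close>.\<close>
    define a where "a = max 0 (t - d / 2)"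
    define b where "b = min 1 (t + d / 2)"
    have ab: "{a..b} \<subseteq> {0..1}" "\<And>x. x \<in> {a..b} \<Longrightarrow> dist x t < d"
      using d(1) by (auto simp: a_def b_def dist_real_def)
    have "\<gamma> ` {a..b} \<subseteq> V"
    proof
      fix y assume "y \<in> \<gamma> ` {a..b}"
      then obtain x where x: "x \<in> {a..b}" "y = \<gamma> x" by blast
      then have "c x \<in> M" using ab inM by blast
      then show "y \<in> V" using M(3) c(3)[of x] x ab(1) by auto
    qed
    then have "(\<phi> \<circ> \<gamma>) piecewise_C1_differentiable_on {a..b}"
      using \<gamma> V(1) ab(1) unfolding piecewise_C1_path_def by blast
    then obtain K where K: "finite K" "(\<phi> \<circ> \<gamma>) C1_differentiable_on ({a..b} - K)"
      unfolding piecewise_C1_differentiable_on_def by blast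
    have "\<exists>c'. (c has_vector_derivative c') (at x)" if x: "x \<in> {a<..<b} - K" for x
    proof -
      obtain D where D: "(\<phi> \<circ> \<gamma> has_vector_derivative D) (at x)"
        using K(2) x unfolding C1_differentiable_on_def by force
      have eq: "s ((\<phi> \<circ> \<gamma>) y) = c y" "(\<phi> \<circ> \<gamma>) y \<in> (\<phi> \<circ> k) ` M" if "y \<in> {a<..<b}" for y
      proof -
        have y: "y \<in> {a..b}" using that by auto
        then have "c y \<in> M" "k (c y) = \<gamma> y" using ab inM c(3) by blast+
        then show "s ((\<phi> \<circ> \<gamma>) y) = c y" "(\<phi> \<circ> \<gamma>) y \<in> (\<phi> \<circ> k) ` M" using M(6)[of "c y"] by (auto intro!: image_eqI[of _ _ "c y"])
      qed
      have "(s has_field_derivative deriv s ((\<phi> \<circ> \<gamma>) x)) (at ((\<phi> \<circ> \<gamma>) x))"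
        by (rule holomorphic_derivI[OF M(5,4)]) (use eq(2) x in blast)
      from field_vector_diff_chain_at[OF D this]
      have "(c has_vector_derivative D * deriv s ((\<phi> \<circ> \<gamma>) x)) (at x)"
        by (rule has_vector_derivative_transform_within_open[of _ _ _ "{a<..<b}"]) (use x eq(1) in auto)
      then show ?thesis by blast
    qed
    moreover have "ball t (d / 2) \<inter> {0<..<1} \<subseteq> {a<..<b}"
      unfolding ball_eq_greaterThanLessThan by (auto simp: a_def b_def)
    ultimately show ?thesis using d(1) K(1) by (intro exI[of _ "d / 2"] exI[of _ K]) auto
  qed
  then obtain d K where dK: "\<And>t. t \<in> {0..1} \<Longrightarrow> 0 < d t \<and> finite (K t) \<and>
      (\<forall>s\<in>ball t (d t) \<inter> {0<..<1} - K t. \<exists>c'. (c has_vector_derivative c') (at s))" by metis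
  have "{0..1} \<subseteq> (\<Union>t\<in>{0..1}. ball t (d t))" using dK by force
  then obtain C where C: "C \<subseteq> {0..1::real}" "finite C" "{0..1} \<subseteq> (\<Union>t\<in>C. ball t (d t))"
    by (rule compactE_image[OF compact_Icc _ , rotated]) auto
  show ?thesis
  proof (rule that[of "\<Union>t\<in>C. K t"])
    show "finite (\<Union>t\<in>C. K t)" using C dK by blast
    fix s assume s: "s \<in> {0<..<1} - (\<Union>t\<in>C. K t)"
    then have "s \<in> {0..1}" by auto
    then obtain t where t: "t \<in> C" "s \<in> ball t (d t)" using C(3) by blast
    then have "s \<in> ball t (d t) \<inter> {0<..<1} - K t" using s by blast
    then show "\<exists>c'. (c has_vector_derivative c') (at s)" using dK[of t] t(1) C(1) by blast
  qed
qed

text \<open>Along the lift the derivative of the potential \<open>G\<close> is bounded by the speed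
  of \<gamma>, so the variation of \<open>G\<close> is at most the length. All lower bounds for
  distances are obtained from this.\<close>

lemma metric_length_ge:
  assumes \<rho>: "conformal_metric A \<rho>" and \<gamma>: "piecewise_C1_path U A \<gamma>"
    and k: "holo_into U A S k" "locally_inj S k"
    and c: "continuous_on {0..1} c" "c ` {0..1} \<subseteq> S" "\<And>t. t \<in> {0..1} \<Longrightarrow> k (c t) = \<gamma> t"
    and G: "\<And>z. z \<in> S \<Longrightarrow> (G has_derivative G' z) (at z)"
    and bound: "\<And>z h. z \<in> S \<Longrightarrow> \<bar>G' z h\<bar> \<le> pull A \<rho> k z * cmod h"
    and st: "0 \<le> s" "s \<le> t" "t \<le> 1"
  shows "ennreal \<bar>G (c t) - G (c s)\<bar> \<le> metric_length A \<rho> \<gamma>"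
proof -
  obtain K where K: "finite K" "\<And>t. t \<in> {0<..<1} - K \<Longrightarrow> \<exists>c'. (c has_vector_derivative c') (at t)"
    using piecewise_C1_path_lift_differentiable[OF \<gamma> k c] by metis
  obtain c' where c': "\<And>t. t \<in> {0<..<1} - K \<Longrightarrow> (c has_vector_derivative c' t) (at t)"
    using K(2) by metis
  have inS: "c x \<in> S" if "x \<in> {0..1}" for x using c(2) that by blast
  \<comment> \<open>The value 0 at the exceptional times changes no integral and lets the comparison
    with the speed hold at every point.\<close>
  define f where "f x = (if x \<in> {0<..<1} - K then G' (c x) (c' x) else 0)" for x
  have "((\<lambda>x. G (c x)) has_vector_derivative f x) (at x)" if x: "x \<in> {s<..<t} - K" for x
  proof -
    have x': "x \<in> {0<..<1} - K" using x st by auto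
    have "(c has_derivative (\<lambda>h. h *\<^sub>R c' x)) (at x)" using c'[OF x'] by (simp add: has_vector_derivative_def)
    from has_derivative_compose[OF this G[OF inS]]
    have "((\<lambda>x. G (c x)) has_derivative (\<lambda>h. G' (c x) (h *\<^sub>R c' x))) (at x)" using x' by simp
    moreover have "linear (G' (c x))" using has_derivative_linear[OF G[OF inS]] x' by simp
    ultimately show ?thesis
      using x' by (simp add: has_vector_derivative_def f_def linear_cmul)
  qed
  moreover have "continuous_on {s..t} (\<lambda>x. G (c x))"
  proof (rule continuous_on_compose2[of S G])
    show "continuous_on S G" using G by (meson continuous_at_imp_continuous_on has_derivative_continuous)
    show "continuous_on {s..t} c" by (rule continuous_on_subset[OF c(1)]) (use st in auto)
    show "c ` {s..t} \<subseteq> S" using inS st by auto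
  qed
  ultimately have "(f has_integral (G (c t) - G (c s))) {s..t}"
    by (intro fundamental_theorem_of_calculus_interior_strong[OF K(1) st(2)]) auto
  then have "ennreal \<bar>G (c t) - G (c s)\<bar> \<le> (\<integral>\<^sup>+x. ennreal \<bar>f x\<bar> * indicator {s..t} x \<partial>lborel)"
    by (rule abs_has_integral_le_nn_integral)
  also have "\<dots> \<le> (\<integral>\<^sup>+x. ennreal (metric_speed A \<rho> \<gamma> x) * indicator {0..1} x \<partial>lborel)"
  proof (rule nn_integral_mono)
    fix x :: real
    show "ennreal \<bar>f x\<bar> * indicator {s..t} x \<le> ennreal (metric_speed A \<rho> \<gamma> x) * indicator {0..1} x"
    proof (cases "x \<in> {0<..<1} - K \<and> x \<in> {s..t}")
      case True
      then have x: "x \<in> {0<..<1} - K" by blast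
      have "metric_speed A \<rho> \<gamma> x = pull A \<rho> k (c x) * cmod (c' x)"
        by (rule metric_speed_eq[OF \<rho> k(1) c'[OF x] inS, of "{0<..<1}"]) (use x c(3) in auto)
      moreover have "\<bar>f x\<bar> \<le> pull A \<rho> k (c x) * cmod (c' x)" using bound[OF inS] x by (simp add: f_def)
      ultimately show ?thesis using x by (auto intro: ennreal_leI simp: indicator_def)
    next
      case False
      then have "ennreal \<bar>f x\<bar> * indicator {s..t} x = 0" by (auto simp: f_def indicator_def)
      then show ?thesis by (simp only: zero_le)
    qed
  qed
  finally show ?thesis unfolding metric_length_def .
qed

lemma holo_into_linepath:
  assumes k: "holo_into U A S k" and pq: "closed_segment p q \<subseteq> S"
  shows "piecewise_C1_path U A (k \<circ> linepath p q)"
  unfolding piecewise_C1_path_def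
proof (intro conjI)
  have im: "linepath p q t \<in> S" if "t \<in> {0..1}" for t
    using pq linepath_in_path[OF that] by blast
  show "path (k \<circ> linepath p q)" unfolding path_def
    by (rule continuous_on_compose) (use k im in \<open>auto simp: holo_into_def intro: continuous_on_subset\<close>)
  show "path_image (k \<circ> linepath p q) \<subseteq> U"
    unfolding path_image_def using k im unfolding holo_into_def by fastforce
  show "\<forall>(V, \<phi>)\<in>A. \<forall>a b. {a..b} \<subseteq> {0..1} \<and> (k \<circ> linepath p q) ` {a..b} \<subseteq> V \<longrightarrow>
      (\<phi> \<circ> (k \<circ> linepath p q)) piecewise_C1_differentiable_on {a..b}"
  proof safe
    fix V \<phi> and a b :: real
    assume V: "(V, \<phi>) \<in> A" and ab: "{a..b} \<subseteq> {0..1}" "(k \<circ> linepath p q) ` {a..b} \<subseteq> V"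
    have in2: "linepath p q t \<in> S \<inter> k -` V" if "t \<in> {a..b}" for t
      using im[of t] ab that by auto
    have hol: "(\<phi> \<circ> k) holomorphic_on (S \<inter> k -` V)" "open (S \<inter> k -` V)" using holo_chart[OF k V] by blast+
    have "(\<phi> \<circ> (k \<circ> linepath p q)) C1_differentiable_on {a..b}"
      unfolding C1_differentiable_on_def
    proof (intro exI conjI ballI)
      fix t assume t: "t \<in> {a..b}"
      show "(\<phi> \<circ> (k \<circ> linepath p q) has_vector_derivative (q - p) * deriv (\<phi> \<circ> k) (linepath p q t)) (at t)"
        using field_vector_diff_chain_at[OF has_vector_derivative_linepath_within holomorphic_derivI[OF hol in2[OF t]]]
        by (simp only: o_assoc)
    next
      show "continuous_on {a..b} (\<lambda>t. (q - p) * deriv (\<phi> \<circ> k) (linepath p q t))"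
        by (intro continuous_intros continuous_on_compose2[OF holomorphic_on_imp_continuous_on[OF holomorphic_deriv[OF hol]]])
           (use in2 in auto)
    qed
    then show "(\<phi> \<circ> (k \<circ> linepath p q)) piecewise_C1_differentiable_on {a..b}"
      by (rule C1_differentiable_imp_piecewise)
  qed
qed

lemma metric_dist_le:
  assumes \<rho>: "conformal_metric A \<rho>" and k: "holo_into U A S k" and pq: "closed_segment p q \<subseteq> S"
    and M: "\<And>z. z \<in> closed_segment p q \<Longrightarrow> pull A \<rho> k z \<le> M"
  shows "metric_dist U A \<rho> (k p) (k q) \<le> ennreal (M * cmod (q - p))"
proof -
  let ?\<gamma> = "k \<circ> linepath p q"
  have "metric_dist U A \<rho> (k p) (k q) \<le> metric_length A \<rho> ?\<gamma>"
    unfolding metric_dist_def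
    by (rule INF_lower) (use holo_into_linepath[OF k pq] in \<open>auto simp: pathstart_def pathfinish_def linepath_def\<close>)
  also have "\<dots> \<le> (\<integral>\<^sup>+x. ennreal (M * cmod (q - p)) * indicator {0..1::real} x \<partial>lborel)"
    unfolding metric_length_def
  proof (rule nn_integral_mono)
    fix x :: real
    show "ennreal (metric_speed A \<rho> ?\<gamma> x) * indicator {0..1} x \<le> ennreal (M * cmod (q - p)) * indicator {0..1} x"
    proof (cases "x \<in> {0..1}")
      case True
      then have seg: "linepath p q x \<in> closed_segment p q" by (rule linepath_in_path)
      have "metric_speed A \<rho> ?\<gamma> x = pull A \<rho> k (linepath p q x) * cmod (q - p)"
        by (rule metric_speed_eq[OF \<rho> k has_vector_derivative_linepath_within, of _ _ _ UNIV]) (use seg pq in auto)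
      also have "\<dots> \<le> M * cmod (q - p)" by (rule mult_right_mono[OF M[OF seg]]) simp
      finally show ?thesis using True by (simp add: ennreal_leI)
    qed simp
  qed
  also have "\<dots> = ennreal (M * cmod (q - p))" by (simp add: nn_integral_cmult_indicator)
  finally show ?thesis .
qed

end

section \<open>Two-sided comparison of metric balls with Euclidean discs\<close>

section \<open>Distances of metrics that pull back to the Poincare metric\<close>

text \<open>The meeting point of existence and uniqueness: it refers neither to curvature nor to
  completeness, yet it determines lengths, since paths lift through disc coverings.\<close>

definition poincare_metric :: "'a::t2_space set \<Rightarrow> 'a chart set \<Rightarrow> 'a density \<Rightarrow> bool" where
  "poincare_metric U A \<rho> \<longleftrightarrow> conformal_metric A \<rho> \<and>
     (\<forall>k z. disc_cover U A k \<longrightarrow> z \<in> ball 0 1 \<longrightarrow> pull A \<rho> k z = 2 / (1 - (cmod z)\<^sup>2))"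

lemma disc_norm_sq: "z \<in> ball 0 1 \<Longrightarrow> (cmod z)\<^sup>2 < 1"
  by (simp add: abs_square_less_1)

text \<open>The hyperbolic distance to 0 would be the sharp potential but is not differentiable at
  0. This one is smooth, still tends to infinity at the boundary of the disc, and its gradient is
  dominated by the density because |F| < 1.\<close>

lemma disc_potential:
  assumes F: "F holomorphic_on S" "open S" and z: "z \<in> S" "F z \<in> ball 0 1"
  defines "G' \<equiv> \<lambda>h. 2 * Re (cnj (F z) * (deriv F z * h)) / (1 - (cmod (F z))\<^sup>2)"
  shows "((\<lambda>z. - ln (1 - (cmod (F z))\<^sup>2)) has_derivative G') (at z)"
    and "\<bar>G' h\<bar> \<le> 2 * cmod (deriv F z) / (1 - (cmod (F z))\<^sup>2) * cmod h"
proof -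
  have pos: "0 < 1 - (cmod (F z))\<^sup>2" using disc_norm_sq[OF z(2)] by simp
  have n2: "((\<lambda>z. 1 - (cmod z)\<^sup>2) has_derivative (\<lambda>h. - (2 * Re (cnj w * h)))) (at w)" for w :: complex
    unfolding cmod_power2 by (auto intro!: derivative_eq_intros)
  have "(F has_derivative (\<lambda>h. deriv F z * h)) (at z)"
    using holomorphic_derivI[OF F z(1)] by (simp add: has_field_derivative_def)
  from has_derivative_compose[OF this n2]
  have "((\<lambda>z. 1 - (cmod (F z))\<^sup>2) has_derivative (\<lambda>h. - (2 * Re (cnj (F z) * (deriv F z * h))))) (at z)" .
  from has_derivative_minus[OF has_derivative_ln[OF pos this]]
  show "((\<lambda>z. - ln (1 - (cmod (F z))\<^sup>2)) has_derivative G') (at z)"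
    unfolding G'_def by (rule has_derivative_eq_rhs) (simp add: fun_eq_iff divide_inverse algebra_simps)
  have "\<bar>Re (cnj (F z) * (deriv F z * h))\<bar> \<le> cmod (F z) * cmod (deriv F z * h)"
    using abs_Re_le_cmod[of "cnj (F z) * (deriv F z * h)"] by (simp add: norm_mult)
  also have "\<dots> \<le> 1 * cmod (deriv F z * h)" by (rule mult_right_mono) (use z(2) in auto)
  finally have "2 * \<bar>Re (cnj (F z) * (deriv F z * h))\<bar> / (1 - (cmod (F z))\<^sup>2) \<le>
      2 * (1 * cmod (deriv F z * h)) / (1 - (cmod (F z))\<^sup>2)"
    using pos by (intro divide_right_mono mult_left_mono) auto
  moreover have "\<bar>2 * X / Y\<bar> = 2 * \<bar>X\<bar> / Y" if "0 < Y" for X Y :: real using that by (simp add: abs_mult)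
  then have "\<bar>G' h\<bar> = 2 * \<bar>Re (cnj (F z) * (deriv F z * h))\<bar> / (1 - (cmod (F z))\<^sup>2)"
    using pos unfolding G'_def by blast
  ultimately show "\<bar>G' h\<bar> \<le> 2 * cmod (deriv F z) / (1 - (cmod (F z))\<^sup>2) * cmod h" by (simp add: norm_mult)
qed

context surface
begin

lemma metric_dist_lift:
  assumes k: "disc_cover U A k" and p: "p \<in> ball 0 1" and d: "metric_dist U A \<rho> (k p) y < b"
  obtains \<gamma> c where "piecewise_C1_path U A \<gamma>" "metric_length A \<rho> \<gamma> < b" "continuous_on {0..1} c"
    "c ` {0..1} \<subseteq> ball 0 1" "c 0 = p" "\<And>t. t \<in> {0..1} \<Longrightarrow> k (c t) = \<gamma> t" "k (c 1) = y"
proof -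
  obtain \<gamma> where \<gamma>: "piecewise_C1_path U A \<gamma>" "pathstart \<gamma> = k p" "pathfinish \<gamma> = y" "metric_length A \<rho> \<gamma> < b"
    using d unfolding metric_dist_def INF_less_iff by blast
  have "continuous_on {0..1} \<gamma>" "\<gamma> ` {0..1} \<subseteq> U" "k p = \<gamma> 0"
    using \<gamma> unfolding piecewise_C1_path_def path_def path_image_def pathstart_def by simp_all
  then obtain c where c: "continuous_on {0..1} c" "c ` {0..1} \<subseteq> ball 0 1" "c 0 = p" "\<And>t. t \<in> {0..1} \<Longrightarrow> k (c t) = \<gamma> t"
    using disc_cover_lift_path[OF k _ _ p] by metis
  have "k (c 1) = y" using c(4)[of 1] \<gamma>(3) by (simp add: pathfinish_def)
  then show ?thesis using that[OF \<gamma>(1,4) c] by blast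
qed

text \<open>A path shorter than \<open>R\<close> lifts to one from 0 to \<eta>, along which - ln (1
  - |z|^2) changes by less than \<open>R\<close>. The resulting radius is not sharp, but it is below
  1 and depends on \<open>R\<close> alone.\<close>

lemma poincare_metric_near:
  assumes \<rho>: "poincare_metric U A \<rho>" and k: "disc_cover U A k" and d: "metric_dist U A \<rho> (k 0) y < ennreal R"
  obtains \<eta> where "\<eta> \<in> ball 0 1" "k \<eta> = y" "(cmod \<eta>)\<^sup>2 < 1 - exp (- R)"
proof -
  have cm: "conformal_metric A \<rho>" and pl: "\<And>z. z \<in> ball 0 1 \<Longrightarrow> pull A \<rho> k z = 2 / (1 - (cmod z)\<^sup>2)"
    using \<rho> k unfolding poincare_metric_def by blast+
  have "(0::complex) \<in> ball 0 1" by simp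
  from metric_dist_lift[OF k this d]
  obtain \<gamma> c where \<gamma>: "piecewise_C1_path U A \<gamma>" "metric_length A \<rho> \<gamma> < ennreal R" and c: "continuous_on {0..1} c"
    "c ` {0..1} \<subseteq> ball 0 1" "c 0 = 0" "\<And>t. t \<in> {0..1} \<Longrightarrow> k (c t) = \<gamma> t" "k (c 1) = y" by metis
  let ?G = "\<lambda>z. - ln (1 - (cmod z)\<^sup>2)"
  have "ennreal \<bar>?G (c 1) - ?G (c 0)\<bar> \<le> metric_length A \<rho> \<gamma>"
  proof (rule metric_length_ge[OF cm \<gamma>(1) disc_coverD(1,2)[OF k] c(1,2,4)])
    fix z h :: complex assume z: "z \<in> ball 0 1"
    note P = disc_potential[OF holomorphic_on_ident open_ball z z]
    show "(?G has_derivative (\<lambda>h. 2 * Re (cnj z * (deriv (\<lambda>z. z) z * h)) / (1 - (cmod z)\<^sup>2))) (at z)" by (rule P(1))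
    show "\<bar>2 * Re (cnj z * (deriv (\<lambda>z. z) z * h)) / (1 - (cmod z)\<^sup>2)\<bar> \<le> pull A \<rho> k z * cmod h"
      using P(2)[of h] pl[OF z] by simp
  qed simp_all
  also have "\<dots> < ennreal R" by (rule \<gamma>(2))
  finally have "\<bar>?G (c 1) - ?G (c 0)\<bar> < R" by (simp add: ennreal_less_iff)
  then have ln: "- R < ln (1 - (cmod (c 1))\<^sup>2)" using c(3) by simp
  have c1: "c 1 \<in> ball 0 1" using c(2) by (simp add: image_subset_iff)
  have "0 < 1 - (cmod (c 1))\<^sup>2" using disc_norm_sq[OF c1] by simp
  then have "exp (- R) < 1 - (cmod (c 1))\<^sup>2" using ln by (metis exp_less_mono exp_ln)
  then show ?thesis using that[OF c1 c(5)] by simp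
qed

text \<open>The radial segment has Euclidean length at most \<open>s\<close>, and the density on it
  is at most 2 / (1 - s^2).\<close>

lemma poincare_metric_far:
  assumes \<rho>: "poincare_metric U A \<rho>" and k: "disc_cover U A k" and \<eta>: "cmod \<eta> \<le> s" "s < 1"
  shows "metric_dist U A \<rho> (k 0) (k \<eta>) \<le> ennreal (2 * s / (1 - s\<^sup>2))"
proof -
  have cm: "conformal_metric A \<rho>" and pl: "\<And>z. z \<in> ball 0 1 \<Longrightarrow> pull A \<rho> k z = 2 / (1 - (cmod z)\<^sup>2)"
    using \<rho> k unfolding poincare_metric_def by blast+
  have s0: "0 \<le> s" using \<eta> norm_ge_zero order_trans by blast
  have s2: "s\<^sup>2 < 1" using s0 \<eta>(2) by (simp add: abs_square_less_1)
  have seg: "cmod z \<le> s" if "z \<in> closed_segment 0 \<eta>" for z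
  proof -
    have "closed_segment 0 \<eta> \<subseteq> cball 0 s" by (rule closed_segment_subset) (use s0 \<eta> in auto)
    then show ?thesis using that by auto
  qed
  have "metric_dist U A \<rho> (k 0) (k \<eta>) \<le> ennreal (2 / (1 - s\<^sup>2) * cmod (\<eta> - 0))"
  proof (rule metric_dist_le[OF cm disc_coverD(1)[OF k]])
    show "closed_segment 0 \<eta> \<subseteq> ball 0 1" using seg \<eta>(2) by fastforce
    fix z assume z: "z \<in> closed_segment 0 \<eta>"
    have "(cmod z)\<^sup>2 \<le> s\<^sup>2" using seg[OF z] by (intro power_mono) auto
    then have "2 / (1 - (cmod z)\<^sup>2) \<le> 2 / (1 - s\<^sup>2)" using s2 by (intro divide_left_mono) auto
    then show "pull A \<rho> k z \<le> 2 / (1 - s\<^sup>2)" using pl[of z] seg[OF z] \<eta>(2) by simp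
  qed
  also have "\<dots> \<le> ennreal (2 / (1 - s\<^sup>2) * s)"
    using \<eta> s2 by (intro ennreal_leI mult_left_mono) auto
  finally show ?thesis by simp
qed

end

section \<open>Construction of a complete conformal metric of curvature -1\<close>

section \<open>Existence of the hyperbolic metric\<close>

lemma frechet_derivative_cong_open:
  assumes S: "open S" "z \<in> S" and eq: "\<And>w. w \<in> S \<Longrightarrow> f w = g w"
  shows "frechet_derivative f (at z) = frechet_derivative g (at z)"
proof -
  have "(f has_derivative D) (at z) \<longleftrightarrow> (g has_derivative D) (at z)" for D
    using has_derivative_transform_within_open[OF _ S, of f D UNIV g]
      has_derivative_transform_within_open[OF _ S, of g D UNIV f] eq by metis
  then show ?thesis unfolding frechet_derivative_def by simp
qed

lemma gauss_curvature_cong: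
  assumes S: "open S" "z \<in> S" and eq: "\<And>w. w \<in> S \<Longrightarrow> r w = r' w"
  shows "gauss_curvature r z = gauss_curvature r' z"
proof -
  have "frechet_derivative (\<lambda>w. ln (r w)) (at v) = frechet_derivative (\<lambda>w. ln (r' w)) (at v)" if "v \<in> S" for v
    by (rule frechet_derivative_cong_open[OF S(1) that]) (simp add: eq)
  then have "frechet_derivative (\<lambda>v. frechet_derivative (\<lambda>w. ln (r w)) (at v) b) (at z) =
      frechet_derivative (\<lambda>v. frechet_derivative (\<lambda>w. ln (r' w)) (at v) b) (at z)" for b
    by (intro frechet_derivative_cong_open[OF S]) simp
  then show ?thesis using eq[OF S(2)] by (simp add: gauss_curvature_def laplacian_def)
qed

lemma disc_metric_pullback:
  assumes N: "open N" and s: "s holomorphic_on N" "s ` N \<subseteq> ball 0 1" "\<And>w. w \<in> N \<Longrightarrow> deriv s w \<noteq> 0"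
  defines "r \<equiv> \<lambda>w. 2 * cmod (deriv s w) / (1 - (cmod (s w))\<^sup>2)"
  shows "Ck_on k N r" "\<And>w. w \<in> N \<Longrightarrow> 0 < r w" "\<And>w. w \<in> N \<Longrightarrow> gauss_curvature r w = -1"
proof -
  have pos: "0 < 1 - (cmod (s w))\<^sup>2" if "w \<in> N" for w using disc_norm_sq[of "s w"] s(2) that by auto
  show rpos: "0 < r w" if "w \<in> N" for w using pos[OF that] s(3)[OF that] by (simp add: r_def)
  \<comment> \<open>The modulus is written as the square root of a positive smooth function, to
    which the closure lemmas apply.\<close>
  have "Ck_on k N (\<lambda>w. 2 * sqrt ((cmod (deriv s w))\<^sup>2) * inverse (1 + (-1) * (cmod (s w))\<^sup>2))"
  proof (intro Ck_on_mult[OF N] Ck_on_const Ck_on_sqrt[OF N] Ck_on_inverse[OF N] Ck_on_add[OF N] Ck_on_norm2_holomorphic[OF N])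
    show "deriv s holomorphic_on N" by (rule holomorphic_deriv[OF s(1) N])
    show "0 < (cmod (deriv s z))\<^sup>2" if "z \<in> N" for z using s(3)[OF that] by simp
    show "1 + (-1) * (cmod (s z))\<^sup>2 \<noteq> 0" if "z \<in> N" for z using pos[OF that] by simp
  qed (rule s(1))
  then show "Ck_on k N r" by (rule Ck_on_cong[OF N, rotated]) (simp add: r_def divide_inverse)
  fix w assume w: "w \<in> N"
  let ?u = "\<lambda>z. ln (2 / (1 - (cmod (s z))\<^sup>2)) + ln (cmod (deriv s z))"
  obtain a b where L: "liouville N ?u a b"
    using liouville_pullback[OF open_ball N liouville_disc s] by metis
  have ru: "ln (r z) = ?u z" if "z \<in> N" for z
    using pos[OF that] s(3)[OF that] by (simp add: r_def ln_mult ln_div)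
  have "gauss_curvature r w = gauss_curvature (\<lambda>z. exp (?u z)) w"
    by (rule gauss_curvature_cong[OF N w]) (metis ru rpos exp_ln)
  also have "\<dots> = -1"
  proof -
    have "(exp x)\<^sup>2 = exp (2 * x)" for x :: real by (simp add: exp_double)
    then show ?thesis using liouville_laplacian[OF N L w] unfolding gauss_curvature_def ln_exp by simp
  qed
  finally show "gauss_curvature r w = -1" .
qed

text \<open>The density at \<open>\<zeta>\<close> is read off from any covering by the disc that maps \<open>0\<close> to the point with
  coordinate \<open>\<zeta>\<close>.\<close>

definition disc_density :: "'a::t2_space set \<Rightarrow> 'a chart set \<Rightarrow> 'a density" where
  "disc_density U A c \<zeta> =
     2 / cmod (deriv (snd c \<circ> (SOME k. disc_cover U A k \<and> k 0 = inv_into (fst c) (snd c) \<zeta>)) 0)"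

locale hyp_surface =
  fixes U :: "'a::t2_space set" and A :: "'a chart set"
  assumes hyp: "hyperbolic_surface U A"

sublocale hyp_surface \<subseteq> surface U A
  using hyp by unfold_locales (simp add: hyperbolic_surface_def)

context hyp_surface
begin

text \<open>Lifting \<open>k\<close> through \<open>k'\<close> gives a self-map of the disc fixing
  0, and the Schwarz lemma bounds its derivative. Used in both directions this makes
  \<open>disc_density\<close> independent of the covering chosen.\<close>

lemma disc_cover_deriv_le:
  assumes k: "disc_cover U A k" "disc_cover U A k'" "k 0 = k' 0" and V: "(V, \<phi>) \<in> A" "k 0 \<in> V"
  shows "cmod (deriv (\<phi> \<circ> k) 0) \<le> cmod (deriv (\<phi> \<circ> k') 0)"
proof -
  have "(0::complex) \<in> ball 0 1" by simp
  from disc_cover_lift_holo[OF k(2) _ disc_coverD(1)[OF k(1)] this k(3)[symmetric]]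
  obtain h where h: "h holomorphic_on ball 0 1" "h ` ball 0 1 \<subseteq> ball 0 1" "h 0 = 0" "\<And>z. z \<in> ball 0 1 \<Longrightarrow> k' (h z) = k z"
    by (metis zero_less_one)
  have h1: "cmod (deriv h 0) \<le> 1"
    by (rule Schwarz_Lemma(2)[where \<xi> = 0, OF h(1,3)]) (use h(2) in \<open>auto simp: image_subset_iff\<close>)
  have d: "((\<phi> \<circ> k') has_field_derivative deriv (\<phi> \<circ> k') (h 0)) (at (h 0))"
    by (rule holomorphic_derivI[OF holo_chart[OF disc_coverD(1)[OF k(2)] V(1)]]) (use V(2) k(3) h(3) in simp)
  have dh: "(h has_field_derivative deriv h 0) (at 0)" by (rule holomorphic_derivI[OF h(1) open_ball]) simp
  have "(\<phi> \<circ> k has_field_derivative deriv (\<phi> \<circ> k') (h 0) * deriv h 0) (at 0)"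
    by (rule has_field_derivative_transform_within_open[OF DERIV_chain[OF d dh] open_ball[of 0 1]]) (use h(4) in auto)
  then have "deriv (\<phi> \<circ> k) 0 = deriv (\<phi> \<circ> k') 0 * deriv h 0" using h(3) by (simp add: DERIV_imp_deriv)
  then show ?thesis using mult_left_mono[OF h1, of "cmod (deriv (\<phi> \<circ> k') 0)"] by (simp add: norm_mult)
qed

lemma disc_density_at_0:
  assumes k: "disc_cover U A k" and V: "(V, \<phi>) \<in> A" "k 0 \<in> V"
  shows "disc_density U A (V, \<phi>) (\<phi> (k 0)) = 2 / cmod (deriv (\<phi> \<circ> k) 0)"
proof -
  define k' where "k' = (SOME k'. disc_cover U A k' \<and> k' 0 = inv_into V \<phi> (\<phi> (k 0)))"
  have inv: "inv_into V \<phi> (\<phi> (k 0)) = k 0" by (rule chart_inv[OF V])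
  have "disc_cover U A k \<and> k 0 = inv_into V \<phi> (\<phi> (k 0))" using k inv by simp
  then have "disc_cover U A k' \<and> k' 0 = inv_into V \<phi> (\<phi> (k 0))"
    unfolding k'_def by (rule someI[of "\<lambda>k'. disc_cover U A k' \<and> k' 0 = inv_into V \<phi> (\<phi> (k 0))"])
  then have k': "disc_cover U A k'" "k' 0 = k 0" using inv by auto
  have "cmod (deriv (\<phi> \<circ> k) 0) = cmod (deriv (\<phi> \<circ> k') 0)"
    by (rule antisym; rule disc_cover_deriv_le) (use k k' V in auto)
  then show ?thesis unfolding disc_density_def k'_def by simp
qed

text \<open>Recentring \<open>k\<close> at \<open>z\<close> multiplies its derivative by 1 - |z|^2,
  the derivative of the Moebius transformation at 0.\<close>

lemma disc_density_eq:
  assumes k: "disc_cover U A k" and z: "z \<in> ball 0 1" and V: "(V, \<phi>) \<in> A" "k z \<in> V"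
  shows "disc_density U A (V, \<phi>) (\<phi> (k z)) = 2 / (cmod (deriv (\<phi> \<circ> k) z) * (1 - (cmod z)\<^sup>2))"
proof -
  have z1: "cmod z < 1" using z by simp
  let ?M = "Moebius_function 0 (- z)"
  note M = Moebius_props[OF z1]
  have k': "disc_cover U A (k \<circ> ?M)" by (rule disc_cover_Moebius[OF k z1])
  have d: "((\<phi> \<circ> k) has_field_derivative deriv (\<phi> \<circ> k) (?M 0)) (at (?M 0))"
    by (rule holomorphic_derivI[OF holo_chart[OF disc_coverD(1)[OF k] V(1)]]) (use V(2) z M(3) in simp)
  have dM: "(?M has_field_derivative deriv ?M 0) (at 0)" by (rule holomorphic_derivI[OF M(1) open_ball]) simp
  have "deriv (\<phi> \<circ> (k \<circ> ?M)) 0 = deriv (\<phi> \<circ> k) z * of_real (1 - (cmod z)\<^sup>2)"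
    using DERIV_imp_deriv[OF DERIV_chain[OF d dM]] M(3,4) by (simp add: o_assoc)
  moreover have "cmod (complex_of_real (1 - (cmod z)\<^sup>2)) = 1 - (cmod z)\<^sup>2"
    unfolding norm_of_real using disc_norm_sq[OF z] by simp
  ultimately show ?thesis
    using disc_density_at_0[OF k' V(1)] V(2) M(3) by (simp add: norm_mult del: of_real_diff)
qed

text \<open>\<open>disc_density\<close> chooses a new covering for every \<zeta>. Near a given point
  a single covering and its local inverse \<open>s\<close> describe the density as a pullback, from
  which smoothness and curvature can be read off.\<close>

lemma disc_density_local:
  assumes V: "(V, \<phi>) \<in> A" and \<zeta>: "\<zeta> \<in> \<phi> ` V"
  obtains N s where "open N" "\<zeta> \<in> N" "s holomorphic_on N" "s ` N \<subseteq> ball 0 1" "\<And>w. w \<in> N \<Longrightarrow> deriv s w \<noteq> 0"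
    "\<And>w. w \<in> N \<Longrightarrow> disc_density U A (V, \<phi>) w = 2 * cmod (deriv s w) / (1 - (cmod (s w))\<^sup>2)"
proof -
  obtain x where x: "x \<in> V" "\<zeta> = \<phi> x" using \<zeta> by blast
  obtain k where k: "disc_cover U A k" "k 0 = x"
    using hyperbolic_surface_disc_cover[OF hyp] chart_subset[OF V] x by blast
  have "(0::complex) \<in> ball 0 1" "k 0 \<in> V" using k x by auto
  from local_inverse[OF disc_coverD(1,2)[OF k(1)] V this]
  obtain M s where M: "open M" "0 \<in> M" "M \<subseteq> ball 0 1 \<inter> k -` V" "open ((\<phi> \<circ> k) ` M)" "s holomorphic_on (\<phi> \<circ> k) ` M"
    "\<And>w. w \<in> M \<Longrightarrow> s (\<phi> (k w)) = w" "\<And>w. w \<in> M \<Longrightarrow> deriv (\<phi> \<circ> k) w * deriv s (\<phi> (k w)) = 1" by metis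
  show ?thesis
  proof (rule that[OF M(4) _ M(5)])
    show "\<zeta> \<in> (\<phi> \<circ> k) ` M" using M(2) k x by force
    show "s ` (\<phi> \<circ> k) ` M \<subseteq> ball 0 1" using M(3,6) by force
    fix v assume "v \<in> (\<phi> \<circ> k) ` M"
    then obtain w where w: "w \<in> M" "v = \<phi> (k w)" by auto
    show "deriv s v \<noteq> 0" using M(7)[OF w(1)] w(2) by auto
    have "cmod (deriv (\<phi> \<circ> k) w) * cmod (deriv s v) = 1" using M(7)[OF w(1)] w(2) by (metis norm_mult norm_one)
    moreover have "deriv (\<phi> \<circ> k) w \<noteq> 0" using M(7)[OF w(1)] by auto
    ultimately have "cmod (deriv s v) = 1 / cmod (deriv (\<phi> \<circ> k) w)" by (simp add: eq_divide_eq mult.commute)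
    moreover have "w \<in> ball 0 1" "k w \<in> V" using w(1) M(3) by blast+
    ultimately show "disc_density U A (V, \<phi>) v = 2 * cmod (deriv s v) / (1 - (cmod (s v))\<^sup>2)"
      using disc_density_eq[OF k(1) _ V] M(6)[OF w(1)] w(2) by (simp add: field_simps)
  qed
qed

lemma disc_density_conformal: "conformal_metric A (disc_density U A)"
  unfolding conformal_metric_def
proof (intro conjI)
  show "\<forall>(V, \<phi>)\<in>A. (\<forall>z\<in>\<phi> ` V. disc_density U A (V, \<phi>) z > 0) \<and> (\<forall>k. Ck_on k (\<phi> ` V) (disc_density U A (V, \<phi>)))"
  proof (rule ballI, clarify, intro conjI ballI allI)
    fix V \<phi> assume V: "(V, \<phi>) \<in> A"
    show "0 < disc_density U A (V, \<phi>) z" if z: "z \<in> \<phi> ` V" for z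
    proof -
      obtain N s where N: "open N" "z \<in> N" "s holomorphic_on N" "s ` N \<subseteq> ball 0 1" "\<And>w. w \<in> N \<Longrightarrow> deriv s w \<noteq> 0"
        "\<And>w. w \<in> N \<Longrightarrow> disc_density U A (V, \<phi>) w = 2 * cmod (deriv s w) / (1 - (cmod (s w))\<^sup>2)"
        using disc_density_local[OF V z] by metis
      show ?thesis unfolding N(6)[OF N(2)] by (rule disc_metric_pullback(2)[OF N(1,3,4,5,2)])
    qed
    show "Ck_on k (\<phi> ` V) (disc_density U A (V, \<phi>))" for k
    proof (rule Ck_on_local)
      fix z assume z: "z \<in> \<phi> ` V"
      obtain N s where N: "open N" "z \<in> N" "s holomorphic_on N" "s ` N \<subseteq> ball 0 1" "\<And>w. w \<in> N \<Longrightarrow> deriv s w \<noteq> 0"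
        "\<And>w. w \<in> N \<Longrightarrow> disc_density U A (V, \<phi>) w = 2 * cmod (deriv s w) / (1 - (cmod (s w))\<^sup>2)"
        using disc_density_local[OF V z] by metis
      have "Ck_on k N (disc_density U A (V, \<phi>))"
        by (rule Ck_on_cong[OF N(1) _ disc_metric_pullback(1)[OF N(1,3,4,5)]]) (simp_all add: N(6))
      then show "\<exists>N. open N \<and> z \<in> N \<and> Ck_on k N (disc_density U A (V, \<phi>))" using N(1,2) by blast
    qed
  qed
  show "\<forall>(V, \<phi>)\<in>A. \<forall>(V', \<psi>)\<in>A. \<forall>p\<in>V \<inter> V'.
      disc_density U A (V, \<phi>) (\<phi> p) = disc_density U A (V', \<psi>) (\<psi> p) * cmod (deriv (\<psi> \<circ> inv_into V \<phi>) (\<phi> p))"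
  proof (rule ballI, clarify)
    fix V \<phi> V' \<psi> p assume V: "(V, \<phi>) \<in> A" "(V', \<psi>) \<in> A" and p: "p \<in> V" "p \<in> V'"
    obtain k where k: "disc_cover U A k" "k 0 = p"
      using hyperbolic_surface_disc_cover[OF hyp] chart_subset[OF V(1)] p by blast
    have z: "(0::complex) \<in> ball 0 1" by simp
    have kV: "k 0 \<in> V" "k 0 \<in> V'" using k p by auto
    have ch: "deriv (\<psi> \<circ> k) 0 = deriv (\<psi> \<circ> inv_into V \<phi>) (\<phi> (k 0)) * deriv (\<phi> \<circ> k) 0"
      by (rule chart_change[OF disc_coverD(1)[OF k(1)] V z kV])
    obtain M where "0 \<in> M" "\<And>w. w \<in> M \<Longrightarrow> deriv (\<psi> \<circ> k) w \<noteq> 0"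
      using local_inverse[OF disc_coverD(1,2)[OF k(1)] V(2) z kV(2)] by metis
    then have "deriv (\<psi> \<circ> k) 0 \<noteq> 0" by blast
    then show "disc_density U A (V, \<phi>) (\<phi> p) = disc_density U A (V', \<psi>) (\<psi> p) * cmod (deriv (\<psi> \<circ> inv_into V \<phi>) (\<phi> p))"
      unfolding k(2)[symmetric] disc_density_at_0[OF k(1) V(1) kV(1)] disc_density_at_0[OF k(1) V(2) kV(2)] ch
      by (auto simp: norm_mult)
  qed
qed

lemma disc_density_poincare: "poincare_metric U A (disc_density U A)"
  unfolding poincare_metric_def
proof (intro conjI allI impI disc_density_conformal)
  fix k and z :: complex assume k: "disc_cover U A k" and z: "z \<in> ball 0 1"
  obtain V \<phi> where V: "(V, \<phi>) \<in> A" "k z \<in> V" using ex_chart[OF disc_coverD(3)[OF k z]] by metis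
  obtain M where "z \<in> M" "\<And>w. w \<in> M \<Longrightarrow> deriv (\<phi> \<circ> k) w \<noteq> 0"
    using local_inverse[OF disc_coverD(1,2)[OF k] V(1) z V(2)] by metis
  then have "deriv (\<phi> \<circ> k) z \<noteq> 0" by blast
  then show "pull A (disc_density U A) k z = 2 / (1 - (cmod z)\<^sup>2)"
    unfolding pull_eq[OF disc_density_conformal disc_coverD(1)[OF k] V(1) z V(2)] disc_density_eq[OF k z V]
    by simp
qed

text \<open>In a covering centred at a late term, all later terms have preimages in one compact
  disc, so a subsequence converges in \<open>U\<close>. For every late term the limit again has a
  preimage in such a disc, and this bounds its distance from that term.\<close>

lemma poincare_metric_complete:
  assumes \<rho>: "poincare_metric U A \<rho>"
  shows "complete_metric U A \<rho>"
  unfolding complete_metric_def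
proof (intro allI impI, elim conjE)
  fix x :: "nat \<Rightarrow> 'a"
  assume xU: "range x \<subseteq> U" and cauchy: "\<forall>e>0. \<exists>N. \<forall>m\<ge>N. \<forall>n\<ge>N. metric_dist U A \<rho> (x m) (x n) < e"
  have "\<exists>k. disc_cover U A k \<and> k 0 = x m" for m
    using hyperbolic_surface_disc_cover[OF hyp, of "x m"] xU by blast
  then obtain k where k: "\<And>m. disc_cover U A (k m)" "\<And>m. k m 0 = x m" by metis
  \<comment> \<open>The Euclidean radius that \<open>poincare_metric_near\<close> assigns to the
    distance \<open>e\<close>.\<close>
  define q where "q e = sqrt (1 - exp (- e))" for e :: real
  have q: "0 \<le> q e" "q e < 1" "(q e)\<^sup>2 = 1 - exp (- e)" if "0 < e" for e using that by (auto simp: q_def)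
  have N: "\<exists>N. \<forall>m\<ge>N. \<forall>n\<ge>N. \<exists>\<eta>\<in>cball 0 (q e). k m \<eta> = x n" if e: "0 < e" for e
  proof -
    have "0 < ennreal e" using e by simp
    then obtain N where N: "\<And>m n. N \<le> m \<Longrightarrow> N \<le> n \<Longrightarrow> metric_dist U A \<rho> (x m) (x n) < ennreal e" using cauchy by metis
    have "\<exists>\<eta>\<in>cball 0 (q e). k m \<eta> = x n" if mn: "N \<le> m" "N \<le> n" for m n
    proof -
      have "metric_dist U A \<rho> (k m 0) (x n) < ennreal e" using N[OF mn] k by simp
      then obtain \<eta> where \<eta>: "\<eta> \<in> ball 0 1" "k m \<eta> = x n" "(cmod \<eta>)\<^sup>2 < 1 - exp (- e)"
        by (rule poincare_metric_near[OF \<rho> k(1)])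
      have "cmod \<eta> \<le> q e" unfolding q_def by (rule real_le_rsqrt) (use \<eta>(3) in simp)
      then show ?thesis using \<eta>(2) by (intro bexI[of _ \<eta>]) auto
    qed
    then show ?thesis by blast
  qed
  have cont: "(\<lambda>n. k m (\<eta> n)) \<longlonglongrightarrow> k m \<eta>'" if "\<eta> \<longlonglongrightarrow> \<eta>'" "\<eta>' \<in> ball 0 1" for m \<eta> \<eta>'
  proof -
    have "isCont (k m) \<eta>'" using disc_coverD(4)[OF k(1)] that(2) by (simp add: continuous_on_eq_continuous_at)
    then show ?thesis using that(1) by (rule isCont_tendsto_compose)
  qed
  \<comment> \<open>No triangle inequality is needed: the subsequence that converges in one covering has, in the
    covering centred at \<open>x m\<close>, a further subsequence of nearby preimages.\<close>
  have sub: "\<exists>\<tau>. strict_mono \<tau> \<and> (\<exists>\<eta>'\<in>cball 0 (q e). (\<lambda>j. x (\<sigma> (\<tau> j))) \<longlonglongrightarrow> k m \<eta>')"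
    if e: "0 < e" and \<sigma>: "\<And>j. \<exists>\<eta>\<in>cball 0 (q e). k m \<eta> = x (\<sigma> j)" for e m and \<sigma> :: "nat \<Rightarrow> nat"
  proof -
    obtain \<eta> where \<eta>: "\<And>j. \<eta> j \<in> cball 0 (q e)" "\<And>j. k m (\<eta> j) = x (\<sigma> j)" using \<sigma> by metis
    obtain \<eta>' \<tau> where \<tau>: "\<eta>' \<in> cball 0 (q e)" "strict_mono \<tau>" "(\<eta> \<circ> \<tau>) \<longlonglongrightarrow> \<eta>'"
      using compact_imp_seq_compact[OF compact_cball] \<eta>(1) unfolding seq_compact_def by metis
    have "\<eta>' \<in> ball 0 1" using \<tau>(1) q(2)[OF e] by auto
    from cont[OF \<tau>(3) this, of m] have "(\<lambda>j. x (\<sigma> (\<tau> j))) \<longlonglongrightarrow> k m \<eta>'" by (simp add: \<eta>(2))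
    then show ?thesis using \<tau> by blast
  qed
  obtain N1 where N1: "\<And>m n. N1 \<le> m \<Longrightarrow> N1 \<le> n \<Longrightarrow> \<exists>\<eta>\<in>cball 0 (q 1). k m \<eta> = x n" using N[of 1] by auto
  obtain \<tau> \<eta>1 where \<tau>: "strict_mono \<tau>" "\<eta>1 \<in> cball 0 (q 1)" "(\<lambda>j. x (\<tau> j + N1)) \<longlonglongrightarrow> k N1 \<eta>1"
    using sub[of 1 N1 "\<lambda>j. j + N1"] N1 by auto
  define l where "l = k N1 \<eta>1"
  define \<sigma> where "\<sigma> j = \<tau> j + N1" for j
  have \<sigma>: "strict_mono \<sigma>" "(\<lambda>j. x (\<sigma> j)) \<longlonglongrightarrow> l" using \<tau> by (auto simp: \<sigma>_def l_def strict_mono_def)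
  have lU: "l \<in> U" unfolding l_def by (rule disc_coverD(3)[OF k(1)]) (use \<tau>(2) q(2)[of 1] in auto)
  have bound: "metric_dist U A \<rho> (x m) l \<le> ennreal (2 * q e / (1 - (q e)\<^sup>2))"
    if e: "0 < e" and Ne: "\<forall>m\<ge>N. \<forall>n\<ge>N. \<exists>\<eta>\<in>cball 0 (q e). k m \<eta> = x n" and m: "N \<le> m" for e N m
  proof -
    have "N \<le> \<sigma> (j + N)" for j using seq_suble[OF \<sigma>(1), of "j + N"] by linarith
    then obtain \<tau>' \<eta>' where \<tau>': "strict_mono \<tau>'" "\<eta>' \<in> cball 0 (q e)" "(\<lambda>j. x (\<sigma> (\<tau>' j + N))) \<longlonglongrightarrow> k m \<eta>'"
      using sub[OF e, of m "\<lambda>j. \<sigma> (j + N)"] Ne m by metis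
    have "strict_mono (\<lambda>j. \<tau>' j + N)" using \<tau>'(1) by (simp add: strict_mono_def)
    from LIMSEQ_subseq_LIMSEQ[OF \<sigma>(2) this] have "(\<lambda>j. x (\<sigma> (\<tau>' j + N))) \<longlonglongrightarrow> l" by (simp add: o_def)
    then have "l = k m \<eta>'" using \<tau>'(3) by (rule LIMSEQ_unique)
    then show ?thesis using poincare_metric_far[OF \<rho> k(1), of \<eta>' "q e" m] \<tau>'(2) q(2)[OF e] k(2) by simp
  qed
  have "(\<lambda>n. metric_dist U A \<rho> (x n) l) \<longlonglongrightarrow> 0"
  proof (rule order_tendstoI)
    fix a :: ennreal assume a: "0 < a"
    obtain \<epsilon> where \<epsilon>: "0 < \<epsilon>" "ennreal \<epsilon> \<le> a"
      using a by (cases a) (auto intro: that[of 1])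
    \<comment> \<open>The bound of \<open>poincare_metric_far\<close> at the radius
      \<open>q e\<close>, where \<open>1 - (q e)\<^sup>2 = exp (- e)\<close>, tends to 0 with
      \<open>e\<close>.\<close>
    have "((\<lambda>e. 2 * sqrt (1 - exp (- e)) / exp (- e)) \<longlongrightarrow> 2 * sqrt (1 - exp (- 0)) / exp (- 0)) (at_right (0::real))"
      by (intro tendsto_intros) auto
    then have "eventually (\<lambda>e. 2 * sqrt (1 - exp (- e)) / exp (- e) < \<epsilon>) (at_right 0)"
      using order_tendstoD(2)[of _ _ "at_right (0::real)" \<epsilon>] \<epsilon>(1) by simp
    then have "eventually (\<lambda>e. 2 * sqrt (1 - exp (- e)) / exp (- e) < \<epsilon> \<and> 0 < e) (at_right (0::real))"
      using eventually_at_right_less[of 0] by eventually_elim simp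
    then obtain e :: real where e: "2 * sqrt (1 - exp (- e)) / exp (- e) < \<epsilon>" "0 < e"
      using eventually_happens[of _ "at_right (0::real)"] by force
    obtain N where Ne: "\<forall>m\<ge>N. \<forall>n\<ge>N. \<exists>\<eta>\<in>cball 0 (q e). k m \<eta> = x n" using N[OF e(2)] by blast
    have "2 * q e / (1 - (q e)\<^sup>2) < \<epsilon>" using e(1) q(3)[OF e(2)] by (simp add: q_def)
    then have "ennreal (2 * q e / (1 - (q e)\<^sup>2)) < ennreal \<epsilon>" by (rule ennreal_lessI[OF \<epsilon>(1)])
    then have "metric_dist U A \<rho> (x m) l < a" if "N \<le> m" for m
      using bound[OF e(2) Ne that] \<epsilon>(2) by (meson le_less_trans less_le_trans)
    then show "\<forall>\<^sub>F n in sequentially. metric_dist U A \<rho> (x n) l < a" by (rule eventually_sequentiallyI)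
  qed simp
  then show "\<exists>l\<in>U. (\<lambda>n. metric_dist U A \<rho> (x n) l) \<longlonglongrightarrow> 0" using lU by blast
qed

theorem hyperbolic_metric_exists: "is_hyperbolic_metric U A (disc_density U A)"
  unfolding is_hyperbolic_metric_def
proof (intro conjI disc_density_conformal poincare_metric_complete disc_density_poincare)
  show "\<forall>(V, \<phi>)\<in>A. \<forall>z\<in>\<phi> ` V. gauss_curvature (disc_density U A (V, \<phi>)) z = -1"
  proof (rule ballI, clarify)
    fix V \<phi> x assume V: "(V, \<phi>) \<in> A" and x: "x \<in> V"
    have z: "\<phi> x \<in> \<phi> ` V" using x by blast
    obtain N s where N: "open N" "\<phi> x \<in> N" "s holomorphic_on N" "s ` N \<subseteq> ball 0 1" "\<And>w. w \<in> N \<Longrightarrow> deriv s w \<noteq> 0"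
        "\<And>w. w \<in> N \<Longrightarrow> disc_density U A (V, \<phi>) w = 2 * cmod (deriv s w) / (1 - (cmod (s w))\<^sup>2)"
      using disc_density_local[OF V z] by metis
    have "gauss_curvature (disc_density U A (V, \<phi>)) (\<phi> x) =
        gauss_curvature (\<lambda>w. 2 * cmod (deriv s w) / (1 - (cmod (s w))\<^sup>2)) (\<phi> x)"
      by (rule gauss_curvature_cong[OF N(1,2,6)])
    then show "gauss_curvature (disc_density U A (V, \<phi>)) (\<phi> x) = -1"
      using disc_metric_pullback(3)[OF N(1,3,4,5,2)] by simp
  qed
qed

end

section \<open>Curvature and completeness determine the pulled back density\<close>

section \<open>Uniqueness of the hyperbolic metric\<close>

lemma liouville_cong:
  assumes S: "open S" and eq: "\<And>z. z \<in> S \<Longrightarrow> u z = v z" and L: "liouville S u a b"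
  shows "liouville S v a b"
  unfolding liouville_def
proof
  fix z assume z: "z \<in> S"
  have "(u has_derivative (\<lambda>h. 2 * Re (a z * h))) (at z)" using L z unfolding liouville_def by blast
  then have "(v has_derivative (\<lambda>h. 2 * Re (a z * h))) (at z)"
    by (rule has_derivative_transform_within_open[OF _ S z eq])
  then show "(v has_derivative (\<lambda>h. 2 * Re (a z * h))) (at z) \<and>
     (a has_derivative (\<lambda>h. b z * h + of_real (exp (2 * v z)) / 4 * cnj h)) (at z) \<and>
     (\<exists>c. (b has_derivative (\<lambda>h. c * h + of_real (exp (2 * v z)) * a z / 2 * cnj h)) (at z))"
    using L z unfolding liouville_def eq[OF z, symmetric] by blast
qed

lemma is_hyperbolic_metricD:
  assumes "is_hyperbolic_metric U A \<rho>"
  shows "conformal_metric A \<rho>" "complete_metric U A \<rho>"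
    "(V, \<phi>) \<in> A \<Longrightarrow> z \<in> \<phi> ` V \<Longrightarrow> gauss_curvature (\<rho> (V, \<phi>)) z = -1"
proof -
  show "conformal_metric A \<rho>" "complete_metric U A \<rho>" using assms unfolding is_hyperbolic_metric_def by blast+
  have *: "\<forall>(V, \<phi>)\<in>A. \<forall>z\<in>\<phi> ` V. gauss_curvature (\<rho> (V, \<phi>)) z = -1"
    using assms unfolding is_hyperbolic_metric_def by (elim conjE)
  assume V: "(V, \<phi>) \<in> A" and z: "z \<in> \<phi> ` V"
  from bspec[OF * V] have "\<forall>z\<in>\<phi> ` V. gauss_curvature (\<rho> (V, \<phi>)) z = -1" by simp
  then show "gauss_curvature (\<rho> (V, \<phi>)) z = -1" using z by (rule bspec)
qed

text \<open>The local inverse in the two forms used later: a section on a full ball around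
  \<open>F e\<close>, and a neighbourhood of \<open>e\<close> on which it is a left inverse and
  \<open>F\<close> is injective.\<close>

lemma locally_injective_local_section:
  assumes F: "F holomorphic_on S" "open S" and e: "e \<in> S" "deriv F e \<noteq> 0"
  obtains d s N where "0 < d" "continuous_on (ball (F e) d) s" "s ` ball (F e) d \<subseteq> S"
    "\<And>z. z \<in> ball (F e) d \<Longrightarrow> F (s z) = z" "open N" "N \<subseteq> S" "e \<in> N" "\<And>e'. e' \<in> N \<Longrightarrow> s (F e') = e'" "inj_on F N"
proof -
  obtain r where r: "0 < r" "ball e r \<subseteq> S" "inj_on F (ball e r)"
    using has_complex_derivative_locally_injective[OF F(1) e(1) F(2) e(2)] by blast
  have hol: "F holomorphic_on ball e r" using F(1) r(2) by (rule holomorphic_on_subset)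
  obtain s where s: "s holomorphic_on F ` ball e r" "\<And>z. z \<in> ball e r \<Longrightarrow> s (F z) = z"
    using holomorphic_has_inverse[OF hol open_ball r(3)] by metis
  have "open (F ` ball e r)" by (rule open_mapping_thm3[OF hol open_ball r(3)])
  moreover have "F e \<in> F ` ball e r" using r(1) by simp
  ultimately obtain d where d: "0 < d" "ball (F e) d \<subseteq> F ` ball e r" by (meson openE)
  show ?thesis
  proof (rule that[OF d(1) _ _ _ open_ball r(2) _ s(2) r(3)])
    show "continuous_on (ball (F e) d) s"
      using holomorphic_on_imp_continuous_on[OF s(1)] d(2) by (rule continuous_on_subset)
    show "s ` ball (F e) d \<subseteq> S"
    proof
      fix y assume "y \<in> s ` ball (F e) d"
      then obtain w where w: "w \<in> ball (F e) d" "y = s w" by blast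
      then obtain z where z: "z \<in> ball e r" "w = F z" using d(2) by blast
      then show "y \<in> S" using s(2)[OF z(1)] w(2) r(2) by auto
    qed
    show "F (s z) = z" if "z \<in> ball (F e) d" for z
    proof -
      obtain y where "y \<in> ball e r" "z = F y" using d(2) \<open>z \<in> ball (F e) d\<close> by blast
      then show ?thesis using s(2) by simp
    qed
  qed (use r(1) in simp)
qed

context surface
begin

lemma pull_positive:
  assumes \<rho>: "conformal_metric A \<rho>" and k: "disc_cover U A k" and z: "z \<in> ball 0 1"
  shows "0 < pull A \<rho> k z"
proof -
  obtain V \<phi> where V: "(V, \<phi>) \<in> A" "k z \<in> V" using ex_chart[OF disc_coverD(3)[OF k z]] by metis
  obtain M where "z \<in> M" "\<And>w. w \<in> M \<Longrightarrow> deriv (\<phi> \<circ> k) w \<noteq> 0"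
    using local_inverse[OF disc_coverD(1,2)[OF k] V(1) z V(2)] by metis
  then have "deriv (\<phi> \<circ> k) z \<noteq> 0" by blast
  moreover have "0 < \<rho> (V, \<phi>) (\<phi> (k z))" using conformal_metricD(1)[OF \<rho> V(1)] V(2) by simp
  ultimately show ?thesis unfolding pull_eq[OF \<rho> disc_coverD(1)[OF k] V(1) z V(2)] by simp
qed

text \<open>In a chart, curvature -1 is Liouville's equation for the logarithm of the density.
  Pulling it back by the chart expression of \<open>k\<close> gives the claim locally, and
  \<open>liouville_local\<close> makes it global.\<close>

lemma hyperbolic_metric_liouville:
  assumes \<rho>: "is_hyperbolic_metric U A \<rho>" and k: "disc_cover U A k"
  obtains a b where "liouville (ball 0 1) (\<lambda>z. ln (pull A \<rho> k z)) a b"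
proof -
  note cm = is_hyperbolic_metricD(1)[OF \<rho>]
  have "\<exists>N a b. open N \<and> z \<in> N \<and> liouville N (\<lambda>z. ln (pull A \<rho> k z)) a b" if z: "z \<in> ball 0 1" for z
  proof -
    obtain V \<phi> where V: "(V, \<phi>) \<in> A" "k z \<in> V" using ex_chart[OF disc_coverD(3)[OF k z]] by metis
    let ?r = "\<rho> (V, \<phi>)"
    have op: "open (\<phi> ` V)" by (rule chart_open_image[OF V(1)])
    have pos: "0 < ?r w" if "w \<in> \<phi> ` V" for w using conformal_metricD(1)[OF cm V(1) that] .
    have C: "Ck_on 3 (\<phi> ` V) (\<lambda>w. ln (?r w))"
      by (rule Ck_on_ln[OF op conformal_metricD(2)[OF cm V(1)] pos])
    have lap: "laplacian (\<lambda>w. ln (?r w)) w = exp (2 * ln (?r w))" if w: "w \<in> \<phi> ` V" for w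
    proof -
      have "exp (2 * ln (?r w)) = (?r w)\<^sup>2" using pos[OF w] by (simp add: exp_double)
      then show ?thesis using is_hyperbolic_metricD(3)[OF \<rho> V(1) w] pos[OF w]
        by (simp add: gauss_curvature_def field_simps)
    qed
    obtain a b where L: "liouville (\<phi> ` V) (\<lambda>w. ln (?r w)) a b"
      using liouville_if_laplacian[OF op C lap] by blast
    obtain M where M: "open M" "z \<in> M" "M \<subseteq> ball 0 1 \<inter> k -` V" "\<And>w. w \<in> M \<Longrightarrow> deriv (\<phi> \<circ> k) w \<noteq> 0"
      using local_inverse[OF disc_coverD(1,2)[OF k] V(1) z V(2)] by metis
    have hol: "(\<phi> \<circ> k) holomorphic_on M"
      using holo_chart(1)[OF disc_coverD(1)[OF k] V(1)] M(3) by (rule holomorphic_on_subset)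
    have "(\<phi> \<circ> k) ` M \<subseteq> \<phi> ` V" using M(3) by auto
    then obtain a' b' where L': "liouville M (\<lambda>z. ln (?r ((\<phi> \<circ> k) z)) + ln (cmod (deriv (\<phi> \<circ> k) z))) a' b'"
      using liouville_pullback[OF op M(1) L hol _ M(4)] by metis
    have "liouville M (\<lambda>z. ln (pull A \<rho> k z)) a' b'"
    proof (rule liouville_cong[OF M(1) _ L'])
      fix w assume w: "w \<in> M"
      have "w \<in> ball 0 1" "k w \<in> V" using w M(3) by blast+
      then show "ln (?r ((\<phi> \<circ> k) w)) + ln (cmod (deriv (\<phi> \<circ> k) w)) = ln (pull A \<rho> k w)"
        using pull_eq[OF cm disc_coverD(1)[OF k] V(1), of w] pos[of "\<phi> (k w)"] M(4)[OF w] by (simp add: ln_mult)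
    qed
    then show ?thesis using M(1,2) by blast
  qed
  then show ?thesis using liouville_local[of "ball 0 1"] that by metis
qed

lemma hyperbolic_metric_developing_map:
  assumes \<rho>: "is_hyperbolic_metric U A \<rho>" and k: "disc_cover U A k"
  obtains F where "F holomorphic_on ball 0 1" "F ` ball 0 1 \<subseteq> ball 0 1" "F 0 = 0"
    "\<And>z. z \<in> ball 0 1 \<Longrightarrow> deriv F z \<noteq> 0"
    "\<And>z. z \<in> ball 0 1 \<Longrightarrow> pull A \<rho> k z = 2 * cmod (deriv F z) / (1 - (cmod (F z))\<^sup>2)"
proof -
  obtain a b where L: "liouville (ball 0 1) (\<lambda>z. ln (pull A \<rho> k z)) a b"
    using hyperbolic_metric_liouville[OF \<rho> k] .
  obtain F where F: "F holomorphic_on ball 0 1" "F ` ball 0 1 \<subseteq> ball 0 1" "F 0 = 0"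
    "\<And>z. z \<in> ball 0 1 \<Longrightarrow> deriv F z \<noteq> 0"
    "\<And>z. z \<in> ball 0 1 \<Longrightarrow> exp (ln (pull A \<rho> k z)) * (1 - (cmod (F z))\<^sup>2) = 2 * cmod (deriv F z)"
    by (rule liouville_developing_map[OF L], rule that) (assumption | blast)+
  have "pull A \<rho> k z = 2 * cmod (deriv F z) / (1 - (cmod (F z))\<^sup>2)" if z: "z \<in> ball 0 1" for z
  proof -
    have "F z \<in> ball 0 1" using F(2) z by blast
    then have "(cmod (F z))\<^sup>2 < 1" by (rule disc_norm_sq)
    then show ?thesis using F(5)[OF z] pull_positive[OF is_hyperbolic_metricD(1)[OF \<rho>] k z]
      by (simp add: field_simps)
  qed
  then show ?thesis using that F(1-4) by blast
qed

end

context hyp_surface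
begin

text \<open>Completeness speaks of the distance, whereas lifting requires limits in the topology of
  \<open>U\<close>. At this stage the metric is known only through \<open>F\<close>: a short path to
  \<open>l\<close> lifts to a path ending at 0 on which |F| stays small, and a local section of
  \<open>F\<close> then confines the lift.\<close>

lemma hyperbolic_metric_convergence:
  assumes \<rho>: "is_hyperbolic_metric U A \<rho>" and l: "l \<in> U"
    and lim: "(\<lambda>n. metric_dist U A \<rho> (x n) l) \<longlonglongrightarrow> 0"
  shows "x \<longlonglongrightarrow> l"
proof (rule topological_tendstoI)
  note cm = is_hyperbolic_metricD(1)[OF \<rho>]
  fix Q assume Q: "open Q" "l \<in> Q"
  obtain k where k: "disc_cover U A k" "k 0 = l" using hyperbolic_surface_disc_cover[OF hyp l] .
  obtain F where F: "F holomorphic_on ball 0 1" "F ` ball 0 1 \<subseteq> ball 0 1" "F 0 = 0"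
    "\<And>z. z \<in> ball 0 1 \<Longrightarrow> deriv F z \<noteq> 0"
    "\<And>z. z \<in> ball 0 1 \<Longrightarrow> pull A \<rho> k z = 2 * cmod (deriv F z) / (1 - (cmod (F z))\<^sup>2)"
    using hyperbolic_metric_developing_map[OF \<rho> k(1)] by metis
  have z0: "(0::complex) \<in> ball 0 1" by simp
  obtain d s N where s: "0 < d" "continuous_on (ball 0 d) s" "s ` ball 0 d \<subseteq> ball 0 1"
    "\<And>z. z \<in> ball 0 d \<Longrightarrow> F (s z) = z" "0 \<in> N" "\<And>e'. e' \<in> N \<Longrightarrow> s (F e') = e'"
    using locally_injective_local_section[OF F(1) open_ball z0 F(4)[OF z0]] F(3) by metis
  have s0: "s 0 = 0" using s(5,6) F(3) by metis
  have "continuous_on (ball 0 d) (\<lambda>w. k (s w))"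
    by (rule continuous_on_compose2[OF disc_coverD(4)[OF k(1)] s(2,3)])
  then have "open (ball 0 d \<inter> (\<lambda>w. k (s w)) -` Q)" using continuous_open_preimage open_ball Q(1) by blast
  moreover have "0 \<in> ball 0 d \<inter> (\<lambda>w. k (s w)) -` Q" using s(1) s0 k(2) Q(2) by simp
  ultimately obtain \<delta> where \<delta>: "0 < \<delta>" "ball 0 \<delta> \<subseteq> ball 0 d \<inter> (\<lambda>w. k (s w)) -` Q" by (meson openE)
  define \<delta>' where "\<delta>' = min \<delta> (1/2)"
  have \<delta>': "0 < \<delta>'" "\<delta>' < 1" "\<delta>' \<le> \<delta>" using \<delta> by (auto simp: \<delta>'_def)
  \<comment> \<open>The value of the potential on the circle |F| = \<delta>'. A lifted path of
    length below \<open>e\<close> that ends where F = 0 cannot reach this circle.\<close>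
  define e where "e = - ln (1 - \<delta>'\<^sup>2)"
  have \<delta>2: "0 < \<delta>'\<^sup>2" "\<delta>'\<^sup>2 < 1" using \<delta>' by (auto simp: abs_square_less_1)
  then have e: "0 < e" by (simp add: e_def)
  have "y \<in> Q" if y: "metric_dist U A \<rho> y l < ennreal e" for y
  proof -
    obtain \<gamma> where \<gamma>: "piecewise_C1_path U A \<gamma>" "pathstart \<gamma> = y" "pathfinish \<gamma> = l" "metric_length A \<rho> \<gamma> < ennreal e"
      using y unfolding metric_dist_def INF_less_iff by blast
    have \<gamma>': "continuous_on {0..1} \<gamma>" "\<gamma> ` {0..1} \<subseteq> U" "\<gamma> 0 = y" "\<gamma> 1 = l"
      using \<gamma> unfolding piecewise_C1_path_def path_def path_image_def pathstart_def pathfinish_def by simp_all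
    \<comment> \<open>Lifting starts at a prescribed preimage, here known only over the final point
      \<open>l = k 0\<close>; so the reversed path is lifted.\<close>
    have "continuous_on {0..1} (\<lambda>t. \<gamma> (1 - t))"
      by (rule continuous_on_compose2[OF \<gamma>'(1)]) (auto intro!: continuous_intros)
    moreover have "(\<lambda>t. \<gamma> (1 - t)) ` {0..1} \<subseteq> U" using \<gamma>'(2) by (auto simp: image_subset_iff)
    ultimately obtain c' where c': "continuous_on {0..1} c'" "c' ` {0..1} \<subseteq> ball 0 1" "c' 0 = 0"
        "\<And>t. t \<in> {0..1} \<Longrightarrow> k (c' t) = \<gamma> (1 - t)"
      using disc_cover_lift_path[OF k(1) _ _ z0, of "\<lambda>t. \<gamma> (1 - t)"] k(2) \<gamma>'(4) by auto
    define c where "c t = c' (1 - t)" for t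
    have c: "continuous_on {0..1} c" "c ` {0..1} \<subseteq> ball 0 1" "\<And>t. t \<in> {0..1} \<Longrightarrow> k (c t) = \<gamma> t"
    proof -
      show "continuous_on {0..1} c" unfolding c_def
        by (rule continuous_on_compose2[OF c'(1)]) (auto intro!: continuous_intros)
      show "c ` {0..1} \<subseteq> ball 0 1" using c'(2) by (auto simp: c_def image_subset_iff)
      show "k (c t) = \<gamma> t" if "t \<in> {0..1}" for t using c'(4)[of "1 - t"] that by (simp add: c_def)
    qed
    have c1: "c 1 = 0" using c'(3) by (simp add: c_def)
    have cb: "c t \<in> ball 0 1" if "t \<in> {0..1}" for t using c(2) that by blast
    let ?G = "\<lambda>z. - ln (1 - (cmod (F z))\<^sup>2)"
    have Fsmall: "F (c t) \<in> ball 0 \<delta>'" if t: "t \<in> {0..1}" for t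
    proof -
      have "ennreal \<bar>?G (c 1) - ?G (c t)\<bar> \<le> metric_length A \<rho> \<gamma>"
      proof (rule metric_length_ge[OF cm \<gamma>(1) disc_coverD(1,2)[OF k(1)] c])
        fix z h :: complex assume z: "z \<in> ball 0 1"
        then have Fz: "F z \<in> ball 0 1" using F(2) by blast
        note P = disc_potential[OF F(1) open_ball z Fz]
        show "(?G has_derivative (\<lambda>h. 2 * Re (cnj (F z) * (deriv F z * h)) / (1 - (cmod (F z))\<^sup>2))) (at z)" by (rule P(1))
        show "\<bar>2 * Re (cnj (F z) * (deriv F z * h)) / (1 - (cmod (F z))\<^sup>2)\<bar> \<le> pull A \<rho> k z * cmod h"
          unfolding F(5)[OF z] by (rule P(2))
      qed (use t in auto)
      also have "\<dots> < ennreal e" by (rule \<gamma>(4))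
      finally have "\<bar>?G (c 1) - ?G (c t)\<bar> < e" by (simp add: ennreal_less_iff)
      then have "ln (1 - \<delta>'\<^sup>2) < ln (1 - (cmod (F (c t)))\<^sup>2)" using c1 F(3) by (simp add: e_def abs_less_iff)
      moreover have "F (c t) \<in> ball 0 1" using F(2) cb[OF t] by blast
      then have "0 < 1 - (cmod (F (c t)))\<^sup>2" using disc_norm_sq by simp
      ultimately have "(cmod (F (c t)))\<^sup>2 < \<delta>'\<^sup>2" using \<delta>2 by simp
      then have "cmod (F (c t)) < \<delta>'" by (rule power2_less_imp_less) (use \<delta>' in simp)
      then show ?thesis by simp
    qed
    have Fd: "F (c t) \<in> ball 0 d" if "t \<in> {0..1}" for t
      using Fsmall[OF that] \<delta>(2) \<delta>'(3) by (auto simp: subset_iff)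
    have cF: "continuous_on {0..1} (\<lambda>t. F (c t))"
      by (rule continuous_on_compose2[OF holomorphic_on_imp_continuous_on[OF F(1)] c(1,2)])
    have "c 0 = s (F (c 0))"
    proof (rule lifts_agree[where S = "{0..1::real}" and X = "ball 0 1" and p = F and ?h1.0 = c and ?h2.0 = "\<lambda>t. s (F (c t))" and a = 1])
      show "continuous_on {0..1} (\<lambda>t. s (F (c t)))" by (rule continuous_on_compose2[OF s(2) cF]) (use Fd in blast)
      show "(\<lambda>t. s (F (c t))) ` {0..1} \<subseteq> ball 0 1" using s(3) Fd by blast
      show "F (c t) = F (s (F (c t)))" if "t \<in> {0..1}" for t using s(4)[OF Fd[OF that]] by simp
      fix z :: complex assume z: "z \<in> ball 0 1"
      obtain N where "open N" "N \<subseteq> ball 0 1" "z \<in> N" "inj_on F N"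
        using locally_injective_local_section[OF F(1) open_ball z F(4)[OF z]] by metis
      then show "\<exists>N. openin (top_of_set (ball 0 1)) N \<and> z \<in> N \<and> inj_on F N"
        by (metis Int_absorb1 openin_open_Int)
    qed (use c c1 s0 F(3) in auto)
    moreover have "F (c 0) \<in> ball 0 \<delta>" using Fsmall[of 0] \<delta>'(3) by simp
    then have "k (s (F (c 0))) \<in> Q" using \<delta>(2) by blast
    ultimately show "y \<in> Q" using c(3)[of 0] \<gamma>'(3) by simp
  qed
  moreover have "\<forall>\<^sub>F n in sequentially. metric_dist U A \<rho> (x n) l < ennreal e"
    using order_tendstoD(2)[OF lim, of "ennreal e"] e by simp
  ultimately show "\<forall>\<^sub>F n in sequentially. x n \<in> Q" by (auto elim: eventually_mono)
qed

text \<open>The Schwarz lemma bounds the derivative of \<open>F\<close> at 0 and, once a section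
  \<open>G\<close> of \<open>F\<close> exists on the whole disc, also that of \<open>G\<close>, its
  reciprocal. The work lies in \<open>ray\<close>: completeness gives the image of a ray an end
  point in \<open>U\<close>, and the path so closed lifts through \<open>k\<close>.\<close>

lemma hyperbolic_metric_pull_0:
  assumes \<rho>: "is_hyperbolic_metric U A \<rho>" and k: "disc_cover U A k"
  shows "pull A \<rho> k 0 = 2"
proof -
  note cm = is_hyperbolic_metricD(1)[OF \<rho>]
  obtain F where F: "F holomorphic_on ball 0 1" "F ` ball 0 1 \<subseteq> ball 0 1" "F 0 = 0"
    "\<And>z. z \<in> ball 0 1 \<Longrightarrow> deriv F z \<noteq> 0"
    "\<And>z. z \<in> ball 0 1 \<Longrightarrow> pull A \<rho> k z = 2 * cmod (deriv F z) / (1 - (cmod (F z))\<^sup>2)"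
    using hyperbolic_metric_developing_map[OF \<rho> k] by metis
  have derG: "(G has_field_derivative inverse (deriv F (G w))) (at w)"
    if "continuous_on (ball 0 R) G" "G ` ball 0 R \<subseteq> ball 0 1" "\<forall>z\<in>ball 0 R. F (G z) = z" "w \<in> ball 0 R" for R G w
  proof (rule has_field_derivative_inverse_basic[where t = "ball 0 R"])
    have Gw: "G w \<in> ball 0 1" using that by blast
    show "(F has_field_derivative deriv F (G w)) (at (G w))" by (rule holomorphic_derivI[OF F(1) open_ball Gw])
    show "deriv F (G w) \<noteq> 0" by (rule F(4)[OF Gw])
    show "continuous (at w) G" using that(1,4) by (simp add: continuous_on_eq_continuous_at)
  qed (use that in auto)
  have ray: "\<exists>e\<in>ball 0 1. ((\<lambda>t. G (t *\<^sub>R \<zeta>)) \<longlongrightarrow> e) (at_left 1)"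
    if R: "0 < R" "R < 1" and G: "continuous_on (ball 0 R) G" "G ` ball 0 R \<subseteq> ball 0 1" "\<forall>z\<in>ball 0 R. F (G z) = z"
      and G0: "G 0 = 0" and \<zeta>: "norm \<zeta> = R" for R G \<zeta>
  proof -
    have Gh: "G holomorphic_on ball 0 R" unfolding holomorphic_on_open[OF open_ball] using derG[OF G] by blast
    have kG: "holo_into U A (ball 0 R) (k \<circ> G)" by (rule holo_into_compose[OF disc_coverD(1)[OF k] Gh G(2) open_ball])
    \<comment> \<open>Since \<open>F\<close> undoes \<open>G\<close>, the factors |F' (G w)| and |G'
      w| cancel: in the coordinate \<open>w\<close> the metric already is the Poincare metric, hence
      bounded on \<open>ball 0 R\<close>.\<close>
    have pl: "pull A \<rho> (k \<circ> G) w = 2 / (1 - (cmod w)\<^sup>2)" if w: "w \<in> ball 0 R" for w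
    proof -
      have Gw: "G w \<in> ball 0 1" using G(2) w by blast
      have "cmod (deriv F (G w)) * cmod (inverse (deriv F (G w))) = 1" using F(4)[OF Gw] by (simp add: norm_inverse)
      moreover have "pull A \<rho> (k \<circ> G) w = pull A \<rho> k (G w) * cmod (inverse (deriv F (G w)))"
        using pull_compose[OF cm disc_coverD(1)[OF k] Gh G(2) open_ball w] DERIV_imp_deriv[OF derG[OF G w]] by simp
      moreover have "F (G w) = w" using G(3) w by blast
      ultimately show ?thesis using F(5)[OF Gw] by simp
    qed
    define x where "x t = k (G (t *\<^sub>R \<zeta>))" for t :: real
    have inb: "t *\<^sub>R \<zeta> \<in> ball 0 R" if "0 \<le> t" "t < 1" for t using that \<zeta> R by simp
    have R2: "R\<^sup>2 < 1" using R by (simp add: abs_square_less_1)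
    define C where "C = 2 / (1 - R\<^sup>2) * R"
    have C: "0 < C" using R R2 by (simp add: C_def)
    have dist: "metric_dist U A \<rho> (x s) (x t) \<le> ennreal (C * \<bar>t - s\<bar>)" if st: "0 \<le> s" "s < 1" "0 \<le> t" "t < 1" for s t
    proof -
      have "metric_dist U A \<rho> ((k \<circ> G) (s *\<^sub>R \<zeta>)) ((k \<circ> G) (t *\<^sub>R \<zeta>)) \<le> ennreal (2 / (1 - R\<^sup>2) * cmod (t *\<^sub>R \<zeta> - s *\<^sub>R \<zeta>))"
      proof (rule metric_dist_le[OF cm kG])
        show sub: "closed_segment (s *\<^sub>R \<zeta>) (t *\<^sub>R \<zeta>) \<subseteq> ball 0 R"
          by (rule closed_segment_subset) (use inb st in auto)
        fix z assume "z \<in> closed_segment (s *\<^sub>R \<zeta>) (t *\<^sub>R \<zeta>)"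
        then have z: "z \<in> ball 0 R" using sub by blast
        then have "(cmod z)\<^sup>2 \<le> R\<^sup>2" by (intro power_mono) auto
        then show "pull A \<rho> (k \<circ> G) z \<le> 2 / (1 - R\<^sup>2)" unfolding pl[OF z] using R2 by (intro divide_left_mono) auto
      qed
      moreover have "cmod (t *\<^sub>R \<zeta> - s *\<^sub>R \<zeta>) = \<bar>t - s\<bar> * R"
        unfolding scaleR_left_diff_distrib[symmetric] norm_scaleR \<zeta> ..
      ultimately show ?thesis by (simp add: x_def C_def mult_ac)
    qed
    have conv: "\<exists>l\<in>U. (\<lambda>n. x (f n)) \<longlonglongrightarrow> l" if f: "\<And>n. 0 \<le> f n" "\<And>n. f n < 1" "f \<longlonglongrightarrow> 1" for f :: "nat \<Rightarrow> real"
    proof -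
      have "\<exists>N. \<forall>m\<ge>N. \<forall>n\<ge>N. metric_dist U A \<rho> (x (f m)) (x (f n)) < e" if e: "0 < e" for e
      proof -
        obtain \<epsilon> where \<epsilon>: "0 < \<epsilon>" "ennreal \<epsilon> \<le> e" using e by (cases e) (auto intro: that[of 1])
        have "Cauchy f" using f(3) by (rule LIMSEQ_imp_Cauchy)
        then obtain N where N: "\<And>m n. N \<le> m \<Longrightarrow> N \<le> n \<Longrightarrow> dist (f m) (f n) < \<epsilon> / C"
          using metric_CauchyD[of f "\<epsilon> / C"] \<epsilon>(1) C by (meson divide_pos_pos)
        have "metric_dist U A \<rho> (x (f m)) (x (f n)) < e" if "N \<le> m" "N \<le> n" for m n
        proof -
          have "C * \<bar>f n - f m\<bar> < \<epsilon>" using N[OF that] C by (simp add: dist_real_def abs_minus_commute field_simps)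
          then have "ennreal (C * \<bar>f n - f m\<bar>) < ennreal \<epsilon>" by (rule ennreal_lessI[OF \<epsilon>(1)])
          then show ?thesis using dist[of "f m" "f n"] f(1,2) \<epsilon>(2) by (meson le_less_trans less_le_trans)
        qed
        then show ?thesis by blast
      qed
      moreover have "range (\<lambda>n. x (f n)) \<subseteq> U"
      proof -
        have "x (f n) \<in> U" for n
          using kG inb[OF f(1,2)] unfolding holo_into_def x_def by fastforce
        then show ?thesis by blast
      qed
      ultimately obtain l where l: "l \<in> U" "(\<lambda>n. metric_dist U A \<rho> (x (f n)) l) \<longlonglongrightarrow> 0"
        using is_hyperbolic_metricD(2)[OF \<rho>] unfolding complete_metric_def by meson
      then show ?thesis using hyperbolic_metric_convergence[OF \<rho> l(1), of "\<lambda>n. x (f n)"] by blast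
    qed
    define t0 where "t0 n = 1 - 1 / real (n + 2)" for n
    have t0: "0 \<le> t0 n" "t0 n < 1" for n by (auto simp: t0_def)
    have "(\<lambda>n. 1 - 1 / real (n + 2)) \<longlonglongrightarrow> 1 - 0"
      by (intro tendsto_diff tendsto_const LIMSEQ_ignore_initial_segment[OF lim_1_over_n])
    then have t0l: "t0 \<longlonglongrightarrow> 1" unfolding t0_def by simp
    obtain l where l: "l \<in> U" "(\<lambda>n. x (t0 n)) \<longlonglongrightarrow> l" using conv[of t0] t0 t0l by blast
    have any: "(\<lambda>n. x (f n)) \<longlonglongrightarrow> l" if f: "\<And>n. 0 \<le> f n" "\<And>n. f n < 1" "f \<longlonglongrightarrow> 1" for f :: "nat \<Rightarrow> real"
    proof -
      \<comment> \<open>Completeness yields a limit for each sequence separately; interleaving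
        \<open>f\<close> with the reference sequence \<open>t0\<close> forces the limits to
        coincide.\<close>
      define h where "h n = (if even n then f (n div 2) else t0 (n div 2))" for n
      have half: "filterlim (\<lambda>n::nat. n div 2) sequentially sequentially"
        unfolding filterlim_at_top
      proof
        fix Z :: nat
        show "\<forall>\<^sub>F n in sequentially. Z \<le> n div 2" by (rule eventually_sequentiallyI[of "2 * Z"]) auto
      qed
      have "h \<longlonglongrightarrow> 1"
      proof (rule topological_tendstoI)
        fix S :: "real set" assume S: "open S" "1 \<in> S"
        have "eventually (\<lambda>n. f n \<in> S \<and> t0 n \<in> S) sequentially"
          using topological_tendstoD[OF f(3) S] topological_tendstoD[OF t0l S] by eventually_elim simp
        then have "eventually (\<lambda>n. f (n div 2) \<in> S \<and> t0 (n div 2) \<in> S) sequentially"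
          using half unfolding filterlim_iff by blast
        then show "eventually (\<lambda>n. h n \<in> S) sequentially" by eventually_elim (simp add: h_def)
      qed
      moreover have "0 \<le> h n" "h n < 1" for n using f(1,2) t0 by (simp_all add: h_def)
      ultimately obtain l' where l': "(\<lambda>n. x (h n)) \<longlonglongrightarrow> l'" using conv[of h] by blast
      have m: "strict_mono (\<lambda>n::nat. 2 * n)" "strict_mono (\<lambda>n::nat. 2 * n + 1)" by (auto simp: strict_mono_def)
      have e1: "(\<lambda>n. x (f n)) \<longlonglongrightarrow> l'" using LIMSEQ_subseq_LIMSEQ[OF l' m(1)] by (simp add: o_def h_def)
      have e2: "(\<lambda>n. x (t0 n)) \<longlonglongrightarrow> l'" using LIMSEQ_subseq_LIMSEQ[OF l' m(2)] by (simp add: o_def h_def)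
      show ?thesis using e1 LIMSEQ_unique[OF e2 l(2)] by simp
    qed
    have lim: "(x \<longlongrightarrow> l) (at_left 1)"
    proof (rule topological_tendstoI)
      fix Q assume Q: "open Q" "l \<in> Q"
      show "eventually (\<lambda>t. x t \<in> Q) (at_left 1)"
      proof (rule sequentially_imp_eventually_at_left[of 0])
        fix f :: "nat \<Rightarrow> real" assume f: "\<And>n. 0 < f n" "\<And>n. f n < 1" "f \<longlonglongrightarrow> 1"
        show "eventually (\<lambda>n. x (f n) \<in> Q) sequentially"
          using topological_tendstoD[OF any[of f] Q] f less_imp_le by blast
      qed simp
    qed
    have cGt: "continuous_on {0..<1} (\<lambda>t. G (t *\<^sub>R \<zeta>))"
      by (rule continuous_on_compose2[OF G(1)]) (use inb in \<open>auto intro!: continuous_intros\<close>)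
    have Gtb: "G (t *\<^sub>R \<zeta>) \<in> ball 0 1" if "0 \<le> t" "t < 1" for t using G(2) inb[OF that] by blast
    have cx: "continuous_on {0..<1} x" unfolding x_def
      by (rule continuous_on_compose2[OF disc_coverD(4)[OF k] cGt]) (use Gtb in auto)
    \<comment> \<open>Closing the path with its limit \<open>l\<close> makes it liftable on the
      compact interval; by uniqueness the lift is \<open>G\<close> along the ray, so its end point
      is the limit sought.\<close>
    define y where "y t = (if t < 1 then x t else l)" for t
    have yx: "y t = x t" if "t < 1" for t using that by (simp add: y_def)
    have ev1: "eventually (\<lambda>t::real. y t = x t) (at_left 1)"
      by (auto simp: eventually_at_left_field y_def intro!: exI[of _ 0])
    have cy: "continuous_on {0..1} y"
    proof (rule continuous_on_IccI)
      have "continuous_on {0..1/2} x" by (rule continuous_on_subset[OF cx]) auto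
      then have "(x \<longlongrightarrow> x 0) (at_right 0)" by (rule continuous_on_Icc_at_rightD) simp
      then show "(y \<longlongrightarrow> y 0) (at_right 0)"
        unfolding yx[OF zero_less_one] by (rule Lim_transform_eventually)
          (auto simp: eventually_at_right_field y_def intro!: exI[of _ 1])
      show "(y \<longlongrightarrow> y 1) (at_left 1)"
        using Lim_transform_eventually[OF lim, of y] ev1 by (simp add: y_def eq_commute)
      fix t :: real assume t: "0 < t" "t < 1"
      have "continuous_on {0<..<1} x" by (rule continuous_on_subset[OF cx]) auto
      then have "(x \<longlongrightarrow> x t) (at t)" using t by (simp add: continuous_on_eq_continuous_at isCont_def)
      moreover have "eventually (\<lambda>s. x s = y s) (at t)"
        by (rule eventually_at_in_open'[of "{..<1}", THEN eventually_mono]) (use t in \<open>auto simp: y_def\<close>)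
      ultimately show "y \<midarrow>t\<rightarrow> y t" unfolding yx[OF t(2)] by (rule Lim_transform_eventually)
    qed simp
    have "y ` {0..1} \<subseteq> U"
    proof -
      have "x t \<in> U" if "0 \<le> t" "t < 1" for t unfolding x_def by (rule disc_coverD(3)[OF k Gtb[OF that]])
      then show ?thesis using l(1) by (auto simp: y_def)
    qed
    moreover have "k 0 = y 0" using G0 by (simp add: y_def x_def)
    ultimately obtain c where c: "continuous_on {0..1} c" "c ` {0..1} \<subseteq> ball 0 1" "c 0 = 0" "\<And>t. t \<in> {0..1} \<Longrightarrow> k (c t) = y t"
      using disc_cover_lift_path[OF k cy, of 0] by (metis centre_in_ball zero_less_one)
    have eq: "c t = G (t *\<^sub>R \<zeta>)" if "t \<in> {0..<1}" for t
    proof (rule disc_cover_unique_lift[OF k, of "{0..<1}" c "\<lambda>t. G (t *\<^sub>R \<zeta>)" 0])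
      show "continuous_on {0..<1} c" by (rule continuous_on_subset[OF c(1)]) auto
      show "c ` {0..<1} \<subseteq> ball 0 1" using c(2) by (auto simp: image_subset_iff)
      show "(\<lambda>t. G (t *\<^sub>R \<zeta>)) ` {0..<1} \<subseteq> ball 0 1" using Gtb by (auto simp: image_subset_iff)
      show "k (c t) = k (G (t *\<^sub>R \<zeta>))" if "t \<in> {0..<1}" for t
        using c(4)[of t] that by (simp add: y_def x_def)
    qed (use cGt c(3) G0 that in auto)
    have c1: "c 1 \<in> ball 0 1" using c(2) by (simp add: image_subset_iff)
    have "(c \<longlongrightarrow> c 1) (at 1 within {0..1})" using c(1) unfolding continuous_on_def by simp
    then have "(c \<longlongrightarrow> c 1) (at_left 1)" by (simp add: at_within_Icc_at_left)
    moreover have "eventually (\<lambda>t. c t = G (t *\<^sub>R \<zeta>)) (at_left 1)"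
      using eq by (auto simp: eventually_at_left_field intro!: exI[of _ 0])
    ultimately have "((\<lambda>t. G (t *\<^sub>R \<zeta>)) \<longlongrightarrow> c 1) (at_left 1)" by (rule Lim_transform_eventually)
    then show ?thesis using c1 by blast
  qed
  have loc: "\<exists>d>0. \<exists>s N. continuous_on (ball (F e) d) s \<and> s ` ball (F e) d \<subseteq> ball 0 1 \<and>
      (\<forall>z\<in>ball (F e) d. F (s z) = z) \<and> openin (top_of_set (ball 0 1)) N \<and> e \<in> N \<and> (\<forall>e'\<in>N. s (F e') = e')"
    if e: "e \<in> ball 0 1" for e
  proof -
    obtain d s N where s: "0 < d" "continuous_on (ball (F e) d) s" "s ` ball (F e) d \<subseteq> ball 0 1"
      "\<And>z. z \<in> ball (F e) d \<Longrightarrow> F (s z) = z" "open N" "N \<subseteq> ball 0 1" "e \<in> N" "\<And>e'. e' \<in> N \<Longrightarrow> s (F e') = e'"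
      using locally_injective_local_section[OF F(1) open_ball e F(4)[OF e]] by metis
    have oN: "openin (top_of_set (ball 0 1)) N" using s(5,6) by (metis Int_absorb1 openin_open_Int)
    show ?thesis
      by (intro exI[of _ d] exI[of _ s] exI[of _ N] conjI ballI s(1,2,3) s(4) oN s(7) s(8))
  qed
  have cF: "continuous_on (ball 0 1) F" by (rule holomorphic_on_imp_continuous_on[OF F(1)])
  have z0: "(0::complex) \<in> ball 0 1" by simp
  obtain G where G: "continuous_on (ball 0 1) G" "G ` ball 0 1 \<subseteq> ball 0 1" "\<forall>z\<in>ball 0 1. F (G z) = z" "G 0 = 0"
  proof (rule section_over_ball[of "ball 0 1" F 1 0, OF cF _ _ z0 F(3) zero_less_one])
    fix e :: complex assume "e \<in> ball 0 1"
    then show "\<exists>d>0. \<exists>s N. continuous_on (ball (F e) d) s \<and> s ` ball (F e) d \<subseteq> ball 0 1 \<and>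
      (\<forall>z\<in>ball (F e) d. F (s z) = z) \<and> openin (top_of_set (ball 0 1)) N \<and> e \<in> N \<and> (\<forall>e'\<in>N. s (F e') = e')"
      by (rule loc)
  next
    fix R :: real and G :: "complex \<Rightarrow> complex" and \<zeta> :: complex
    assume "0 < R" "R < 1" "continuous_on (ball 0 R) G" "G ` ball 0 R \<subseteq> ball 0 1" "\<forall>z\<in>ball 0 R. F (G z) = z"
      "G 0 = 0" "norm \<zeta> = R"
    then show "\<exists>e\<in>ball 0 1. ((\<lambda>t. G (t *\<^sub>R \<zeta>)) \<longlongrightarrow> e) (at_left 1)"
      by (rule ray)
  qed (rule that)
  have Gh: "G holomorphic_on ball 0 1" unfolding holomorphic_on_open[OF open_ball] using derG[OF G(1-3)] by blast
  have "deriv G 0 = inverse (deriv F 0)" using DERIV_imp_deriv[OF derG[OF G(1-3) z0]] G(4) by simp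
  moreover have "cmod (deriv G 0) \<le> 1"
    by (rule Schwarz_Lemma(2)[where \<xi> = 0, OF Gh G(4)]) (use G(2) in \<open>auto simp: image_subset_iff\<close>)
  moreover have "cmod (deriv F 0) \<le> 1"
    by (rule Schwarz_Lemma(2)[where \<xi> = 0, OF F(1,3)]) (use F(2) in \<open>auto simp: image_subset_iff\<close>)
  moreover have "1 \<le> b" if "a = inverse b" "a \<le> 1" "0 < b" for a b :: real
    using that by (simp add: inverse_le_1_iff)
  ultimately have "cmod (deriv F 0) = 1" using F(4)[OF z0] by (metis antisym norm_inverse zero_less_norm_iff)
  then show ?thesis using F(5)[OF z0] F(3) by simp
qed

theorem hyperbolic_metric_poincare:
  assumes \<rho>: "is_hyperbolic_metric U A \<rho>"
  shows "poincare_metric U A \<rho>"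
  unfolding poincare_metric_def
proof (intro conjI allI impI)
  show cm: "conformal_metric A \<rho>" by (rule is_hyperbolic_metricD(1)[OF \<rho>])
  fix k and z :: complex assume k: "disc_cover U A k" and z: "z \<in> ball 0 1"
  then have z1: "cmod z < 1" by simp
  note M = Moebius_props[OF z1]
  have "pull A \<rho> (k \<circ> Moebius_function 0 (- z)) 0 = 2"
    by (rule hyperbolic_metric_pull_0[OF \<rho> disc_cover_Moebius[OF k z1]])
  moreover have "pull A \<rho> (k \<circ> Moebius_function 0 (- z)) 0 = pull A \<rho> k z * cmod (of_real (1 - (cmod z)\<^sup>2))"
    using pull_compose[OF cm disc_coverD(1)[OF k] M(1,2) open_ball, of 0] M(3,4) by simp
  moreover have "cmod (complex_of_real (1 - (cmod z)\<^sup>2)) = 1 - (cmod z)\<^sup>2" "1 - (cmod z)\<^sup>2 \<noteq> 0"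
    unfolding norm_of_real using disc_norm_sq[OF z] by simp_all
  ultimately show "pull A \<rho> k z = 2 / (1 - (cmod z)\<^sup>2)" by (simp add: eq_divide_eq del: of_real_diff)
qed

corollary hyperbolic_metric_is_poincare: "poincare_metric U A (hyperbolic_metric U A)"
  unfolding hyperbolic_metric_def
  by (rule hyperbolic_metric_poincare, rule someI[of "is_hyperbolic_metric U A"], rule hyperbolic_metric_exists)

end

section \<open>Quantitative forms of the Schwarz lemma\<close>

section \<open>Self-maps of the disc that are almost rotations\<close>

text \<open>Unless \<open>h\<close> is a rotation, q z = h z / z maps the disc into itself. The
  Schwarz-Pick inequality keeps q z close to q 0 = h' 0, so for fixed z the bound tends to |z| as
  |h' 0| tends to 1.\<close>

lemma disc_selfmap_lower_bound:
  assumes h: "h holomorphic_on ball 0 1" "h 0 = 0" "\<And>z. cmod z < 1 \<Longrightarrow> cmod (h z) < 1"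
    and z: "cmod z < 1"
  shows "cmod z * (cmod (deriv h 0) - cmod z * (1 - (cmod (deriv h 0))\<^sup>2) / (1 - cmod z)) \<le> cmod (h z)"
proof -
  define a where "a = cmod (deriv h 0)"
  have a1: "a \<le> 1" unfolding a_def by (rule Schwarz_Lemma(2)[OF h z])
  show ?thesis
  proof (cases "a = 1")
    case True
    then obtain \<alpha> where "h z = \<alpha> * z" "cmod \<alpha> = 1" using Schwarz_Lemma(3)[OF h z] z unfolding a_def by blast
    then show ?thesis using True unfolding a_def[symmetric] by (simp add: norm_mult)
  next
    case False
    obtain q where q: "q holomorphic_on ball 0 1" "\<And>z. cmod z < 1 \<Longrightarrow> h z = z * q z" "deriv h 0 = q 0"
      using Schwarz3[OF h(1,2)] by metis
    have q1: "cmod (q w) < 1" if w: "cmod w < 1" for w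
    proof (cases "w = 0")
      case True
      then show ?thesis using False a1 q(3) by (simp add: a_def)
    next
      case w0: False
      have "cmod (h w) \<noteq> cmod w"
      proof
        assume "cmod (h w) = cmod w"
        then obtain \<alpha> where al: "\<forall>z. cmod z < 1 \<longrightarrow> h z = \<alpha> * z" "cmod \<alpha> = 1"
          using Schwarz_Lemma(3)[OF h z] w w0 by blast
        have "(h has_field_derivative \<alpha>) (at 0)"
        proof (rule has_field_derivative_transform_within_open[of "\<lambda>z. \<alpha> * z" _ _ "ball 0 1"])
          show "((\<lambda>z. \<alpha> * z) has_field_derivative \<alpha>) (at 0)" by (auto intro!: derivative_eq_intros)
        qed (use al in auto)
        then show False using al(2) False by (simp add: a_def DERIV_imp_deriv)
      qed
      moreover have "cmod (h w) \<le> cmod w" by (rule Schwarz_Lemma(1)[OF h w])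
      ultimately have "cmod w * cmod (q w) < cmod w * 1" using q(2)[OF w] by (simp add: norm_mult)
      then show ?thesis using w0 by simp
    qed
    define m where "m w = Moebius_function 0 (q 0) (q w)" for w
    have q0: "cmod (q 0) < 1" using q1[of 0] by simp
    have "m holomorphic_on ball 0 1"
    proof -
      have "(Moebius_function 0 (q 0) \<circ> q) holomorphic_on ball 0 1"
        by (rule holomorphic_on_compose_gen[OF q(1) Moebius_function_holomorphic[OF q0]]) (use q1 in auto)
      then show ?thesis by (simp add: m_def[abs_def] o_def)
    qed
    moreover have "m 0 = 0" by (simp add: m_def Moebius_function_eq_zero)
    moreover have "cmod (m w) < 1" if "cmod w < 1" for w
      unfolding m_def by (rule Moebius_function_norm_lt_1[OF q0 q1[OF that]])
    ultimately have mz: "cmod (m z) \<le> cmod z" using Schwarz_Lemma(1)[of m z] z by blast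
    define r where "r = cmod z"
    have r: "0 \<le> r" "r < 1" using z by (simp_all add: r_def)
    have aq: "a = cmod (q 0)" by (simp add: a_def q(3))
    define d where "d = cmod (q z - q 0)"
    have nz: "1 - cnj (q 0) * q z \<noteq> 0"
    proof
      assume "1 - cnj (q 0) * q z = 0"
      then have "cmod (cnj (q 0) * q z) = 1" by simp
      moreover have "cmod (q 0) * cmod (q z) < 1 * 1" by (rule mult_strict_mono'[OF q0 q1[OF z]]) auto
      ultimately show False by (simp add: norm_mult)
    qed
    have "d / cmod (1 - cnj (q 0) * q z) \<le> r"
      using mz by (simp add: m_def Moebius_function_simple norm_divide d_def r_def)
    then have "d \<le> r * cmod (1 - cnj (q 0) * q z)" using nz by (simp add: divide_le_eq)
    \<comment> \<open>Written through \<open>q z - q 0\<close>, the denominator turns the estimate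
      into an inequality for \<open>d\<close> with \<open>d\<close> on both sides, which can be
      solved because r < 1.\<close>
    also have "1 - cnj (q 0) * q z = of_real (1 - a\<^sup>2) - cnj (q 0) * (q z - q 0)"
      unfolding aq of_real_diff complex_norm_square by (simp add: algebra_simps)
    also have "cmod \<dots> \<le> cmod (of_real (1 - a\<^sup>2)) + cmod (cnj (q 0) * (q z - q 0))" by (rule norm_triangle_ineq4)
    also have "cmod (complex_of_real (1 - a\<^sup>2)) = 1 - a\<^sup>2"
      unfolding norm_of_real using a1 aq by (simp add: abs_square_le_1)
    also have "cmod (cnj (q 0) * (q z - q 0)) = a * d" by (simp add: norm_mult aq d_def)
    finally have "d \<le> r * ((1 - a\<^sup>2) + a * d)" using r(1) by (simp add: mult_left_mono)
    also have "\<dots> \<le> r * ((1 - a\<^sup>2) + 1 * d)"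
      using r(1) a1 by (intro mult_left_mono add_left_mono mult_right_mono) (auto simp: d_def)
    finally have "d * (1 - r) \<le> r * (1 - a\<^sup>2)" by (simp add: algebra_simps)
    then have d: "d \<le> r * (1 - a\<^sup>2) / (1 - r)" using r(2) by (simp add: le_divide_eq)
    have "a \<le> cmod (q z) + d" unfolding aq d_def using norm_triangle_ineq2[of "q 0" "q z"] by (simp add: norm_minus_commute)
    then have "a - r * (1 - a\<^sup>2) / (1 - r) \<le> cmod (q z)" using d by linarith
    then have "r * (a - r * (1 - a\<^sup>2) / (1 - r)) \<le> r * cmod (q z)" using r(1) by (rule mult_left_mono)
    then show ?thesis unfolding a_def[symmetric] r_def[symmetric] q(2)[OF z] by (simp add: norm_mult r_def)
  qed
qed

text \<open>On the circle of radius \<open>r\<close> the modulus of \<open>h\<close> is at least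
  \<open>s\<close>; an open map fixing 0 then covers the disc of radius \<open>s\<close>.\<close>

lemma disc_selfmap_image_ball:
  assumes h: "h holomorphic_on ball 0 1" "h 0 = 0" "\<And>z. cmod z < 1 \<Longrightarrow> cmod (h z) < 1"
    and r: "0 < r" "r < 1" and s: "0 < s"
    and le: "s \<le> r * (cmod (deriv h 0) - r * (1 - (cmod (deriv h 0))\<^sup>2) / (1 - r))"
  shows "ball 0 s \<subseteq> h ` cball 0 r"
proof -
  have sub: "cball 0 r \<subseteq> ball (0::complex) 1" using r by auto
  have "ball (h 0) s \<subseteq> h ` cball 0 r"
  proof (rule ball_subset_open_map_image)
    show "continuous_on (closure (cball 0 r)) h"
      using holomorphic_on_imp_continuous_on[OF h(1)] sub by (auto intro: continuous_on_subset)
    have lb: "s \<le> cmod (h z)" if "cmod z = r" for z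
      using disc_selfmap_lower_bound[OF h, of z] that r le by simp
    have "\<not> h constant_on ball 0 1"
    proof
      assume "h constant_on ball 0 1"
      then have "h (of_real r) = h 0" unfolding constant_on_def using r by auto
      then show False using lb[of "of_real r"] r s h(2) by simp
    qed
    then show "open (h ` interior (cball 0 r))"
      using open_mapping_thm[OF h(1) open_ball _ open_ball, of "0" r] r by (auto simp: subset_ball)
    show "s \<le> cmod (h z - h 0)" if "z \<in> frontier (cball 0 r)" for z
      using lb[of z] that r h(2) by (simp add: dist_norm)
  qed (use r s in auto)
  then show ?thesis using h(2) by simp
qed

text \<open>Each factor is the ratio of consecutive partial products, and these decrease to a limit
  that is at least \<open>s\<close>, hence not 0.\<close>

lemma factors_tendsto_1:
  fixes a :: "nat \<Rightarrow> real"
  assumes a: "\<And>n. 0 \<le> a n" "\<And>n. a n \<le> 1" and s: "0 < s" "\<And>n. s \<le> (\<Prod>j<n. a j)"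
  shows "a \<longlonglongrightarrow> 1"
proof -
  define p where "p n = (\<Prod>j<n. a j)" for n
  have ps: "p (Suc n) = p n * a n" for n by (simp add: p_def)
  have pos: "0 < p n" for n using s less_le_trans unfolding p_def by blast
  have "decseq p" unfolding decseq_Suc_iff ps using a(2) pos by (simp add: mult_left_le less_imp_le)
  then obtain L where L: "p \<longlonglongrightarrow> L" using decseq_convergent[of p s] s(2) unfolding p_def by blast
  have "s \<le> L" by (rule LIMSEQ_le_const[OF L]) (use s(2) in \<open>auto simp: p_def\<close>)
  then have L0: "L \<noteq> 0" using s(1) by simp
  have "(\<lambda>n. p (Suc n) / p n) \<longlonglongrightarrow> L / L" by (rule tendsto_divide[OF LIMSEQ_Suc[OF L] L L0])
  moreover have "p (Suc n) / p n = a n" for n using pos[of n] ps[of n] by simp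
  ultimately show ?thesis using L0 by simp
qed

section \<open>The two dynamical statements\<close>

section \<open>Iteration of a holomorphic covering\<close>

locale hyp_covering = hyp_surface U A for U :: "'a::t2_space set" and A +
  fixes U' :: "'a set" and f :: "'a \<Rightarrow> 'a"
  assumes U': "openin (top_of_set U) U'" and f: "holomorphic_covering U' (restrict_atlas A U') U A f"
begin

lemma U'_subset: "U' \<subseteq> U" using U' openin_subset by fastforce

lemma f_covering: "covering_space U' f U" using f unfolding holomorphic_covering_def by blast

lemma f_into: "x \<in> U' \<Longrightarrow> f x \<in> U"
  using covering_space_imp_surjective[OF f_covering] by blast

lemma f_chart:
  assumes V: "(V, \<phi>) \<in> A" "(V', \<psi>) \<in> A"
  shows "(\<psi> \<circ> f \<circ> inv_into (V \<inter> U') \<phi>) holomorphic_on \<phi> ` ((V \<inter> U') \<inter> f -` V')"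
proof -
  have *: "\<forall>(V, \<phi>)\<in>restrict_atlas A U'. \<forall>(V', \<psi>)\<in>A. (\<psi> \<circ> f \<circ> inv_into V \<phi>) holomorphic_on \<phi> ` (V \<inter> f -` V')"
    using f unfolding holomorphic_covering_def holomorphic_map_def by (elim conjE)
  have "(V \<inter> U', \<phi>) \<in> restrict_atlas A U'" using V(1) unfolding restrict_atlas_def by (rule rev_image_eqI) simp
  from bspec[OF * this] have "\<forall>(V', \<psi>)\<in>A. (\<psi> \<circ> f \<circ> inv_into (V \<inter> U') \<phi>) holomorphic_on \<phi> ` ((V \<inter> U') \<inter> f -` V')" by simp
  from bspec[OF this V(2)] show ?thesis by simp
qed

lemma holo_into_f:
  assumes g: "holo_into U A S g" and gU': "g ` S \<subseteq> U'"
  shows "holo_into U A S (f \<circ> g)"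
  unfolding holo_into_def
proof (intro conjI)
  show S: "open S" using g unfolding holo_into_def by blast
  have cg: "continuous_on S g" using g unfolding holo_into_def by blast
  show c: "continuous_on S (f \<circ> g)"
    by (rule continuous_on_compose[OF cg continuous_on_subset[OF covering_space_imp_continuous[OF f_covering] gU']])
  show im: "(f \<circ> g) ` S \<subseteq> U" using gU' f_into by auto
  show "\<forall>(V', \<psi>)\<in>A. (\<psi> \<circ> (f \<circ> g)) holomorphic_on (S \<inter> (f \<circ> g) -` V')"
  proof (rule ballI, clarify)
    fix V' \<psi> assume V': "(V', \<psi>) \<in> A"
    have "(\<psi> \<circ> (f \<circ> g)) field_differentiable (at z)" if z: "z \<in> S \<inter> (f \<circ> g) -` V'" for z
    proof -
      have "g z \<in> U" using g z unfolding holo_into_def by blast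
      then obtain V \<phi> where V: "(V, \<phi>) \<in> A" "g z \<in> V" by (rule ex_chart)
      define M where "M = (S \<inter> g -` V) \<inter> (S \<inter> (f \<circ> g) -` V')"
      have M: "open M" unfolding M_def
        by (intro open_Int holo_chart(2)[OF g V(1)] open_preimage[OF S c im chart_openin[OF V']])
      have "(\<phi> \<circ> g) holomorphic_on M"
        using holo_chart(1)[OF g V(1)] by (rule holomorphic_on_subset) (auto simp: M_def)
      moreover have "(\<phi> \<circ> g) ` M \<subseteq> \<phi> ` ((V \<inter> U') \<inter> f -` V')" using gU' by (auto simp: M_def)
      ultimately have "((\<psi> \<circ> f \<circ> inv_into (V \<inter> U') \<phi>) \<circ> (\<phi> \<circ> g)) holomorphic_on M"
        using holomorphic_on_compose_gen f_chart[OF V(1) V'] by blast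
      moreover have "((\<psi> \<circ> f \<circ> inv_into (V \<inter> U') \<phi>) \<circ> (\<phi> \<circ> g)) w = (\<psi> \<circ> (f \<circ> g)) w" if w: "w \<in> M" for w
      proof -
        have "inj_on \<phi> (V \<inter> U')" using chart_inj[OF V(1)] by (rule inj_on_subset) blast
        moreover have "g w \<in> V \<inter> U'" using w gU' by (auto simp: M_def)
        ultimately have "inv_into (V \<inter> U') \<phi> (\<phi> (g w)) = g w" by (rule inv_into_f_f)
        then show ?thesis by simp
      qed
      ultimately have "(\<psi> \<circ> (f \<circ> g)) holomorphic_on M" by (rule holomorphic_transform)
      then show ?thesis by (rule holomorphic_on_imp_differentiable_at[OF _ M]) (use z V(2) in \<open>auto simp: M_def\<close>)
    qed
    then show "(\<psi> \<circ> (f \<circ> g)) holomorphic_on (S \<inter> (f \<circ> g) -` V')"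
      by (simp add: holomorphic_on_def field_differentiable_at_within)
  qed
qed

text \<open>\<open>k'\<close> is lifted through \<open>f\<close> and then through \<open>k\<close>,
  so \<open>h\<close> runs against the dynamics. Holomorphy comes in one go from viewing
  \<open>h\<close> as a lift of \<open>k'\<close> through the locally injective composite of
  \<open>k\<close> and \<open>f\<close>.\<close>

lemma lift_through_f:
  assumes k: "disc_cover U A k" "k 0 \<in> U'" and k': "disc_cover U A k'" "k' 0 = f (k 0)"
  obtains h where "h holomorphic_on ball 0 1" "h ` ball 0 1 \<subseteq> ball 0 1" "h 0 = 0"
    "\<And>z. z \<in> ball 0 1 \<Longrightarrow> k (h z) \<in> U'" "\<And>z. z \<in> ball 0 1 \<Longrightarrow> f (k (h z)) = k' z"
proof -
  have z0: "(0::complex) \<in> ball 0 1" by simp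
  have "k' ` ball 0 1 \<subseteq> U" using disc_coverD(3)[OF k'(1)] by blast
  then obtain g where g: "continuous_on (ball 0 1) g" "g ` ball 0 1 \<subseteq> U'" "g 0 = k 0" "\<forall>z\<in>ball 0 1. f (g z) = k' z"
    using covering_space_lift_ball[OF f_covering zero_less_one disc_coverD(4)[OF k'(1)] _ k(2)] k'(2) by metis
  have "g ` ball 0 1 \<subseteq> U" using g(2) U'_subset by blast
  then obtain h where h: "continuous_on (ball 0 1) h" "h ` ball 0 1 \<subseteq> ball 0 1" "h 0 = 0" "\<And>z. z \<in> ball 0 1 \<Longrightarrow> k (h z) = g z"
    using disc_cover_lift[OF k(1) zero_less_one g(1) _ z0] g(3) by metis
  have kU': "k (h z) \<in> U'" if "z \<in> ball 0 1" for z using h(4)[OF that] g(2) that by auto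
  have fk: "f (k (h z)) = k' z" if "z \<in> ball 0 1" for z using h(4)[OF that] g(4) that by simp
  define \<Omega> where "\<Omega> = ball 0 1 \<inter> k -` U'"
  have \<Omega>: "open \<Omega>" unfolding \<Omega>_def by (rule holo_open_preimage[OF disc_coverD(1)[OF k(1)] U'])
  have k\<Omega>: "holo_into U A \<Omega> k" by (rule holo_into_subset[OF disc_coverD(1)[OF k(1)] \<Omega>]) (simp add: \<Omega>_def)
  have P: "holo_into U A \<Omega> (f \<circ> k)" by (rule holo_into_f[OF k\<Omega>]) (auto simp: \<Omega>_def)
  have "locally_inj \<Omega> (f \<circ> k)" unfolding locally_inj_def
  proof
    fix z assume z: "z \<in> \<Omega>"
    then have zb: "z \<in> ball 0 1" "k z \<in> U'" by (auto simp: \<Omega>_def)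
    obtain N where N: "open N" "z \<in> N" "N \<subseteq> ball 0 1" "inj_on k N"
      using disc_coverD(2)[OF k(1)] zb(1) unfolding locally_inj_def by blast
    obtain T u q where T: "k z \<in> T" "openin (top_of_set U') T" "homeomorphism T u f q"
      using covering_space_local_homeomorphism[OF f_covering zb(2)] by metis
    have "openin (top_of_set U) T" using T(2) U' by (rule openin_trans)
    then have op: "open (\<Omega> \<inter> k -` T)" by (rule holo_open_preimage[OF k\<Omega>])
    have "inj_on f T" using T(3) unfolding homeomorphism_def by (metis inj_on_inverseI)
    then have "inj_on (f \<circ> k) (N \<inter> (\<Omega> \<inter> k -` T))"
      using N(4) by (intro comp_inj_on) (auto intro: inj_on_subset)
    moreover have "open (N \<inter> (\<Omega> \<inter> k -` T))" using N(1) op by (rule open_Int)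
    ultimately show "\<exists>N. open N \<and> z \<in> N \<and> N \<subseteq> \<Omega> \<and> inj_on (f \<circ> k) N"
      using z N(2) T(1) by (intro exI[of _ "N \<inter> (\<Omega> \<inter> k -` T)"]) auto
  qed
  moreover have "h ` ball 0 1 \<subseteq> \<Omega>" using h(2) kU' by (auto simp: \<Omega>_def image_subset_iff)
  ultimately have "h holomorphic_on ball 0 1"
    by (rule lift_holomorphic[OF P _ disc_coverD(1)[OF k'(1)] h(1)]) (simp add: fk)
  then show ?thesis using that h(2,3) kU' fk by blast
qed

end

locale hyp_wandering = hyp_covering U A U' f for U :: "'a::t2_space set" and A U' f +
  fixes W :: "'a set" and w :: 'a
  assumes W: "openin (top_of_set U) W" "\<And>n. (f ^^ n) ` W \<subseteq> U'" and w: "w \<in> W"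
begin

lemma orbit_coverings:
  obtains k h s where "\<And>n. disc_cover U A (k n)" "\<And>n. k n 0 = (f ^^ n) w"
    "\<And>n. h n holomorphic_on ball 0 1" "\<And>n. h n ` ball 0 1 \<subseteq> ball 0 1" "\<And>n. h n 0 = 0"
    "\<And>n z. z \<in> ball 0 1 \<Longrightarrow> k n (h n z) \<in> U'" "\<And>n z. z \<in> ball 0 1 \<Longrightarrow> f (k n (h n z)) = k (Suc n) z"
    "0 < s" "s < 1" "k 0 ` ball 0 s \<subseteq> W"
proof -
  have orb: "(f ^^ n) w \<in> U'" for n using W(2) w by blast
  have "\<exists>k. disc_cover U A k \<and> k 0 = (f ^^ n) w" for n
    using hyperbolic_surface_disc_cover[OF hyp, of "(f ^^ n) w"] orb U'_subset by blast
  then obtain k where k: "\<And>n. disc_cover U A (k n)" "\<And>n. k n 0 = (f ^^ n) w" by metis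
  have "\<exists>h. h holomorphic_on ball 0 1 \<and> h ` ball 0 1 \<subseteq> ball 0 1 \<and> h 0 = 0 \<and>
    (\<forall>z\<in>ball 0 1. k n (h z) \<in> U') \<and> (\<forall>z\<in>ball 0 1. f (k n (h z)) = k (Suc n) z)" for n
  proof -
    have k0: "k n 0 \<in> U'" "k (Suc n) 0 = f (k n 0)" using k(2) orb by simp_all
    obtain h where "h holomorphic_on ball 0 1" "h ` ball 0 1 \<subseteq> ball 0 1" "h 0 = 0"
      "\<And>z. z \<in> ball 0 1 \<Longrightarrow> k n (h z) \<in> U'" "\<And>z. z \<in> ball 0 1 \<Longrightarrow> f (k n (h z)) = k (Suc n) z"
      by (rule lift_through_f[OF k(1) k0(1) k(1) k0(2)], rule that) (assumption | blast)+
    then show ?thesis by blast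
  qed
  then obtain h where h: "\<And>n. h n holomorphic_on ball 0 1 \<and> h n ` ball 0 1 \<subseteq> ball 0 1 \<and> h n 0 = 0 \<and>
    (\<forall>z\<in>ball 0 1. k n (h n z) \<in> U') \<and> (\<forall>z\<in>ball 0 1. f (k n (h n z)) = k (Suc n) z)" by metis
  have "open (ball 0 1 \<inter> k 0 -` W)" by (rule holo_open_preimage[OF disc_coverD(1)[OF k(1)] W(1)])
  moreover have "0 \<in> ball 0 1 \<inter> k 0 -` W" using k(2)[of 0] w by simp
  ultimately obtain s0 where s0: "0 < s0" "ball 0 s0 \<subseteq> ball 0 1 \<inter> k 0 -` W" by (meson openE)
  define s where "s = min s0 (1/2)"
  have "0 < s" "s < 1" "k 0 ` ball 0 s \<subseteq> W" using s0 by (auto simp: s_def subset_iff)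
  then show ?thesis using that[OF k] h by blast
qed

lemma iterates_contain_disc:
  assumes k: "\<And>n. disc_cover U A (k n)"
    and h: "\<And>n. h n holomorphic_on ball 0 1" "\<And>n. h n ` ball 0 1 \<subseteq> ball 0 1" "\<And>n. h n 0 = 0"
      "\<And>n z. z \<in> ball 0 1 \<Longrightarrow> f (k n (h n z)) = k (Suc n) z"
    and s: "s < 1" "k 0 ` ball 0 s \<subseteq> W"
  shows "k n ` ball 0 s \<subseteq> (f ^^ n) ` W"
proof (induction n)
  case 0
  then show ?case using s by simp
next
  case (Suc n)
  show ?case
  proof
    fix y assume "y \<in> k (Suc n) ` ball 0 s"
    then obtain z where z: "z \<in> ball 0 s" "y = k (Suc n) z" by blast
    have z1: "z \<in> ball 0 1" using z(1) s(1) by auto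
    have "cmod (h n z) \<le> cmod z"
      by (rule Schwarz_Lemma(1)[OF h(1,3)]) (use h(2)[of n] z1 in \<open>auto simp: image_subset_iff\<close>)
    then have "h n z \<in> ball 0 s" using z(1) by simp
    then have "k n (h n z) \<in> (f ^^ n) ` W" using Suc.IH by blast
    then have "f (k n (h n z)) \<in> (f ^^ Suc n) ` W" by auto
    then show "y \<in> (f ^^ Suc n) ` W" using h(4)[OF z1] z(2) by simp
  qed
qed

lemma transition_derivatives_tendsto_1:
  assumes k: "\<And>n. disc_cover U A (k n)" "\<And>n. k n 0 = (f ^^ n) w"
    and h: "\<And>n. h n holomorphic_on ball 0 1" "\<And>n. h n ` ball 0 1 \<subseteq> ball 0 1" "\<And>n. h n 0 = 0"
      "\<And>n z. z \<in> ball 0 1 \<Longrightarrow> f (k n (h n z)) = k (Suc n) z"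
    and s: "0 < s" "s < 1" "k 0 ` ball 0 s \<subseteq> W"
  shows "(\<lambda>n. cmod (deriv (h n) 0)) \<longlonglongrightarrow> 1"
proof -
  have hb: "cmod z < 1 \<Longrightarrow> cmod (h n z) < 1" for n z using h(2)[of n] by (auto simp: image_subset_iff)
  have sub: "ball 0 s \<subseteq> ball (0::complex) 1" using s(2) by auto
  have z0: "(0::complex) \<in> ball 0 s" using s(1) by simp
  \<comment> \<open>The composite of h 0, ..., h (n - 1) with the newest factor innermost, so that
    \<open>k n\<close> is \<open>H n\<close> followed by \<open>k 0\<close> and the n-th
    iterate.\<close>
  define H where "H = rec_nat id (\<lambda>n g. g \<circ> h n)"
  have H0: "H 0 = id" and HS: "H (Suc n) = H n \<circ> h n" for n by (simp_all add: H_def)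
  have H: "H n holomorphic_on ball 0 1 \<and> H n ` ball 0 1 \<subseteq> ball 0 1 \<and> H n 0 = 0 \<and>
      deriv (H n) 0 = (\<Prod>j<n. deriv (h j) 0) \<and> (\<forall>z\<in>ball 0 1. (f ^^ n) (k 0 (H n z)) = k n z)" for n
  proof (induction n)
    case 0
    show ?case by (simp add: H0 holomorphic_on_ident id_def)
  next
    case (Suc n)
    then have IH: "H n holomorphic_on ball 0 1" "H n ` ball 0 1 \<subseteq> ball 0 1" "H n 0 = 0"
      "deriv (H n) 0 = (\<Prod>j<n. deriv (h j) 0)" "\<And>z. z \<in> ball 0 1 \<Longrightarrow> (f ^^ n) (k 0 (H n z)) = k n z" by blast+
    have z0: "(0::complex) \<in> ball 0 1" by simp
    have "(H n has_field_derivative deriv (H n) 0) (at (h n 0))"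
      using holomorphic_derivI[OF IH(1) open_ball z0] h(3) by simp
    from DERIV_chain[OF this holomorphic_derivI[OF h(1) open_ball z0]]
    have "deriv (H (Suc n)) 0 = deriv (H n) 0 * deriv (h n) 0" unfolding HS by (rule DERIV_imp_deriv)
    moreover have "(f ^^ Suc n) (k 0 (H (Suc n) z)) = k (Suc n) z" if z: "z \<in> ball 0 1" for z
    proof -
      have "h n z \<in> ball 0 1" using h(2) z by blast
      then show ?thesis using IH(5) h(4)[OF z] by (simp add: HS)
    qed
    moreover have "H (Suc n) holomorphic_on ball 0 1" unfolding HS
      by (rule holomorphic_on_compose_gen[OF h(1) IH(1) h(2)])
    moreover have "H (Suc n) ` ball 0 1 \<subseteq> ball 0 1" using IH(2) h(2) unfolding HS image_comp[symmetric] by blast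
    moreover have "H (Suc n) 0 = 0" using IH(3) h(3) by (simp add: HS)
    ultimately show ?case using IH(4) by simp
  qed
  have Hb: "cmod z < 1 \<Longrightarrow> cmod (H n z) < 1" for n z using H[of n] by (auto simp: image_subset_iff)
  have "s \<le> (\<Prod>j<n. cmod (deriv (h j) 0))" for n
  proof -
    have hol: "holo_into U A (ball 0 s) ((f ^^ n) \<circ> k 0)" for n
    proof (induction n)
      case 0
      then show ?case using holo_into_subset[OF disc_coverD(1)[OF k(1)] open_ball sub] by simp
    next
      case (Suc n)
      have "((f ^^ n) \<circ> k 0) ` ball 0 s \<subseteq> U'" using s(3) W(2)[of n] by auto
      from holo_into_f[OF Suc.IH this] show ?case by (simp only: funpow.simps(2) o_assoc)
    qed
    have "k n 0 = ((f ^^ n) \<circ> k 0) 0" using k(2) by simp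
    then obtain g where g: "g holomorphic_on ball 0 s" "g ` ball 0 s \<subseteq> ball 0 1" "g 0 = 0"
        "\<And>z. z \<in> ball 0 s \<Longrightarrow> k n (g z) = ((f ^^ n) \<circ> k 0) z"
      using disc_cover_lift_holo[OF k(1)[of n] s(1) hol[of n], of 0] by (metis centre_in_ball zero_less_one)
    have Hs: "H n z \<in> ball 0 s" if z: "z \<in> ball 0 s" for z
    proof -
      have "cmod (H n z) \<le> cmod z"
        by (rule Schwarz_Lemma(1)) (use H[of n] Hb z s(2) in auto)
      then show ?thesis using z by simp
    qed
    have cH: "continuous_on (ball 0 s) (H n)"
      using holomorphic_on_imp_continuous_on H sub continuous_on_subset by metis
    \<comment> \<open>\<open>g\<close> after \<open>H n\<close> and the identity both lift
      \<open>k n\<close> through \<open>k n\<close> and fix 0.\<close>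
    have gH: "g (H n z) = z" if z: "z \<in> ball 0 s" for z
    proof (rule disc_cover_unique_lift[OF k(1)[of n], of "ball 0 s" "\<lambda>z. g (H n z)" "\<lambda>z. z" 0])
      show "continuous_on (ball 0 s) (\<lambda>z. g (H n z))"
        by (rule continuous_on_compose2[OF holomorphic_on_imp_continuous_on[OF g(1)] cH]) (use Hs in blast)
      show "(\<lambda>z. g (H n z)) ` ball 0 s \<subseteq> ball 0 1" using g(2) Hs by blast
      show "k n (g (H n y)) = k n y" if y: "y \<in> ball 0 s" for y
      proof -
        have "y \<in> ball 0 1" using y sub by blast
        then show ?thesis using g(4)[OF Hs[OF y]] H[of n] by simp
      qed
    qed (use z z0 sub g(3) H[of n] in \<open>auto intro: continuous_intros\<close>)
    have dg: "(g has_field_derivative deriv g 0) (at 0)" by (rule holomorphic_derivI[OF g(1) open_ball z0])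
    have "(H n has_field_derivative deriv (H n) 0) (at 0)"
      by (rule holomorphic_derivI[of _ "ball 0 1"]) (use H[of n] in auto)
    then have "(g \<circ> H n has_field_derivative deriv g 0 * deriv (H n) 0) (at 0)"
      by (rule DERIV_chain[rotated]) (use dg H[of n] in simp)
    then have "((\<lambda>z. z) has_field_derivative deriv g 0 * deriv (H n) 0) (at 0)"
      by (rule has_field_derivative_transform_within_open[OF _ open_ball z0]) (simp add: gH)
    then have one: "deriv g 0 * deriv (H n) 0 = 1" using DERIV_ident DERIV_unique by blast
    \<comment> \<open>Rescaled to the unit disc, \<open>g\<close> obeys the Schwarz lemma, so |deriv
      g 0| s \<le> 1. This is the origin of the lower bound \<open>s\<close> for the
      product.\<close>
    define g' where "g' z = g (of_real s * z)" for z
    have im: "of_real s * z \<in> ball 0 s" if "z \<in> ball 0 1" for z :: complex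
      using that s(1) by (simp add: norm_mult)
    have "g' holomorphic_on ball 0 1"
    proof -
      have "(g \<circ> (\<lambda>z. of_real s * z)) holomorphic_on ball 0 1"
        by (rule holomorphic_on_compose_gen[OF _ g(1)]) (use im in \<open>auto intro!: holomorphic_intros\<close>)
      then show ?thesis by (simp add: g'_def[abs_def] o_def)
    qed
    moreover have "g' 0 = 0" by (simp add: g'_def g(3))
    moreover have "cmod (g' z) < 1" if "cmod z < 1" for z
    proof -
      have "z \<in> ball 0 1" using that by simp
      then have "g (of_real s * z) \<in> ball 0 1" using im[of z] g(2) by blast
      then show ?thesis by (simp add: g'_def)
    qed
    ultimately have "cmod (deriv g' 0) \<le> 1" by (rule Schwarz_Lemma(2)[where \<xi> = 0]) auto
    moreover have "deriv g' 0 = deriv g 0 * of_real s"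
    proof -
      have "((\<lambda>z. of_real s * z) has_field_derivative of_real s) (at (0::complex))" by (auto intro!: derivative_eq_intros)
      moreover have "(g has_field_derivative deriv g 0) (at (of_real s * 0))" using dg by simp
      ultimately have "(g' has_field_derivative deriv g 0 * of_real s) (at 0)"
        unfolding g'_def by (rule DERIV_chain2[rotated])
      then show ?thesis by (rule DERIV_imp_deriv)
    qed
    ultimately have gs: "cmod (deriv g 0) * s \<le> 1" using s(1) by (simp add: norm_mult)
    have "cmod (deriv g 0) * cmod (deriv (H n) 0) = 1" using one by (metis norm_mult norm_one)
    then have "s = (cmod (deriv g 0) * s) * cmod (deriv (H n) 0)" by (simp add: mult_ac)
    also have "\<dots> \<le> 1 * cmod (deriv (H n) 0)" using gs by (rule mult_right_mono) simp
    finally show ?thesis using H[of n] by (simp add: prod_norm)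
  qed
  moreover have "cmod (deriv (h n) 0) \<le> 1" for n
    by (rule Schwarz_Lemma(2)[where \<xi> = 0, OF h(1,3) hb]) auto
  ultimately show ?thesis by (intro factors_tendsto_1[OF _ _ s(1)]) auto
qed

lemma liminf_setdist_iterates:
  "liminf (\<lambda>n. hyp_setdist U A ((f ^^ n) w) (U - (f ^^ n) ` W)) > 0"
proof -
  obtain k h s where k: "\<And>n. disc_cover U A (k n)" "\<And>n. k n 0 = (f ^^ n) w"
    and h: "\<And>n. h n holomorphic_on ball 0 1" "\<And>n. h n ` ball 0 1 \<subseteq> ball 0 1" "\<And>n. h n 0 = 0"
    "\<And>n z. z \<in> ball 0 1 \<Longrightarrow> k n (h n z) \<in> U'" "\<And>n z. z \<in> ball 0 1 \<Longrightarrow> f (k n (h n z)) = k (Suc n) z"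
    and s: "0 < s" "s < 1" "k 0 ` ball 0 s \<subseteq> W" by (rule orbit_coverings, rule that) (assumption | blast)+
  have s2: "0 < s\<^sup>2" "s\<^sup>2 < 1" using s by (auto simp: abs_square_less_1)
  \<comment> \<open>Chosen so that the radius in \<open>poincare_metric_near\<close> is exactly
    \<open>s\<close>; it is the same for all n.\<close>
  define R where "R = - ln (1 - s\<^sup>2)"
  have R: "0 < R" "1 - exp (- R) = s\<^sup>2" using s2 by (simp_all add: R_def)
  have "ennreal R \<le> hyp_setdist U A ((f ^^ n) w) (U - (f ^^ n) ` W)" for n
    unfolding hyp_setdist_def
  proof (rule INF_greatest)
    fix y assume y: "y \<in> U - (f ^^ n) ` W"
    show "ennreal R \<le> hyp_dist U A ((f ^^ n) w) y"
    proof (rule ccontr)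
      assume "\<not> ennreal R \<le> hyp_dist U A ((f ^^ n) w) y"
      then have "metric_dist U A (hyperbolic_metric U A) (k n 0) y < ennreal R"
        by (simp add: hyp_dist_def k(2))
      then obtain \<eta> where \<eta>: "k n \<eta> = y" "(cmod \<eta>)\<^sup>2 < 1 - exp (- R)"
        using poincare_metric_near[OF hyperbolic_metric_is_poincare k(1)] by metis
      have "cmod \<eta> < s" by (rule power2_less_imp_less) (use \<eta>(2) R(2) s(1) in auto)
      then have "y \<in> k n ` ball 0 s" using \<eta>(1) by auto
      then show False using iterates_contain_disc[OF k(1) h(1,2,3,5) s(2,3), of n] y by blast
    qed
  qed
  then have "ennreal R \<le> liminf (\<lambda>n. hyp_setdist U A ((f ^^ n) w) (U - (f ^^ n) ` W))"
    by (intro Liminf_bounded) simp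
  moreover have "0 < ennreal R" using R(1) by simp
  ultimately show ?thesis by (rule less_le_trans[rotated])
qed

lemma setdist_preimage_tendsto_infinity:
  assumes n: "\<And>i. 0 < n i" "filterlim n at_top sequentially"
    and D: "(\<lambda>i. hyp_setdist U A ((f ^^ n i) w) (U - D)) \<longlonglongrightarrow> \<infinity>"
  shows "(\<lambda>i. hyp_setdist U A ((f ^^ (n i - 1)) w) (U - (U' \<inter> f -` D))) \<longlonglongrightarrow> \<infinity>"
proof (rule order_tendstoI)
  obtain k h s where k: "\<And>n. disc_cover U A (k n)" "\<And>n. k n 0 = (f ^^ n) w"
    and h: "\<And>n. h n holomorphic_on ball 0 1" "\<And>n. h n ` ball 0 1 \<subseteq> ball 0 1" "\<And>n. h n 0 = 0"
    "\<And>n z. z \<in> ball 0 1 \<Longrightarrow> k n (h n z) \<in> U'" "\<And>n z. z \<in> ball 0 1 \<Longrightarrow> f (k n (h n z)) = k (Suc n) z"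
    and s: "0 < s" "s < 1" "k 0 ` ball 0 s \<subseteq> W" by (rule orbit_coverings, rule that) (assumption | blast)+
  note lim = transition_derivatives_tendsto_1[OF k h(1,2,3,5) s]
  have hb: "cmod z < 1 \<Longrightarrow> cmod (h n z) < 1" for n z using h(2)[of n] by (auto simp: image_subset_iff)
  fix a :: ennreal assume a: "a < \<infinity>"
  then obtain b where b: "0 \<le> b" "a = ennreal b" by (cases a) auto
  \<comment> \<open>The infimum gives only \<le>; the additional 1 makes the final inequality
    strict.\<close>
  define B where "B = b + 1"
  have B: "0 < B" "a < ennreal B" using b by (auto simp: B_def ennreal_less_iff)
  define s0 where "s0 = sqrt (1 - exp (- B))"
  have s0: "0 < s0" "s0 < 1" "s0\<^sup>2 = 1 - exp (- B)" using B(1) by (auto simp: s0_def)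
  \<comment> \<open>Any radius strictly between \<open>s0\<close> and 1 would do: \<open>?q\<close>
    tends to \<open>r\<close> as the derivatives tend to 1, so it eventually exceeds
    \<open>s0\<close> and \<open>disc_selfmap_image_ball\<close> applies.\<close>
  define r where "r = (1 + s0) / 2"
  have r: "0 < r" "r < 1" "s0 < r" using s0 by (auto simp: r_def)
  define R where "R = 2 * r / (1 - r\<^sup>2)"
  let ?q = "\<lambda>n. r * (cmod (deriv (h n) 0) - r * (1 - (cmod (deriv (h n) 0))\<^sup>2) / (1 - r))"
  have "?q \<longlonglongrightarrow> r * (1 - r * (1 - 1\<^sup>2) / (1 - r))" by (intro tendsto_intros lim) (use r in auto)
  then have "\<forall>\<^sub>F n in sequentially. s0 < ?q n" using order_tendstoD(1)[of ?q _ sequentially s0] r(3) by simp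
  moreover have "filterlim (\<lambda>i. n i - 1) sequentially sequentially"
    using filterlim_compose[OF filterlim_minus_const_nat_at_top n(2)] .
  ultimately have ev1: "\<forall>\<^sub>F i in sequentially. s0 < ?q (n i - 1)" unfolding filterlim_iff by blast
  have ev2: "\<forall>\<^sub>F i in sequentially. ennreal R < hyp_setdist U A ((f ^^ n i) w) (U - D)"
    by (rule order_tendstoD(1)[OF D]) simp
  show "\<forall>\<^sub>F i in sequentially. a < hyp_setdist U A ((f ^^ (n i - 1)) w) (U - (U' \<inter> f -` D))"
    using ev1 ev2
  proof eventually_elim
    case (elim i)
    define m where "m = n i - 1"
    \<comment> \<open>Positivity of \<open>n i\<close> excludes truncation in the
      subtraction.\<close>
    have nm: "n i = Suc m" using n(1)[of i] by (simp add: m_def)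
    have img: "ball 0 s0 \<subseteq> h m ` cball 0 r"
      by (rule disc_selfmap_image_ball[OF h(1,3) hb r(1,2) s0(1)]) (use elim(1) in \<open>simp_all add: m_def\<close>)
    have "ennreal B \<le> hyp_setdist U A ((f ^^ m) w) (U - (U' \<inter> f -` D))"
      unfolding hyp_setdist_def
    proof (rule INF_greatest)
      fix y assume y: "y \<in> U - (U' \<inter> f -` D)"
      show "ennreal B \<le> hyp_dist U A ((f ^^ m) w) y"
      proof (rule ccontr)
        assume "\<not> ennreal B \<le> hyp_dist U A ((f ^^ m) w) y"
        then have "metric_dist U A (hyperbolic_metric U A) (k m 0) y < ennreal B"
          by (simp add: hyp_dist_def k(2))
        then obtain \<eta> where \<eta>: "k m \<eta> = y" "(cmod \<eta>)\<^sup>2 < 1 - exp (- B)"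
          using poincare_metric_near[OF hyperbolic_metric_is_poincare k(1)] by metis
        have "cmod \<eta> < s0" by (rule power2_less_imp_less) (use \<eta>(2) s0 in auto)
        then have "\<eta> \<in> ball 0 s0" by simp
        then obtain \<xi> where \<xi>: "\<xi> \<in> cball 0 r" "\<eta> = h m \<xi>" using img by blast
        have \<xi>1: "\<xi> \<in> ball 0 1" "cmod \<xi> \<le> r" using \<xi>(1) r(2) by auto
        have yU': "y \<in> U'" and fy: "f y = k (n i) \<xi>"
          using h(4,5)[OF \<xi>1(1), of m] \<eta>(1) \<xi>(2) nm by auto
        have "hyp_dist U A ((f ^^ n i) w) (f y) \<le> ennreal R"
          using poincare_metric_far[OF hyperbolic_metric_is_poincare k(1) \<xi>1(2) r(2), of "n i"]
          by (simp add: hyp_dist_def k(2) fy R_def)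
        \<comment> \<open>\<open>y\<close> lies in \<open>U'\<close> as a value of
          \<open>k m\<close> after \<open>h m\<close>, so being outside the preimage of
          \<open>D\<close> forces \<open>f y\<close> out of \<open>D\<close>, at distance at most
          \<open>R\<close> from the orbit point.\<close>
        moreover have "f y \<in> U - D" using y yU' f_into by blast
        then have "hyp_setdist U A ((f ^^ n i) w) (U - D) \<le> hyp_dist U A ((f ^^ n i) w) (f y)"
          unfolding hyp_setdist_def by (rule INF_lower)
        ultimately show False using elim(2) by (meson leD le_less_trans less_le_trans)
      qed
    qed
    then show ?case using B(2) unfolding m_def by (rule less_le_trans[rotated])
  qed
qed simp

end

theorem theorem4p1:
  fixes U U' W :: "'a::t2_space set"
    and A :: "'a chart set"
    and f :: "'a \<Rightarrow> 'a"
  assumes "hyperbolic_surface U A"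
    and "openin (top_of_set U) U'"
    and "holomorphic_covering U' (restrict_atlas A U') U A f"
    and "openin (top_of_set U) W" and "connected W" and "W \<subseteq> U'"
    and "\<And>n. (f ^^ n) ` W \<subseteq> U'"
  shows "(\<forall>w\<in>W. liminf (\<lambda>n. hyp_setdist U A ((f ^^ n) w) (U - (f ^^ n) ` W)) > 0) \<and>
    (\<forall>w\<in>W. \<forall>D V. \<forall>n :: nat \<Rightarrow> nat.
       openin (top_of_set U) D \<and> V = U' \<inter> f -` D \<and>
       (\<forall>k. n k > 0) \<and> filterlim n at_top sequentially \<and>
       (\<forall>k. (f ^^ n k) w \<in> D) \<and>
       (\<lambda>k. hyp_setdist U A ((f ^^ n k) w) (U - D)) \<longlonglongrightarrow> \<infinity> \<longrightarrow>
       (\<lambda>k. hyp_setdist U A ((f ^^ (n k - 1)) w) (U - V)) \<longlonglongrightarrow> \<infinity>)"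
proof -
  have loc: "hyp_wandering U A U' f W w" if "w \<in> W" for w
    using assms that by unfold_locales
  show ?thesis
  proof (intro conjI ballI allI impI; (elim conjE)?)
    fix w assume "w \<in> W"
    then interpret hyp_wandering U A U' f W w by (rule loc)
    show "liminf (\<lambda>n. hyp_setdist U A ((f ^^ n) w) (U - (f ^^ n) ` W)) > 0"
      by (rule liminf_setdist_iterates)
  next
    fix w D V and n :: "nat \<Rightarrow> nat"
    assume w: "w \<in> W" and V: "V = U' \<inter> f -` D" and n: "\<forall>k. n k > 0" "filterlim n at_top sequentially"
      and D: "(\<lambda>k. hyp_setdist U A ((f ^^ n k) w) (U - D)) \<longlonglongrightarrow> \<infinity>"
    interpret hyp_wandering U A U' f W w using w by (rule loc)
    show "(\<lambda>k. hyp_setdist U A ((f ^^ (n k - 1)) w) (U - V)) \<longlonglongrightarrow> \<infinity>"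
      unfolding V by (rule setdist_preimage_tendsto_infinity[OF _ n(2) D]) (use n(1) in blast)
  qed
qed

end
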